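(* For every planar ICIS germ $f\in R=k[[x,y]]$, we have $$\mathrm{AD}^2_{(1)}(f)=e_f,$$ where $e_f$ is the Hilbert–Samuel multiplicity of the Jacobian ideal $\left(\frac{\partial f}{\partial x},\frac{\partial f}{\partial y}\right)\subset R/(f)$. In particular, the number of $2^{\mathrm{nd}}$-order weight-$1$ inflection points limiting to this singularity in a general $1$-parameter deformation is equal to $e_f$.
   Context: $k$ is an algebraically closed field of characteristic $0$. A planar ICIS germ is $f\in R=k[[x,y]]$, $f(0)=0$, defining an isolated curve singularity; $A=R/(f)$. With $J(f)=(\partial f/\partial x,\partial f/\partial y)$, $e_f=\lim_{s\to\infty}\frac1s\dim_k R/(f,J(f)^s)$. Deformations: let $\delta_1,\dots,\delta_d\in k[[x,y]]$ represent a $k$-basis of $\mathrm{Def}^1(f)=\mathrm{Ext}^1_A(\Omega^1_{A/k},A)$ (a quotient of $A$). A $1$-parameter deformation $X/B$ of $f$, given by $(a_i)\in k^d$, has $\mathscr O_B=k[[t]]$, $\mathscr O_X=k[[x,y]][[t]]/(f+t\sum_i a_i\delta_i)$; $X_0$ is the fiber $t=0$, with ideal $I_{X_0}=(t)\subset\mathscr O_X$. Principal parts: $\mathscr P^m_{X/B}=(\mathscr O_X\widehat\otimes_{\mathscr O_B}\mathscr O_X)/I_\Delta^m$, $I_\Delta$ the ideal of the diagonal, regarded as an $\mathscr O_X$-module via the left factor. For a general deformation its dual is free of rank $m$; let $e_1,\dots,e_m$ be a basis of it. For a list $\overline\tau=(\tau_1,\dots,\tau_m)$ of elements of $\mathscr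 P^m_{X/B}$, let $I^m_{\overline\tau}\subset\mathscr O_X$ be the ideal generated by the determinant of the $m\times m$ matrix $(e_i(\tau_j))$. Automatic degeneracy: $\mathrm{AD}^m_{(1)}(f)=\min_{X/B}\min_{\overline\tau}\dim_k\mathscr O_X/(I_{X_0}+I^m_{\overline\tau})$, the minimum over $1$-parameter deformations $X/B$ of $f$ (with $(\mathscr P^m_{X/B})^\vee$ free of rank $m$) and lists $\overline\tau$ of $m$ elements of $\mathscr P^m_{X/B}$. Limiting inflection points: for a general $1$-parameter deformation $X/B$ (parameters in a suitable dense Zariski-open subset) and a list $\overline\tau$ of $m$ elements attaining the minimum defining $\mathrm{AD}^m_{(1)}(f)$, the number of $m^{\mathrm{th}}$-order weight-$1$ inflection points limiting to the singularity in a general $1$-parameter deformation is $\dim_{K}\big((\mathscr O_X/I^m_{\overline\tau})\otimes_{k[[t]]}K\big)$, where $K$ is an algebraic closure of $k((t))$. *)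

theory Defs
  imports
    "HOL-Computational_Algebra.Formal_Laurent_Series"
    "HOL-Algebra.Algebraic_Closure_Type"
    "HOL-Library.Poly_Mapping"
    "HOL-Library.Function_Algebras"
    "HOL-Library.Product_Plus"
    "HOL-Library.Extended_Nat"
    "HOL-Library.Extended_Real"
    "HOL-Library.FuncSet"
    "Jordan_Normal_Form.Determinant"
begin

text \<open>
  Quotient rings and quotient modules are handled through representatives: an element of
  \<open>V/W\<close> is given by an element of \<open>V\<close>, and an ideal of \<open>R/I\<close> by its preimage in \<open>R\<close>.
\<close>

section \<open>Quotients\<close>

definition gen_ideal :: "'r::comm_ring_1 set \<Rightarrow> 'r set" where
  "gen_ideal = Modules.module.span (*)"

fun ideal_power :: "'r::comm_ring_1 set \<Rightarrow> nat \<Rightarrow> 'r set" where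
  "ideal_power I 0 = UNIV"
| "ideal_power I (Suc n) = gen_ideal {a * b | a b. a \<in> I \<and> b \<in> ideal_power I n}"

text \<open>
  The classes of \<open>b 0, \<dots>, b (n - 1)\<close> form a basis of \<open>V/W\<close>, regarded as a module over the
  quotient of the scalar ring by the ideal \<open>I\<close> (so \<open>I = {0}\<close> for a vector space).
\<close>
definition basis_mod ::
  "('r::comm_ring_1 \<Rightarrow> 'v::ab_group_add \<Rightarrow> 'v) \<Rightarrow> 'r set \<Rightarrow> 'v set \<Rightarrow> 'v set \<Rightarrow> nat \<Rightarrow> (nat \<Rightarrow> 'v) \<Rightarrow> bool"
where
  "basis_mod scale I V W n b \<longleftrightarrow>
     (\<forall>i<n. b i \<in> V) \<and>
     (\<forall>v\<in>V. \<exists>c. v - (\<Sum>i<n. scale (c i) (b i)) \<in> W) \<and>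
     (\<forall>c. (\<Sum>i<n. scale (c i) (b i)) \<in> W \<longrightarrow> (\<forall>i<n. c i \<in> I))"

text \<open>The dimension of \<open>V/W\<close>, where \<open>V\<close> is the whole type; \<open>\<infinity>\<close> if there is no finite basis.\<close>
definition quot_dim :: "('c::field \<Rightarrow> 'v::ab_group_add \<Rightarrow> 'v) \<Rightarrow> 'v set \<Rightarrow> enat" where
  "quot_dim scale W = Inf {enat n | n. \<exists>b. basis_mod scale {0} UNIV W n b}"

text \<open>
  \<open>\<phi>\<close> represents a homomorphism \<open>L/N \<rightarrow> R/I\<close> of \<open>R\<close>-modules, where \<open>N \<subseteq> L\<close>. The values of
  \<open>\<phi>\<close> outside \<open>L\<close> are irrelevant.
\<close>
definition hom_mod ::
  "('r::comm_ring_1 \<Rightarrow> 'v::ab_group_add \<Rightarrow> 'v) \<Rightarrow> 'v set \<Rightarrow> 'v set \<Rightarrow> 'r set \<Rightarrow> ('v \<Rightarrow> 'r) set"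
where
  "hom_mod scale L N I = {\<phi>.
     (\<forall>u\<in>L. \<forall>v\<in>L. \<phi> (u + v) - (\<phi> u + \<phi> v) \<in> I) \<and>
     (\<forall>r. \<forall>v\<in>L. \<phi> (scale r v) - r * \<phi> v \<in> I) \<and>
     (\<forall>v\<in>N. \<phi> v \<in> I)}"

text \<open>
  The dimension over \<open>K\<close> of \<open>(M/Q) \<otimes>\<^bsub>B\<^esub> K\<close>, for a ring homomorphism \<open>\<beta> : B \<rightarrow> K\<close> and a
  \<open>B\<close>-module \<open>M\<close> with submodule \<open>Q\<close>: the tensor product is the free \<open>K\<close>-vector space on the
  symbols \<open>m \<otimes> 1\<close> modulo the usual relations.
\<close>
definition pm_scale :: "'c::field \<Rightarrow> ('m \<Rightarrow>\<^sub>0 'c) \<Rightarrow> ('m \<Rightarrow>\<^sub>0 'c)" where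
  "pm_scale c = Poly_Mapping.map (\<lambda>x. c * x)"

definition base_change_relations ::
  "('b \<Rightarrow> 'm::ab_group_add \<Rightarrow> 'm) \<Rightarrow> ('b \<Rightarrow> 'c::field) \<Rightarrow> 'm set \<Rightarrow> ('m \<Rightarrow>\<^sub>0 'c) set"
where
  "base_change_relations scale \<beta> Q =
     {Poly_Mapping.single (u + v) 1 - Poly_Mapping.single u 1 - Poly_Mapping.single v 1 | u v. True} \<union>
     {Poly_Mapping.single (scale b u) 1 - Poly_Mapping.single u (\<beta> b) | b u. True} \<union>
     {Poly_Mapping.single u 1 | u. u \<in> Q}"

definition base_change_dim ::
  "('b \<Rightarrow> 'm::ab_group_add \<Rightarrow> 'm) \<Rightarrow> ('b \<Rightarrow> 'c::field) \<Rightarrow> 'm set \<Rightarrow> enat"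
where
  "base_change_dim scale \<beta> Q =
     quot_dim pm_scale (Modules.module.span pm_scale (base_change_relations scale \<beta> Q))"

section \<open>Plane curve germs\<close>

text \<open>\<open>k[[x,y]] = k[[x]][[y]]\<close>: the outer power series variable is \<open>y\<close>.\<close>
type_synonym 'k ser_xy = "'k fps fps"

definition fps_map :: "('a \<Rightarrow> 'b) \<Rightarrow> 'a fps \<Rightarrow> 'b fps" where
  "fps_map h g = Abs_fps (\<lambda>n. h (fps_nth g n))"

definition deriv_x :: "'k::comm_ring_1 ser_xy \<Rightarrow> 'k ser_xy" where
  "deriv_x = fps_map fps_deriv"

definition deriv_y :: "'k::comm_ring_1 ser_xy \<Rightarrow> 'k ser_xy" where
  "deriv_y = fps_deriv"

definition const_xy :: "'a::zero \<Rightarrow> 'a fps fps" where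
  "const_xy c = fps_const (fps_const c)"

definition scale_xy :: "'k::comm_ring_1 \<Rightarrow> 'k ser_xy \<Rightarrow> 'k ser_xy" where
  "scale_xy c g = const_xy c * g"

definition jacobian_ideal :: "'k::comm_ring_1 ser_xy \<Rightarrow> 'k ser_xy set" where
  "jacobian_ideal f = gen_ideal {deriv_x f, deriv_y f}"

text \<open>The singular locus of \<open>f = 0\<close> is at most the closed point; smooth germs are allowed.\<close>
definition planar_icis :: "'k::field ser_xy \<Rightarrow> bool" where
  "planar_icis f \<longleftrightarrow>
     fps_nth (fps_nth f 0) 0 = 0 \<and> quot_dim scale_xy (gen_ideal {f, deriv_x f, deriv_y f}) < \<infinity>"

definition jacobian_length :: "'k::field ser_xy \<Rightarrow> nat \<Rightarrow> enat" where
  "jacobian_length f s = quot_dim scale_xy (gen_ideal (insert f (ideal_power (jacobian_ideal f) s)))"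

definition normalized_jacobian_length :: "'k::field ser_xy \<Rightarrow> nat \<Rightarrow> ereal" where
  "normalized_jacobian_length f s = ereal_of_enat (jacobian_length f s) / ereal (real s)"

definition jacobian_multiplicity :: "'k::field ser_xy \<Rightarrow> ereal" where
  "jacobian_multiplicity f = lim (normalized_jacobian_length f)"

section \<open>First-order deformations\<close>

text \<open>
  Let \<open>A = R/(f)\<close>. The (complete) module of differentials is \<open>\<Omega> = (A dx \<oplus> A dy) / K\<close> with
  \<open>K = A df\<close>, so that \<open>Ext\<^sup>1(\<Omega>, A) = Hom(K, A) / Hom(A\<^sup>2, A)\<close> by the long exact sequence of
  \<open>0 \<rightarrow> K \<rightarrow> A\<^sup>2 \<rightarrow> \<Omega> \<rightarrow> 0\<close>. Here \<open>df_module f\<close> is the preimage of \<open>K\<close> in \<open>R\<^sup>2\<close>.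
\<close>
definition scale_pair :: "'r::comm_ring_1 \<Rightarrow> 'r \<times> 'r \<Rightarrow> 'r \<times> 'r" where
  "scale_pair r p = (r * fst p, r * snd p)"

definition df_module :: "'k::comm_ring_1 ser_xy \<Rightarrow> ('k ser_xy \<times> 'k ser_xy) set" where
  "df_module f = {(u, v). \<exists>g. u - g * deriv_x f \<in> gen_ideal {f} \<and> v - g * deriv_y f \<in> gen_ideal {f}}"

definition hom_df :: "'k::comm_ring_1 ser_xy \<Rightarrow> ('k ser_xy \<times> 'k ser_xy \<Rightarrow> 'k ser_xy) set" where
  "hom_df f = hom_mod scale_pair (df_module f) (gen_ideal {f} \<times> gen_ideal {f}) (gen_ideal {f})"

definition extendable_df :: "'k::comm_ring_1 ser_xy \<Rightarrow> ('k ser_xy \<times> 'k ser_xy \<Rightarrow> 'k ser_xy) set" where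
  "extendable_df f =
     {\<psi>. \<exists>\<alpha> \<beta>. \<forall>(u, v)\<in>df_module f. \<psi> (u, v) - (\<alpha> * u + \<beta> * v) \<in> gen_ideal {f}}"

text \<open>
  The identification of \<open>Ext\<^sup>1(\<Omega>, A)\<close> with a quotient of \<open>A\<close>: a series \<open>\<delta>\<close> represents the class
  of the homomorphism \<open>K \<rightarrow> A\<close> sending \<open>df\<close> to \<open>\<delta>\<close>.
\<close>
definition def1_basis :: "'k::field ser_xy \<Rightarrow> nat \<Rightarrow> (nat \<Rightarrow> 'k ser_xy) \<Rightarrow> bool" where
  "def1_basis f d \<delta> \<longleftrightarrow> (\<exists>\<psi>.
     (\<forall>i<d. \<psi> i (deriv_x f, deriv_y f) - \<delta> i \<in> gen_ideal {f}) \<and>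
     basis_mod (\<lambda>c \<psi> p. const_xy c * \<psi> p) {0} (hom_df f) (extendable_df f) d \<psi>)"

section \<open>One-parameter deformations and principal parts\<close>

text \<open>
  \<open>k[[x,y]][[t]]\<close> has \<open>t\<close> as its outer variable. The complete tensor product
  \<open>k[[x,y]][[t]] \<otimes> k[[x,y]][[t]]\<close> over \<open>k[[t]]\<close> is \<open>k[[x,y]][[x',y']][[t]]\<close>.
\<close>
type_synonym 'k ser_xyt = "'k ser_xy fps"
type_synonym 'k ser_two = "'k ser_xy ser_xy fps"

definition param_space :: "nat \<Rightarrow> (nat \<Rightarrow> 'k) set" where
  "param_space d = {..<d} \<rightarrow>\<^sub>E UNIV"

definition deformation_eq ::
  "'k::field ser_xy \<Rightarrow> nat \<Rightarrow> (nat \<Rightarrow> 'k ser_xy) \<Rightarrow> (nat \<Rightarrow> 'k) \<Rightarrow> 'k ser_xyt"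
where
  "deformation_eq f d \<delta> a = fps_const f + fps_X * fps_const (\<Sum>i<d. const_xy (a i) * \<delta> i)"

definition scale_xyt :: "'k::comm_ring_1 \<Rightarrow> 'k ser_xyt \<Rightarrow> 'k ser_xyt" where
  "scale_xyt c g = fps_const (const_xy c) * g"

text \<open>\<open>left_incl s = s \<otimes> 1\<close> and \<open>right_incl s = 1 \<otimes> s\<close>, that is, \<open>s(x,y,t)\<close> and \<open>s(x',y',t)\<close>.\<close>
definition left_incl :: "'k::comm_ring_1 ser_xyt \<Rightarrow> 'k ser_two" where
  "left_incl = fps_map const_xy"

definition right_incl :: "'k::comm_ring_1 ser_xyt \<Rightarrow> 'k ser_two" where
  "right_incl = fps_map (fps_map (fps_map const_xy))"

definition diagonal_ideal :: "'k::comm_ring_1 ser_two set" where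
  "diagonal_ideal = gen_ideal (range (\<lambda>s. right_incl s - left_incl s))"

text \<open>
  For \<open>X\<close> with equation \<open>F\<close>, the principal parts \<open>P\<^sup>m\<close> of \<open>X/B\<close> are the quotient of
  \<open>k[[x,y]][[x',y']][[t]]\<close> by this ideal.
\<close>
definition principal_parts_ideal :: "nat \<Rightarrow> 'k::comm_ring_1 ser_xyt \<Rightarrow> 'k ser_two set" where
  "principal_parts_ideal m F =
     gen_ideal ({left_incl F, right_incl F} \<union> ideal_power diagonal_ideal m)"

definition dual_principal_parts ::
  "nat \<Rightarrow> 'k::comm_ring_1 ser_xyt \<Rightarrow> ('k ser_two \<Rightarrow> 'k ser_xyt) set"
where
  "dual_principal_parts m F =
     hom_mod (\<lambda>s p. left_incl s * p) UNIV (principal_parts_ideal m F) (gen_ideal {F})"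

definition dual_basis ::
  "nat \<Rightarrow> 'k::comm_ring_1 ser_xyt \<Rightarrow> (nat \<Rightarrow> 'k ser_two \<Rightarrow> 'k ser_xyt) \<Rightarrow> bool"
where
  "dual_basis m F e \<longleftrightarrow>
     basis_mod (\<lambda>s \<phi> p. s * \<phi> p) (gen_ideal {F})
       (dual_principal_parts m F) {\<phi>. \<forall>p. \<phi> p \<in> gen_ideal {F}} m e"

text \<open>The preimage in \<open>k[[x,y]][[t]]\<close> of the ideal of \<open>O\<^bsub>X\<^esub>\<close> generated by \<open>det (e\<^bsub>i\<^esub>(\<tau>\<^bsub>j\<^esub>))\<close>.\<close>
definition inflection_ideal ::
  "nat \<Rightarrow> 'k::comm_ring_1 ser_xyt \<Rightarrow> (nat \<Rightarrow> 'k ser_two \<Rightarrow> 'k ser_xyt) \<Rightarrow> (nat \<Rightarrow> 'k ser_two)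
    \<Rightarrow> 'k ser_xyt set"
where
  "inflection_ideal m F e \<tau> = gen_ideal {F, det (mat m m (\<lambda>(i, j). e i (\<tau> j)))}"

definition special_fibre_length ::
  "nat \<Rightarrow> 'k::field ser_xyt \<Rightarrow> (nat \<Rightarrow> 'k ser_two \<Rightarrow> 'k ser_xyt) \<Rightarrow> (nat \<Rightarrow> 'k ser_two) \<Rightarrow> enat"
where
  "special_fibre_length m F e \<tau> =
     quot_dim scale_xyt (gen_ideal (insert fps_X (inflection_ideal m F e \<tau>)))"

text \<open>
  The ideal is independent of the basis \<open>e\<close> of the dual, so letting \<open>e\<close> vary as well does not
  affect the minimum; the existence of \<open>e\<close> says that the dual is free of rank \<open>m\<close>.
\<close>
definition automatic_degeneracy ::
  "nat \<Rightarrow> 'k::field ser_xy \<Rightarrow> nat \<Rightarrow> (nat \<Rightarrow> 'k ser_xy) \<Rightarrow> enat"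
where
  "automatic_degeneracy m f d \<delta> =
     Inf {special_fibre_length m (deformation_eq f d \<delta> a) e \<tau> | a e \<tau>.
            a \<in> param_space d \<and> dual_basis m (deformation_eq f d \<delta> a) e}"

section \<open>Limiting inflection points of general deformations\<close>

definition base_scale :: "'k::comm_ring_1 fps \<Rightarrow> 'k ser_xyt \<Rightarrow> 'k ser_xyt" where
  "base_scale b g = fps_map const_xy b * g"

definition to_geometric_generic :: "'k::field fps \<Rightarrow> 'k fls alg_closure" where
  "to_geometric_generic b = to_ac (fps_to_fls b)"

definition limiting_inflection_points ::
  "nat \<Rightarrow> 'k::field ser_xyt \<Rightarrow> (nat \<Rightarrow> 'k ser_two \<Rightarrow> 'k ser_xyt) \<Rightarrow> (nat \<Rightarrow> 'k ser_two) \<Rightarrow> enat"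
where
  "limiting_inflection_points m F e \<tau> =
     base_change_dim base_scale to_geometric_generic (inflection_ideal m F e \<tau>)"

inductive_set poly_funs :: "nat \<Rightarrow> ((nat \<Rightarrow> 'k::comm_ring_1) \<Rightarrow> 'k) set" for d where
  const: "(\<lambda>_. c) \<in> poly_funs d"
| coord: "i < d \<Longrightarrow> (\<lambda>a. a i) \<in> poly_funs d"
| add: "p \<in> poly_funs d \<Longrightarrow> q \<in> poly_funs d \<Longrightarrow> (\<lambda>a. p a + q a) \<in> poly_funs d"
| mult: "p \<in> poly_funs d \<Longrightarrow> q \<in> poly_funs d \<Longrightarrow> (\<lambda>a. p a * q a) \<in> poly_funs d"

definition zariski_open :: "nat \<Rightarrow> (nat \<Rightarrow> 'k::comm_ring_1) set \<Rightarrow> bool" where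
  "zariski_open d U \<longleftrightarrow>
     (\<exists>P\<subseteq>poly_funs d. U = {a \<in> param_space d. \<exists>p\<in>P. p a \<noteq> 0})"

definition zariski_dense :: "nat \<Rightarrow> (nat \<Rightarrow> 'k::comm_ring_1) set \<Rightarrow> bool" where
  "zariski_dense d U \<longleftrightarrow> (\<forall>V. zariski_open d V \<and> V \<noteq> {} \<longrightarrow> U \<inter> V \<noteq> {})"

definition for_general_params :: "nat \<Rightarrow> ((nat \<Rightarrow> 'k::comm_ring_1) \<Rightarrow> bool) \<Rightarrow> bool" where
  "for_general_params d Q \<longleftrightarrow> (\<exists>U. zariski_open d U \<and> zariski_dense d U \<and> (\<forall>a\<in>U. Q a))"

definition attains_degeneracy ::
  "nat \<Rightarrow> 'k::field ser_xy \<Rightarrow> nat \<Rightarrow> (nat \<Rightarrow> 'k ser_xy) \<Rightarrow> (nat \<Rightarrow> 'k)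
    \<Rightarrow> (nat \<Rightarrow> 'k ser_two \<Rightarrow> 'k ser_xyt) \<Rightarrow> (nat \<Rightarrow> 'k ser_two) \<Rightarrow> bool"
where
  "attains_degeneracy m f d \<delta> a e \<tau> \<longleftrightarrow>
     dual_basis m (deformation_eq f d \<delta> a) e \<and>
     special_fibre_length m (deformation_eq f d \<delta> a) e \<tau> = automatic_degeneracy m f d \<delta>"

end

theory Submission
  imports Defs
begin

text \<open>
  Let \<open>R = k[[x,y]]\<close> and \<open>F = f + t g\<close>. The relative derivations of \<open>O\<^bsub>X\<^esub>\<close> contain
  \<open>D = F\<^sub>y \<partial>\<^sub>x - F\<^sub>x \<partial>\<^sub>y\<close>, and as soon as the dual of the principal parts is free, evaluation
  on the diagonal and \<open>D\<close> form a basis: the determinant \<open>h\<close> of the change of basis satisfies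
  \<open>f\<^sub>x, f\<^sub>y \<in> (h, f)\<close> at \<open>t = 0\<close>, and in characteristic \<open>0\<close> an isolated singularity forces such an
  \<open>h\<close> to be a unit. In this basis the determinant takes, modulo \<open>t\<close>, exactly the values in the
  Jacobian ideal \<open>J\<close>, so the automatic degeneracy is the minimum over \<open>l \<in> J\<close> of \<open>dim R/(f, l)\<close>.
  That minimum is attained by a generator of a principal reduction of \<open>J\<close> modulo \<open>f\<close>, whence it is the
  Hilbert--Samuel multiplicity.

  The dual is free if \<open>f\<close> is smooth, or if \<open>g\<close> is a unit: then \<open>O\<^bsub>X\<^esub>\<close> is \<open>R\<close> with \<open>t = - f/g\<close>, and
  \<open>f/g\<close> again has an isolated critical point. Finally, \<open>F, \<Delta>, t\<close> is a regular sequence if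
  \<open>R/(f, \<Delta>(0))\<close> is finite-dimensional, so \<open>O\<^bsub>X\<^esub>/(\<Delta>)\<close> is free over \<open>k[[t]]\<close> and its generic rank
  is the length of its special fibre.
\<close>

no_notation vec_index (infixl "$" 100)
unbundle fps_syntax

section \<open>Dimensions of quotients\<close>

text \<open>Three facts about R carry the argument, in place of normalization, depth and resolution.
  A factor can be cancelled modulo a coprime one, because the ideal the two generate contains powers
  of x and y; this yields additivity of lengths, flatness over the base and uniqueness of the matrix
  entries in the trace argument. Power series can be built coefficient by coefficient, which
  replaces appeals to completeness. The dimensions of R/m^j are explicit, and counting with them
  produces a form in f_x, f_y that vanishes modulo f, from which the reduction is obtained: f_x - c
  f_y serves for all but finitely many c in k, unless J contains a unit. The unit g exists for a
  general parameter because the homomorphism df |-> 1 has a class in Ext^1, which classes with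
  values in the maximal ideal cannot generate unless f is smooth. The lower bound concerns every
  parameter whose dual is free, general or not; there freeness is only a hypothesis, and the unit h
  has to be extracted from it.\<close>

definition indep_mod :: "('c::field \<Rightarrow> 'v::ab_group_add \<Rightarrow> 'v) \<Rightarrow> 'v set \<Rightarrow> 'i set \<Rightarrow> ('i \<Rightarrow> 'v) \<Rightarrow> bool" where
  "indep_mod scale W I v \<longleftrightarrow> (\<forall>c. (\<Sum>i\<in>I. scale (c i) (v i)) \<in> W \<longrightarrow> (\<forall>i\<in>I. c i = 0))"

definition span_mod :: "('c::field \<Rightarrow> 'v::ab_group_add \<Rightarrow> 'v) \<Rightarrow> 'v set \<Rightarrow> 'i set \<Rightarrow> ('i \<Rightarrow> 'v) \<Rightarrow> bool" where
  "span_mod scale W I b \<longleftrightarrow> (\<forall>u. \<exists>c. u - (\<Sum>i\<in>I. scale (c i) (b i)) \<in> W)"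

text \<open>The two halves are separated because dimension estimates use them one at a time, and
  their index sets are arbitrary so that pairs of exponents and disjoint sums can serve as
  indices.\<close>

lemma basis_mod_iff:
  "basis_mod scale {0} UNIV W n b \<longleftrightarrow> span_mod scale W {..<n} b \<and> indep_mod scale W {..<n} b"
  by (auto simp: basis_mod_def span_mod_def indep_mod_def)

lemma span_mod_reindex:
  assumes "bij_betw h A I" "span_mod scale W I b"
  shows "span_mod scale W A (b \<circ> h)"
  unfolding span_mod_def
proof
  fix u
  obtain c where c: "u - (\<Sum>i\<in>I. scale (c i) (b i)) \<in> W"
    using assms(2) by (auto simp: span_mod_def)
  have "(\<Sum>i\<in>I. scale (c i) (b i)) = (\<Sum>a\<in>A. scale (c (h a)) (b (h a)))"
    using sum.reindex_bij_betw[OF assms(1), of "\<lambda>i. scale (c i) (b i)"] by simp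
  then show "\<exists>c. u - (\<Sum>i\<in>A. scale (c i) ((b \<circ> h) i)) \<in> W"
    using c by (intro exI[of _ "c \<circ> h"]) simp
qed

lemma indep_mod_reindex:
  assumes h: "bij_betw h A I" and v: "indep_mod scale W I v"
  shows "indep_mod scale W A (v \<circ> h)"
  unfolding indep_mod_def
proof (intro allI impI)
  fix c assume c: "(\<Sum>i\<in>A. scale (c i) ((v \<circ> h) i)) \<in> W"
  let ?d = "c \<circ> the_inv_into A h"
  have inj: "inj_on h A" using h by (simp add: bij_betw_def)
  have "(\<Sum>i\<in>I. scale (?d i) (v i)) = (\<Sum>a\<in>A. scale (?d (h a)) (v (h a)))"
    using sum.reindex_bij_betw[OF h, of "\<lambda>i. scale (?d i) (v i)"] by simp
  also have "\<dots> = (\<Sum>a\<in>A. scale (c a) ((v \<circ> h) a))"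
    by (intro sum.cong) (auto simp: the_inv_into_f_f[OF inj])
  finally have "(\<Sum>i\<in>I. scale (?d i) (v i)) \<in> W" using c by simp
  then have "\<forall>i\<in>I. ?d i = 0"
    using v[unfolded indep_mod_def, rule_format, of ?d] by blast
  then show "\<forall>a\<in>A. c a = 0"
    using h by (auto simp: bij_betw_def the_inv_into_f_f)
qed

context vector_space
begin

text \<open>Steinitz exchange modulo \<open>W\<close>: replacing each \<open>v j\<close> by a
  combination \<open>\<beta> j\<close> of the \<open>b i\<close> changes it by an element of
  \<open>W\<close> only, so a linear relation between the \<open>\<beta> j\<close> would be one
  between the \<open>v j\<close> modulo \<open>W\<close>. Hence the \<open>\<beta> j\<close> are
  independent in the span of the \<open>b i\<close>.\<close>

lemma card_indep_mod_le_span_mod: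
  assumes W: "subspace W" and fin: "finite I" "finite J"
    and b: "span_mod scale W I b" and v: "indep_mod scale W J v"
  shows "card J \<le> card I"
proof -
  have "\<forall>j. \<exists>c. v j - (\<Sum>i\<in>I. scale (c i) (b i)) \<in> W"
    using b by (auto simp: span_mod_def)
  then obtain c where c: "\<And>j. v j - (\<Sum>i\<in>I. scale (c j i) (b i)) \<in> W"
    by metis
  define \<beta> where "\<beta> j = (\<Sum>i\<in>I. scale (c j i) (b i))" for j
  have zero: "\<forall>j\<in>J. a j = 0" if "(\<Sum>j\<in>J. scale (a j) (\<beta> j)) = 0" for a
  proof -
    have "(\<Sum>j\<in>J. scale (a j) (v j)) = (\<Sum>j\<in>J. scale (a j) (v j - \<beta> j))"
      using that by (simp add: scale_right_diff_distrib sum_subtractf)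
    also have "\<dots> \<in> W"
      using c by (intro subspace_sum[OF W] subspace_scale[OF W]) (simp add: \<beta>_def)
    finally show ?thesis using v by (simp add: indep_mod_def)
  qed
  have inj: "inj_on \<beta> J"
  proof (rule inj_onI, rule ccontr)
    fix j k assume jk: "j \<in> J" "k \<in> J" "\<beta> j = \<beta> k" "j \<noteq> k"
    define a :: "_ \<Rightarrow> 'a" where "a i = (if i = j then 1 else if i = k then -1 else 0)" for i
    have "(\<Sum>i\<in>J. scale (a i) (\<beta> i)) = (\<Sum>i\<in>{j,k}. scale (a i) (\<beta> i))"
      using jk fin by (intro sum.mono_neutral_right) (auto simp: a_def)
    also have "\<dots> = 0" using jk by (simp add: a_def)
    finally have "a j = 0" using zero jk by blast
    then show False by (simp add: a_def)
  qed
  have "independent (\<beta> ` J)"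
  proof (rule independent_if_scalars_zero)
    fix u x assume u: "(\<Sum>x\<in>\<beta> ` J. scale (u x) x) = 0" and x: "x \<in> \<beta> ` J"
    have "(\<Sum>j\<in>J. scale (u (\<beta> j)) (\<beta> j)) = 0"
      using u by (simp add: sum.reindex[OF inj])
    from zero[OF this] x show "u x = 0" by auto
  qed (use fin in simp)
  moreover have "\<beta> ` J \<subseteq> span (b ` I)"
    unfolding \<beta>_def by (intro image_subsetI span_sum span_scale span_base imageI)
  ultimately have "card (\<beta> ` J) \<le> card (b ` I)"
    using independent_span_bound[of "b ` I" "\<beta> ` J"] fin by auto
  also have "\<dots> \<le> card I" using fin by (rule_tac card_image_le)
  finally show ?thesis using inj by (simp add: card_image)
qed

lemma span_mod_contains_basis:
  assumes W: "subspace W" and "finite I" "span_mod scale W I b"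
  shows "\<exists>I'\<subseteq>I. span_mod scale W I' b \<and> indep_mod scale W I' b"
  using assms(2,3)
proof (induction "card I" arbitrary: I)
  case 0
  then show ?case by (auto simp: indep_mod_def)
next
  case (Suc n)
  show ?case
  proof (cases "indep_mod scale W I b")
    case True
    then show ?thesis using Suc by auto
  next
    case False
    then obtain c j where c: "(\<Sum>i\<in>I. scale (c i) (b i)) \<in> W" "j \<in> I" "c j \<noteq> 0"
      by (auto simp: indep_mod_def)
    have "span_mod scale W (I - {j}) b"
      unfolding span_mod_def
    proof
      fix u
      obtain d where d: "u - (\<Sum>i\<in>I. scale (d i) (b i)) \<in> W"
        using Suc.prems by (auto simp: span_mod_def)
      define e where "e i = d i - d j / c j * c i" for i
      have "u - (\<Sum>i\<in>I. scale (d i) (b i)) + scale (d j / c j) (\<Sum>i\<in>I. scale (c i) (b i)) \<in> W"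
        using subspace_add[OF W d subspace_scale[OF W c(1)]] by simp
      also have "u - (\<Sum>i\<in>I. scale (d i) (b i)) + scale (d j / c j) (\<Sum>i\<in>I. scale (c i) (b i))
          = u - (\<Sum>i\<in>I. scale (e i) (b i))"
        by (simp add: e_def scale_left_diff_distrib sum_subtractf scale_sum_right)
      also have "(\<Sum>i\<in>I. scale (e i) (b i)) = (\<Sum>i\<in>I - {j}. scale (e i) (b i))"
        using Suc.prems c by (subst sum.remove[of _ j]) (auto simp: e_def)
      finally show "\<exists>c. u - (\<Sum>i\<in>I - {j}. scale (c i) (b i)) \<in> W" by blast
    qed
    moreover have "n = card (I - {j})" "finite (I - {j})" using Suc c by auto
    ultimately obtain I' where "I' \<subseteq> I - {j}" "span_mod scale W I' b" "indep_mod scale W I' b"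
      using Suc.hyps(1) by blast
    then show ?thesis by blast
  qed
qed

lemma quot_dim_eqI:
  assumes W: "subspace W" and fin: "finite I"
    and b: "span_mod scale W I b" "indep_mod scale W I b"
  shows "quot_dim scale W = enat (card I)"
proof -
  obtain h where h: "bij_betw h {..<card I} I"
    using ex_bij_betw_nat_finite[OF fin] by (auto simp: lessThan_atLeast0)
  let ?S = "{enat n | n. \<exists>b. basis_mod scale {0} UNIV W n b}"
  have "?S = {enat (card I)}"
  proof (rule equalityI; rule subsetI)
    fix x assume "x \<in> ?S"
    then obtain n b' where n: "x = enat n" "span_mod scale W {..<n} b'" "indep_mod scale W {..<n} b'"
      by (auto simp: basis_mod_iff)
    have "card I = card {..<n}"
      by (intro antisym card_indep_mod_le_span_mod[OF W _ _ n(2) b(2)]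
          card_indep_mod_le_span_mod[OF W _ _ b(1) n(3)]) (use fin in auto)
    with n show "x \<in> {enat (card I)}" by simp
  next
    fix x assume "x \<in> {enat (card I)}"
    then show "x \<in> ?S"
      using span_mod_reindex[OF h b(1)] indep_mod_reindex[OF h b(2)] by (auto simp: basis_mod_iff)
  qed
  then show ?thesis by (simp add: quot_dim_def)
qed

lemma quot_dim_le:
  assumes W: "subspace W" and fin: "finite I" and b: "span_mod scale W I b"
  shows "quot_dim scale W \<le> enat (card I)"
proof -
  obtain I' where I': "I' \<subseteq> I" "span_mod scale W I' b" "indep_mod scale W I' b"
    using span_mod_contains_basis[OF W fin b] by blast
  then have "finite I'" using fin finite_subset by blast
  from quot_dim_eqI[OF W this I'(2,3)] show ?thesis
    using card_mono[OF fin I'(1)] by simp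
qed

text \<open>A finite value is attained: the infimum of the empty set is infinite, and a nonempty set
  of extended naturals contains its infimum.\<close>

lemma quot_dim_basisE:
  assumes "quot_dim scale W = enat n"
  obtains b where "span_mod scale W {..<n} b" "indep_mod scale W {..<n} b"
proof -
  let ?S = "{enat n | n. \<exists>b. basis_mod scale {0} UNIV W n b}"
  have "?S \<noteq> {}"
  proof
    assume e: "?S = {}"
    show False using assms unfolding quot_dim_def e by (simp add: Inf_enat_def)
  qed
  then obtain x where "x \<in> ?S" by blast
  then have "(LEAST x. x \<in> ?S) \<in> ?S" by (rule LeastI)
  then have "quot_dim scale W \<in> ?S"
    using \<open>?S \<noteq> {}\<close> by (simp only: quot_dim_def Inf_enat_def if_False)
  then obtain b where "basis_mod scale {0} UNIV W n b"
    using assms by auto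
  then show ?thesis
    using that by (auto simp: basis_mod_iff)
qed

lemma quot_dim_ge:
  assumes W: "subspace W" and fin: "finite J" and v: "indep_mod scale W J v"
  shows "enat (card J) \<le> quot_dim scale W"
proof (cases "quot_dim scale W")
  case (enat n)
  then obtain b where "span_mod scale W {..<n} b" by (rule quot_dim_basisE)
  from card_indep_mod_le_span_mod[OF W _ fin this v] enat show ?thesis by simp
qed simp

lemma quot_dim_antimono:
  assumes W: "subspace W" "subspace W'" "W \<subseteq> W'"
  shows "quot_dim scale W' \<le> quot_dim scale W"
proof (cases "quot_dim scale W")
  case (enat n)
  then obtain b where "span_mod scale W {..<n} b" by (rule quot_dim_basisE)
  then have "span_mod scale W' {..<n} b"
    using W(3) unfolding span_mod_def by blast
  from quot_dim_le[OF W(2) _ this] enat show ?thesis by simp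
qed simp

end

section \<open>Ideals\<close>

lemma module_mult: "Modules.module ((*) :: 'r::comm_ring_1 \<Rightarrow> 'r \<Rightarrow> 'r)"
  by unfold_locales (auto simp: algebra_simps)

lemmas gen_ideal_base = module.span_base[OF module_mult, folded gen_ideal_def]
lemmas gen_ideal_zero = module.span_zero[OF module_mult, folded gen_ideal_def]
lemmas gen_ideal_add = module.span_add[OF module_mult, folded gen_ideal_def]
lemmas gen_ideal_diff = module.span_diff[OF module_mult, folded gen_ideal_def]
lemmas gen_ideal_neg = module.span_neg[OF module_mult, folded gen_ideal_def]
lemmas gen_ideal_mult = module.span_scale[OF module_mult, folded gen_ideal_def]
lemmas gen_ideal_sum = module.span_sum[OF module_mult, folded gen_ideal_def]
lemmas gen_ideal_mono = module.span_mono[OF module_mult, folded gen_ideal_def]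
lemmas gen_ideal_induct =
  module.span_induct_alt[OF module_mult, folded gen_ideal_def, consumes 1, case_names zero step]

lemma gen_ideal_least:
  fixes T :: "'r::comm_ring_1 set"
  assumes "S \<subseteq> T" "0 \<in> T" "\<And>u v. u \<in> T \<Longrightarrow> v \<in> T \<Longrightarrow> u + v \<in> T" "\<And>r u. u \<in> T \<Longrightarrow> r * u \<in> T"
  shows "gen_ideal S \<subseteq> T"
proof
  fix u assume "u \<in> gen_ideal S"
  then show "u \<in> T"
    by (induction rule: gen_ideal_induct) (use assms in auto)
qed

lemma gen_ideal_mult_right: "a \<in> gen_ideal S \<Longrightarrow> a * (r::'r::comm_ring_1) \<in> gen_ideal S"
  using gen_ideal_mult[of a S r] by (simp add: mult.commute)

lemma gen_ideal_insert: "gen_ideal (insert a S) = {u. \<exists>r. u - r * a \<in> gen_ideal S}"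
  using module.span_insert[OF module_mult, of a S] by (simp add: gen_ideal_def)

lemma gen_ideal_1: "u \<in> gen_ideal {a} \<longleftrightarrow> (\<exists>r. u = r * (a::'r::comm_ring_1))"
  using module.span_singleton[OF module_mult, of a] by (auto simp: gen_ideal_def)

lemma gen_ideal_2: "u \<in> gen_ideal {a, b} \<longleftrightarrow> (\<exists>r s. u = r * a + s * (b::'r::comm_ring_1))"
  by (simp add: gen_ideal_insert[of a] gen_ideal_1 algebra_simps)

lemma gen_ideal_subsetI: "S \<subseteq> gen_ideal T \<Longrightarrow> gen_ideal S \<subseteq> gen_ideal T"
  by (rule gen_ideal_least) (auto intro: gen_ideal_zero gen_ideal_add gen_ideal_mult)

section \<open>Power series in two variables\<close>

lemma const_xy_simps [simp]:
  "const_xy (0::'k::comm_ring_1) = 0" "const_xy (1::'k) = 1"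
  by (simp_all add: const_xy_def)

lemma const_xy_add: "const_xy (a + b) = const_xy a + const_xy (b::'k::comm_ring_1)"
  and const_xy_mult: "const_xy (a * b) = const_xy a * const_xy (b::'k)"
  and const_xy_diff: "const_xy (a - b) = const_xy a - const_xy (b::'k)"
  by (simp_all add: const_xy_def flip: fps_const_add fps_const_mult fps_const_sub fps_const_neg)

lemma const_xy_sum: "const_xy (\<Sum>i\<in>A. h i) = (\<Sum>i\<in>A. const_xy (h i :: 'k::comm_ring_1))"
  by (induction A rule: infinite_finite_induct) (auto simp: const_xy_add)

lemma const_xy_mult_nth [simp]: "(const_xy (c::'k::comm_ring_1) * g) $ b $ a = c * g $ b $ a"
  by (simp add: const_xy_def)

lemma const_xy_nth: "const_xy (c::'k::comm_ring_1) $ b $ a = (if a = 0 \<and> b = 0 then c else 0)"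
  by (simp add: const_xy_def)

lemma ser_eqI: "(\<And>b a. (g::'k::zero fps fps) $ b $ a = h $ b $ a) \<Longrightarrow> g = h"
  by (simp add: fps_eq_iff)

global_interpretation xy: vector_space "scale_xy :: 'k::field \<Rightarrow> _"
  by unfold_locales (auto simp: scale_xy_def const_xy_add const_xy_mult algebra_simps)

lemma subspace_xy_gen_ideal: "xy.subspace (gen_ideal S)"
  by (auto simp: xy.subspace_def scale_xy_def intro: gen_ideal_zero gen_ideal_add gen_ideal_mult)

lemma nth00_mult: "((g::'k::comm_ring_1 fps fps) * h) $ 0 $ 0 = g $ 0 $ 0 * h $ 0 $ 0"
  by (simp add: fps_mult_nth)

lemma nth00_power: "((g::'k::comm_ring_1 fps fps) ^ n) $ 0 $ 0 = (g $ 0 $ 0) ^ n"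
  by (induction n) (auto simp: nth00_mult)

lemma fps_unitI: "(g::'a::comm_ring_1 fps) $ 0 dvd 1 \<Longrightarrow> g dvd 1"
proof -
  assume "g $ 0 dvd 1"
  then obtain y where "g $ 0 * y = 1" by (metis dvdE)
  from fps_right_inverse[OF this] show "g dvd 1" by (metis dvdI)
qed

lemma ser_unitI: "(g::'k::field fps fps) $ 0 $ 0 \<noteq> 0 \<Longrightarrow> g dvd 1"
  by (intro fps_unitI) (simp add: dvd_field_iff)

subsection \<open>The filtration by powers of the maximal ideal\<close>

text \<open>The power m^n in terms of coefficients, so that m-adic limits are read off directly.
  Since y is the outer variable, the coefficient of x^a y^b is \<open>g $ b $ a\<close>.\<close>

definition max_power :: "nat \<Rightarrow> 'k::comm_ring_1 fps fps set" where
  "max_power n = {g. \<forall>a b. a + b < n \<longrightarrow> g $ b $ a = 0}"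

abbreviation ser_x :: "'k::comm_ring_1 fps fps" where "ser_x \<equiv> fps_const fps_X"
abbreviation ser_y :: "'k::comm_ring_1 fps fps" where "ser_y \<equiv> fps_X"

lemma max_power_0 [simp]: "max_power 0 = UNIV"
  by (simp add: max_power_def)

lemma max_power_1: "g \<in> max_power (Suc 0) \<longleftrightarrow> g $ 0 $ 0 = 0"
  by (simp add: max_power_def)

lemma max_power_antimono: "m \<le> n \<Longrightarrow> max_power n \<subseteq> max_power m"
  by (auto simp: max_power_def)

lemma max_power_zero [simp]: "0 \<in> max_power n"
  and max_power_add: "g \<in> max_power n \<Longrightarrow> h \<in> max_power n \<Longrightarrow> g + h \<in> max_power n"
  and max_power_diff: "g \<in> max_power n \<Longrightarrow> h \<in> max_power n \<Longrightarrow> g - h \<in> max_power n"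
  by (auto simp: max_power_def)

lemma max_power_mult:
  assumes "g \<in> max_power m" "h \<in> max_power n"
  shows "g * h \<in> max_power (m + n)"
proof -
  have "(g * h) $ b $ a = 0" if "a + b < m + n" for a b
  proof -
    have "g $ i $ j * h $ (b - i) $ (a - j) = 0" if "i \<le> b" "j \<le> a" for i j
    proof (cases "j + i < m")
      case True
      then show ?thesis using assms by (simp add: max_power_def)
    next
      case False
      then have "(a - j) + (b - i) < n" using that \<open>a + b < m + n\<close> by linarith
      then show ?thesis using assms by (simp add: max_power_def)
    qed
    then show ?thesis
      unfolding fps_mult_nth fps_sum_nth by (intro sum.neutral ballI) simp
  qed
  then show ?thesis by (simp add: max_power_def)
qed

lemma max_power_mult_left: "h \<in> max_power n \<Longrightarrow> g * h \<in> max_power n"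
  using max_power_mult[of g 0 h n] by simp

lemma max_power_mult_right: "h \<in> max_power n \<Longrightarrow> h * g \<in> max_power n"
  using max_power_mult[of h n g 0] by simp

lemma max_power_power: "g \<in> max_power 1 \<Longrightarrow> g ^ n \<in> max_power n"
  by (induction n) (use max_power_mult[of g 1] in auto)

lemma ser_x_in_max_power: "ser_x \<in> max_power 1" and ser_y_in_max_power: "ser_y \<in> max_power 1"
  by (auto simp: max_power_def)

lemma max_power_Inter: "(\<And>n. g \<in> max_power n) \<Longrightarrow> g = 0"
proof (rule ser_eqI)
  fix b a assume "\<And>n. g \<in> max_power n"
  then have "g \<in> max_power (Suc (a + b))" by blast
  then show "g $ b $ a = 0 $ b $ a" by (simp add: max_power_def)
qed

lemma ser_decompose:
  obtains u v where "(g::'k::comm_ring_1 fps fps) = const_xy (g $ 0 $ 0) + ser_x * u + ser_y * v"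
proof -
  have 1: "h = fps_const (h $ 0) + fps_X * fps_shift 1 h" for h :: "'a::comm_ring_1 fps"
    by (auto simp: fps_eq_iff fps_X_mult_nth)
  have "g = fps_const (g $ 0) + ser_y * fps_shift 1 g" by (rule 1)
  also have "g $ 0 = fps_const (g $ 0 $ 0) + fps_X * fps_shift 1 (g $ 0)" by (rule 1)
  finally have "g = const_xy (g $ 0 $ 0) + ser_x * fps_const (fps_shift 1 (g $ 0)) + ser_y * fps_shift 1 g"
    by (simp add: const_xy_def flip: fps_const_add fps_const_mult)
  then show ?thesis by (rule that)
qed

section \<open>Monomials below a given degree\<close>

definition monomial_xy :: "nat \<times> nat \<Rightarrow> 'k::comm_ring_1 fps fps" where
  "monomial_xy = (\<lambda>(a, b). ser_x ^ a * ser_y ^ b)"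

text \<open>Pairs are (x-exponent, y-exponent); the corresponding monomials span R modulo
  m^n.\<close>

definition corner :: "nat \<Rightarrow> (nat \<times> nat) set" where
  "corner n = {(a, b). a + b < n}"

lemma monomial_xy_nth: "(monomial_xy p :: 'k::comm_ring_1 fps fps) $ b $ a = (if p = (a, b) then 1 else 0)"
proof (cases p)
  case (Pair a' b')
  have "(monomial_xy p :: 'k fps fps) = fps_const (fps_X ^ a') * fps_X ^ b'"
    by (simp add: monomial_xy_def Pair flip: fps_const_power)
  then show ?thesis by (auto simp: Pair fps_X_power_nth)
qed

lemma corner_Suc: "corner (Suc n) = corner n \<union> (\<lambda>a. (a, n - a)) ` {..n}"
  by (auto simp: corner_def image_iff)

lemma finite_corner [simp]: "finite (corner n)"
  by (rule finite_subset[of _ "{..n} \<times> {..n}"]) (auto simp: corner_def)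

lemma card_corner_Suc: "card (corner (Suc n)) = card (corner n) + Suc n"
proof -
  have "card ((\<lambda>a. (a, n - a)) ` {..n}) = Suc n"
    by (subst card_image) (auto simp: inj_on_def)
  then show ?thesis
    using finite_corner[of n]
    by (subst corner_Suc, subst card_Un_disjoint) (auto simp: corner_def simp del: finite_corner)
qed

lemma corner_0: "corner 0 = {}" by (simp add: corner_def)

lemma card_corner: "2 * card (corner n) = n * (n + 1)"
  by (induction n) (auto simp: card_corner_Suc corner_0)

lemma sum_corner_nth:
  "(\<Sum>p\<in>corner n. const_xy (c p) * monomial_xy p) $ b $ a = (if a + b < n then c (a, b) else (0::'k::comm_ring_1))"
proof -
  have "(\<Sum>p\<in>corner n. const_xy (c p) * monomial_xy p) $ b $ a = (\<Sum>p\<in>corner n. if p = (a, b) then c p else 0)"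
    unfolding fps_sum_nth by (intro sum.cong refl) (simp add: monomial_xy_nth)
  moreover have "(a, b) \<in> corner n \<longleftrightarrow> a + b < n" by (simp add: corner_def)
  ultimately show ?thesis by simp
qed

lemma span_mod_max_power: "span_mod scale_xy (max_power n) (corner n) (monomial_xy :: _ \<Rightarrow> 'k::field fps fps)"
  unfolding span_mod_def scale_xy_def
  by (intro allI, rule_tac x = "\<lambda>(a, b). u $ b $ a" in exI) (simp add: max_power_def sum_corner_nth)

lemma subspace_max_power: "xy.subspace (max_power n)"
  by (auto simp: xy.subspace_def scale_xy_def intro: max_power_add max_power_mult_left)

subsection \<open>Ideals of finite colength\<close>

text \<open>A monomial of degree at least 2N is divisible by x^N or by y^N; \<open>u\<close>
  collects those with y-exponent below N.\<close>

lemma max_power_subset_powers: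
  assumes "g \<in> max_power (2 * N)"
  shows "\<exists>u v. g = ser_x ^ N * u + ser_y ^ N * v"
proof -
  define u where "u = Abs_fps (\<lambda>b. if b < N then fps_shift N (g $ b) else 0)"
  have "g = fps_const (fps_X ^ N) * u + fps_X ^ N * fps_shift N g"
  proof (rule ser_eqI)
    fix b a
    show "g $ b $ a = (fps_const (fps_X ^ N) * u + fps_X ^ N * fps_shift N g) $ b $ a"
      using assms by (auto simp: u_def fps_X_power_mult_nth max_power_def)
  qed
  then show ?thesis by (auto simp flip: fps_const_power)
qed

text \<open>Too many powers of \<open>z\<close> are dependent modulo the ideal. Factoring out the
  lowest power that occurs in a dependence leaves a series with nonzero constant term, which is a
  unit.\<close>

lemma power_in_ideal_of_finite_colength:
  fixes S :: "'k::field fps fps set"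
  assumes fin: "quot_dim scale_xy (gen_ideal S) < \<infinity>" and z: "z $ 0 $ 0 = 0"
  shows "\<exists>N. z ^ N \<in> gen_ideal S"
proof -
  obtain n where n: "quot_dim scale_xy (gen_ideal S) = enat n"
    using fin by (cases "quot_dim scale_xy (gen_ideal S)") auto
  have "\<not> indep_mod scale_xy (gen_ideal S) {..n} (\<lambda>i. z ^ i)"
    using xy.quot_dim_ge[OF subspace_xy_gen_ideal, of "{..n}" S "\<lambda>i. z ^ i"] n by auto
  then obtain c j where c: "(\<Sum>i\<le>n. const_xy (c i) * z ^ i) \<in> gen_ideal S" "j \<le> n" "c j \<noteq> 0"
    by (auto simp: indep_mod_def scale_xy_def)
  obtain i0 where i0: "c i0 \<noteq> 0" "\<forall>i<i0. c i = 0"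
    using exists_least_iff[of "\<lambda>j. c j \<noteq> 0"] c(3) by blast
  have "i0 \<le> n" using c i0 by (meson le_trans not_le)
  define w where "w = (\<Sum>i\<in>{i0..n}. const_xy (c i) * z ^ (i - i0))"
  have "(\<Sum>i\<le>n. const_xy (c i) * z ^ i) = (\<Sum>i\<in>{i0..n}. const_xy (c i) * z ^ i)"
    using i0 by (intro sum.mono_neutral_right) auto
  also have "\<dots> = z ^ i0 * w"
    unfolding w_def sum_distrib_left
  proof (rule sum.cong[OF refl])
    fix i assume "i \<in> {i0..n}"
    then have "z ^ i = z ^ i0 * z ^ (i - i0)" by (simp flip: power_add)
    then show "const_xy (c i) * z ^ i = z ^ i0 * (const_xy (c i) * z ^ (i - i0))"
      by (simp only: mult.left_commute)
  qed
  finally have 1: "z ^ i0 * w \<in> gen_ideal S" using c by simp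
  have "w $ 0 $ 0 = (\<Sum>i\<in>{i0..n}. if i = i0 then c i0 else 0)"
    unfolding w_def fps_sum_nth by (intro sum.cong refl) (auto simp: nth00_power z const_xy_nth)
  also have "\<dots> = c i0" using \<open>i0 \<le> n\<close> by simp
  finally have "w dvd 1" using i0 by (intro ser_unitI) simp
  then obtain w' where "w * w' = 1" by (metis dvdE)
  then have "z ^ i0 = (z ^ i0 * w) * w'" by (simp add: mult.assoc)
  then show ?thesis using gen_ideal_mult_right[OF 1] by metis
qed

lemma max_power_in_ideal_of_finite_colength:
  fixes S :: "'k::field fps fps set"
  assumes fin: "quot_dim scale_xy (gen_ideal S) < \<infinity>"
  obtains N where "max_power N \<subseteq> gen_ideal S"
proof -
  obtain A B where A: "ser_x ^ A \<in> gen_ideal S" and B: "ser_y ^ B \<in> gen_ideal S"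
    using power_in_ideal_of_finite_colength[OF fin, of ser_x]
      power_in_ideal_of_finite_colength[OF fin, of ser_y] by auto
  have "max_power (2 * (A + B)) \<subseteq> gen_ideal S"
  proof
    fix g :: "'k fps fps" assume "g \<in> max_power (2 * (A + B))"
    then obtain u v where "g = ser_x ^ (A + B) * u + ser_y ^ (A + B) * v"
      using max_power_subset_powers by blast
    then have "g = ser_x ^ A * (ser_x ^ B * u) + ser_y ^ B * (ser_y ^ A * v)"
      by (simp only: power_add mult.assoc mult.left_commute)
    also have "\<dots> \<in> gen_ideal S"
      by (intro gen_ideal_add gen_ideal_mult_right A B)
    finally show "g \<in> gen_ideal S" .
  qed
  then show ?thesis by (rule that)
qed

lemma finite_colengthI:
  fixes S :: "'k::field fps fps set"
  assumes "max_power N \<subseteq> gen_ideal S"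
  shows "quot_dim scale_xy (gen_ideal S) < \<infinity>"
proof -
  have "quot_dim scale_xy (gen_ideal S) \<le> quot_dim scale_xy (max_power N :: 'k fps fps set)"
    by (rule xy.quot_dim_antimono[OF subspace_max_power subspace_xy_gen_ideal assms])
  also have "\<dots> \<le> enat (card (corner N))"
    by (rule xy.quot_dim_le[OF subspace_max_power finite_corner span_mod_max_power])
  also have "\<dots> < \<infinity>" by simp
  finally show ?thesis .
qed

text \<open>The powers x^N and y^N form a regular sequence in the ideal: from a x^N = l u and a y^N
  = l v follows u y^N = v x^N, so x^N divides u and can be cancelled. No unique factorization is
  involved.\<close>

lemma dvd_of_multiples:
  fixes l :: "'k::field fps fps"
  assumes N: "max_power N \<subseteq> gen_ideal S" and S: "\<And>s. s \<in> S \<Longrightarrow> l dvd a * s"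
  shows "l dvd a"
proof -
  have S': "l dvd a * u" if "u \<in> gen_ideal S" for u
    using that
  proof (induction rule: gen_ideal_induct)
    case (step c s u)
    have "l dvd c * (a * s) + a * u"
      by (rule dvd_add[OF dvd_mult[OF S[OF step(1)]] step(2)])
    also have "c * (a * s) + a * u = a * (c * s + u)" by (simp add: algebra_simps)
    finally show ?case .
  qed simp
  have x: "ser_x ^ N \<in> gen_ideal S" and y: "ser_y ^ N \<in> gen_ideal S"
    using N max_power_power[OF ser_x_in_max_power] max_power_power[OF ser_y_in_max_power] by auto
  obtain u where u: "a * ser_x ^ N = l * u" using S'[OF x] by (rule dvdE)
  obtain v where v: "a * ser_y ^ N = l * v" using S'[OF y] by (rule dvdE)
  show ?thesis
  proof (cases "l = 0")
    case True
    then have "a * ser_y ^ N = 0" using v by simp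
    then have "a = 0" by simp
    then show ?thesis by simp
  next
    case False
    have "l * (u * ser_y ^ N) = l * (v * ser_x ^ N)"
      by (simp only: mult.assoc[symmetric] u[symmetric] v[symmetric]) (simp only: ac_simps)
    then have eq: "u * ser_y ^ N = v * ser_x ^ N" using False by simp
    define w where "w = Abs_fps (\<lambda>b. v $ (b + N))"
    have "u = w * ser_x ^ N"
    proof (rule fps_ext)
      fix b
      have "u $ b = (u * ser_y ^ N) $ (b + N)" by (simp add: fps_X_power_mult_right_nth)
      also have "\<dots> = v $ (b + N) * fps_X ^ N" by (simp add: eq)
      finally show "u $ b = (w * ser_x ^ N) $ b" by (simp add: w_def)
    qed
    then have "a * ser_x ^ N = l * w * ser_x ^ N" using u by (simp only: mult.assoc)
    moreover have "(ser_x :: 'k fps fps) ^ N \<noteq> 0" by simp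
    ultimately have "a = l * w" by (metis mult_right_cancel)
    then show ?thesis by simp
  qed
qed

text \<open>Both \<open>a * f\<close> and \<open>a * l\<close> are multiples of \<open>l\<close>, so
  the preceding divisibility applies to the generators \<open>{f, l}\<close>. This is regularity of
  \<open>f\<close> modulo \<open>l\<close>, the form in which coprimality is used from here
  on.\<close>

lemma dvd_cancel_of_finite_colength:
  fixes l :: "'k::field fps fps"
  assumes fin: "quot_dim scale_xy (gen_ideal {f, l}) < \<infinity>" and "l dvd a * f"
  shows "l dvd a"
proof -
  obtain N where "max_power N \<subseteq> gen_ideal {f, l}"
    using max_power_in_ideal_of_finite_colength[OF fin] .
  then show ?thesis
    by (rule dvd_of_multiples) (use assms in auto)
qed

subsection \<open>Partial derivatives\<close>

lemma deriv_x_nth [simp]: "deriv_x g $ b = fps_deriv (g $ b)"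
  by (simp add: deriv_x_def fps_map_def)

lemma deriv_x_add: "deriv_x (g + h) = deriv_x g + deriv_x h"
  and deriv_x_diff: "deriv_x (g - h) = deriv_x g - deriv_x h"
  and deriv_y_add: "deriv_y (g + h) = deriv_y g + deriv_y h"
  and deriv_y_diff: "deriv_y (g - h) = deriv_y g - deriv_y h"
  by (auto simp: fps_eq_iff deriv_y_def algebra_simps)

lemma deriv_x_mult: "deriv_x (g * h) = deriv_x g * h + g * deriv_x h"
proof (rule fps_ext)
  fix n
  have "fps_deriv (\<Sum>i=0..n. g $ i * h $ (n - i)) = (\<Sum>i=0..n. fps_deriv (g $ i) * h $ (n - i) + g $ i * fps_deriv (h $ (n - i)))"
    by (simp add: fps_deriv_sum add.commute)
  then show "deriv_x (g * h) $ n = (deriv_x g * h + g * deriv_x h) $ n"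
    by (simp add: fps_mult_nth sum.distrib)
qed

lemma deriv_y_mult: "deriv_y (g * h) = deriv_y g * h + g * deriv_y h"
  by (simp add: deriv_y_def add.commute)

lemma deriv_const_xy [simp]: "deriv_x (const_xy c) = 0" "deriv_y (const_xy c) = 0"
  by (auto simp: fps_eq_iff deriv_y_def const_xy_def)

lemma deriv_ser_x [simp]: "deriv_x ser_x = 1" "deriv_y ser_x = 0"
  and deriv_ser_y [simp]: "deriv_x ser_y = 0" "deriv_y ser_y = 1"
  by (auto simp: fps_eq_iff deriv_y_def fps_X_def)

section \<open>Partial derivatives in a principal ideal modulo the equation\<close>

text \<open>\<open>L a g\<close> stands for a functional of a dg. The defect \<open>E\<close> of the
  chain rule obeys the same product rule and vanishes on constants, x and y, so g = c + x u + y v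
  gives \<open>E a g = E (a * ser_x) u + E (a * ser_y) v\<close>. Each such step raises the order of
  the first argument until \<open>vanish\<close> applies, which replaces continuity of
  \<open>L\<close>.\<close>

lemma derivation_expansion:
  fixes L :: "'k::comm_ring_1 fps fps \<Rightarrow> 'k fps fps \<Rightarrow> 'c::ab_group_add"
  assumes add1: "\<And>a b g. L (a + b) g = L a g + L b g"
    and add2: "\<And>a g h. L a (g + h) = L a g + L a h"
    and mult: "\<And>a g h. L a (g * h) = L (a * g) h + L (a * h) g"
    and const: "\<And>a c. L a (const_xy c) = 0"
    and vanish: "\<And>a g. a \<in> max_power M \<Longrightarrow> L a g = 0"
  shows "L a g = L (a * deriv_x g) ser_x + L (a * deriv_y g) ser_y"
proof -
  define E where "E a g = L a g - L (a * deriv_x g) ser_x - L (a * deriv_y g) ser_y" for a g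
  have zero: "L 0 g = 0" for g using vanish by simp
  have E_mult: "E a (g * h) = E (a * g) h + E (a * h) g" for a g h
  proof -
    have "a * deriv_x (g * h) = a * h * deriv_x g + a * g * deriv_x h"
      and "a * deriv_y (g * h) = a * h * deriv_y g + a * g * deriv_y h"
      by (simp_all add: deriv_x_mult deriv_y_mult algebra_simps)
    then show ?thesis by (simp only: E_def mult add1) (simp add: algebra_simps)
  qed
  have E_add: "E a (g + h) = E a g + E a h" for a g h
    by (simp add: E_def add2 deriv_x_add deriv_y_add distrib_left add1)
  have E_gens: "E a ser_x = 0" "E a ser_y = 0" "E a (const_xy c) = 0" for a c
    by (simp_all add: E_def zero const)
  \<comment> \<open>Descending induction on the order of \<open>a\<close>; at \<open>k = M\<close>
    the condition on \<open>a\<close> is void.\<close>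
  have "E a g = 0" if "a \<in> max_power (M - k)" for k a g
    using that
  proof (induction k arbitrary: a g)
    case 0
    then show ?case
      by (simp add: E_def vanish max_power_mult_right)
  next
    case (Suc k)
    have up: "a * z \<in> max_power (M - k)" if "z \<in> max_power 1" for z
    proof -
      have "M - k \<le> M - Suc k + 1" by linarith
      then show ?thesis using max_power_mult[OF Suc.prems that] max_power_antimono by blast
    qed
    obtain u v where "g = const_xy (g $ 0 $ 0) + ser_x * u + ser_y * v"
      using ser_decompose .
    then have "E a g = E a (const_xy (g $ 0 $ 0) + ser_x * u + ser_y * v)" by simp
    also have "\<dots> = E (a * ser_x) u + E (a * ser_y) v"
      by (simp add: E_add E_mult E_gens)
    also have "\<dots> = 0"
      using Suc.IH[OF up[OF ser_x_in_max_power]] Suc.IH[OF up[OF ser_y_in_max_power]] by simp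
    finally show ?case .
  qed
  from this[of a M] show ?thesis by (simp add: E_def algebra_simps)
qed

text \<open>
  Let \<open>n\<close> be the length of \<open>R/(h, f)\<close>. The ring \<open>R/(h, f\<^sup>2)\<close> is free of rank \<open>n\<close> over
  \<open>k[f]/(f\<^sup>2)\<close>, so multiplication by \<open>g\<close> has a matrix \<open>P g + f Q g\<close>, and
  \<open>g \<mapsto> tr (P a * Q g)\<close> is a derivation in the sense above. At \<open>a = 1\<close>, \<open>g = f\<close> it takes
  the value \<open>n\<close>, while the chain rule gives \<open>0\<close> because \<open>P\<close> kills the partial derivatives.
\<close>
lemma unit_of_partials_in_ideal:
  fixes f h :: "'k::field_char_0 fps fps"
  assumes f0: "f $ 0 $ 0 = 0"
    and fin: "quot_dim scale_xy (gen_ideal {f, deriv_x f, deriv_y f}) < \<infinity>"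
    and fx: "deriv_x f \<in> gen_ideal {h, f}" and fy: "deriv_y f \<in> gen_ideal {h, f}"
  shows "h dvd 1"
proof -
  let ?I = "gen_ideal {h, f}" and ?K = "gen_ideal {h, f * f}"
  obtain N where N: "max_power N \<subseteq> gen_ideal {f, deriv_x f, deriv_y f}"
    using max_power_in_ideal_of_finite_colength[OF fin] .
  \<comment> \<open>This is where the isolated singularity enters: (h, f) has finite colength, so
    \<open>h\<close> and \<open>f\<close> are coprime, and it contains the power of m that the chain
    rule needs.\<close>
  have "gen_ideal {f, deriv_x f, deriv_y f} \<subseteq> ?I"
    using fx fy by (intro gen_ideal_subsetI) (auto intro: gen_ideal_base)
  with N have NI: "max_power N \<subseteq> ?I" by blast
  then have finI: "quot_dim scale_xy ?I < \<infinity>" by (rule finite_colengthI)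
  then obtain n where "quot_dim scale_xy ?I = enat n" by (cases "quot_dim scale_xy ?I") auto
  then obtain b where span: "span_mod scale_xy ?I {..<n} b" and indep: "indep_mod scale_xy ?I {..<n} b"
    by (rule xy.quot_dim_basisE)
  define S where "S c = (\<Sum>i<n. const_xy (c i) * b i)" for c :: "nat \<Rightarrow> 'k"
  have S_indep: "c i = 0" if "S c \<in> ?I" "i < n" for c i
    using indep that by (auto simp: indep_mod_def S_def scale_xy_def)
  have S_span: "\<exists>c. u - S c \<in> ?I" for u
    using span by (auto simp: span_mod_def S_def scale_xy_def)
  have S_diff: "S (\<lambda>i. c i - d i) = S c - S d" for c d
    by (simp add: S_def const_xy_diff left_diff_distrib sum_subtractf)
  have S_add: "S (\<lambda>i. c i + d i) = S c + S d" for c d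
    by (simp add: S_def const_xy_add distrib_right sum.distrib)
  have S_zero: "S (\<lambda>i. 0) = 0" by (simp add: S_def)
  have S_comb: "S (\<lambda>i. \<Sum>l<n. e l * m l i) = (\<Sum>l<n. const_xy (e l) * S (m l))" for e m
    unfolding S_def const_xy_sum const_xy_mult sum_distrib_right sum_distrib_left
    by (subst sum.swap) (simp add: mult.assoc)
  have S_unit: "S (\<lambda>i. if i = j then c else 0) = const_xy c * b j" if "j < n" for j c
  proof -
    have "S (\<lambda>i. if i = j then c else 0) = (\<Sum>i<n. if i = j then const_xy c * b i else 0)"
      unfolding S_def by (intro sum.cong) auto
    then show ?thesis using that by simp
  qed
  have KI: "?K \<subseteq> ?I"
    by (intro gen_ideal_subsetI) (auto intro!: gen_ideal_base gen_ideal_mult)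
  have fI: "f * u \<in> ?I" for u
    by (intro gen_ideal_mult_right gen_ideal_base) simp
  have ffK: "f * f * u \<in> ?K" for u
    by (intro gen_ideal_mult_right gen_ideal_base) simp
  have expand: "\<exists>c d. u - S c - f * S d \<in> ?K" for u
  proof -
    obtain c r s where 1: "u - S c = r * h + s * f"
      using S_span[of u] by (auto simp: gen_ideal_2)
    obtain d r' s' where 2: "s - S d = r' * h + s' * f"
      using S_span[of s] by (auto simp: gen_ideal_2)
    have "u - S c - f * S d = r * h + f * (s - S d)" using 1 by (simp add: algebra_simps)
    also have "\<dots> = (r + f * r') * h + s' * (f * f)" unfolding 2 by (simp add: algebra_simps)
    finally show ?thesis by (metis gen_ideal_2)
  qed
  then obtain C D where CD: "\<And>u. u - S (C u) - f * S (D u) \<in> ?K" by metis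
  have uniq: "C u i = c i \<and> D u i = d i" if u: "u - S c - f * S d \<in> ?K" and i: "i < n" for u c d i
  proof -
    define c' where "c' i = c i - C u i" for i
    define d' where "d' i = d i - D u i" for i
    have "S c' + f * S d' = (u - S (C u) - f * S (D u)) - (u - S c - f * S d)"
      unfolding c'_def d'_def S_diff by (simp add: algebra_simps)
    also have "\<dots> \<in> ?K" by (intro gen_ideal_diff CD u)
    finally have K: "S c' + f * S d' \<in> ?K" .
    have "(S c' + f * S d') - f * S d' \<in> ?I"
      by (rule gen_ideal_diff) (use K KI fI in auto)
    then have "S c' \<in> ?I" by simp
    then have c': "c' i = 0" if "i < n" for i using S_indep that by blast
    then have "S c' = 0" by (simp add: S_def)
    \<comment> \<open>With \<open>S c' = 0\<close> the factor \<open>f\<close> can be cancelled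
      modulo \<open>h\<close>, after which \<open>d'\<close> is handled in the same way as
      \<open>c'\<close>.\<close>
    with K obtain r s where "f * S d' = r * h + s * (f * f)" by (auto simp: gen_ideal_2)
    then have "(S d' - s * f) * f = h * r" by (simp add: algebra_simps)
    then have "h dvd (S d' - s * f) * f" by simp
    moreover have "quot_dim scale_xy (gen_ideal {f, h}) < \<infinity>" using finI by (simp add: insert_commute)
    ultimately have "h dvd S d' - s * f" by (rule dvd_cancel_of_finite_colength[rotated])
    then obtain w where "S d' - s * f = h * w" by (rule dvdE)
    then have "S d' = w * h + s * f" by (simp add: algebra_simps)
    then have "S d' \<in> ?I" by (auto simp: gen_ideal_2)
    then have "d' i = 0" using S_indep i by blast
    then show ?thesis using c'[OF i] by (simp add: c'_def d'_def)
  qed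
  define P where "P g i j = C (g * b j) i" for g i j
  define Q where "Q g i j = D (g * b j) i" for g i j
  \<comment> \<open>Multiplication by \<open>g\<close> is k-linear, so on \<open>S c\<close> it acts
    through the columns of \<open>P g + f Q g\<close>.\<close>
  have matrix: "g * S c - S (\<lambda>i. \<Sum>l<n. c l * P g i l) - f * S (\<lambda>i. \<Sum>l<n. c l * Q g i l) \<in> ?K" for g c
  proof -
    have "g * S c - S (\<lambda>i. \<Sum>l<n. c l * P g i l) - f * S (\<lambda>i. \<Sum>l<n. c l * Q g i l)
        = (\<Sum>l<n. const_xy (c l) * (g * b l - S (C (g * b l)) - f * S (D (g * b l))))"
      unfolding S_comb P_def Q_def
      by (simp add: S_def[of c] sum_distrib_left sum_subtractf right_diff_distrib mult.left_commute)
    also have "\<dots> \<in> ?K" by (intro gen_ideal_sum gen_ideal_mult CD)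
    finally show ?thesis .
  qed
  have PQ_mult: "P (g * u) i j = (\<Sum>l<n. P u l j * P g i l) \<and>
      Q (g * u) i j = (\<Sum>l<n. P u l j * Q g i l) + (\<Sum>l<n. Q u l j * P g i l)"
    if i: "i < n" for g u i j
  proof -
    define c where "c = C (u * b j)"
    define d where "d = D (u * b j)"
    let ?T = "\<lambda>e M. S (\<lambda>i. \<Sum>l<n. e l * M i l)"
    have "g * u * b j - ?T c (P g) - f * (?T c (Q g) + ?T d (P g))
        = g * (u * b j - S c - f * S d) + (g * S c - ?T c (P g) - f * ?T c (Q g))
          + f * (g * S d - ?T d (P g) - f * ?T d (Q g)) + f * f * ?T d (Q g)"
      by (simp add: algebra_simps)
    also have "\<dots> \<in> ?K"
      unfolding c_def d_def by (intro gen_ideal_add gen_ideal_mult matrix CD ffK)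
    finally have "g * u * b j - ?T c (P g) - f * S (\<lambda>i. (\<Sum>l<n. c l * Q g i l) + (\<Sum>l<n. d l * P g i l)) \<in> ?K"
      by (simp only: S_add)
    from uniq[OF this i] show ?thesis by (simp add: P_def Q_def c_def d_def mult.assoc)
  qed
  have PQ_add: "P (g + u) i j = P g i j + P u i j \<and> Q (g + u) i j = Q g i j + Q u i j"
    if "i < n" for g u i j
  proof -
    have "(g + u) * b j - S (\<lambda>i. C (g * b j) i + C (u * b j) i) - f * S (\<lambda>i. D (g * b j) i + D (u * b j) i)
        = (g * b j - S (C (g * b j)) - f * S (D (g * b j))) + (u * b j - S (C (u * b j)) - f * S (D (u * b j)))"
      unfolding S_add by (simp add: algebra_simps)
    also have "\<dots> \<in> ?K" by (intro gen_ideal_add CD)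
    finally show ?thesis using uniq that by (auto simp: P_def Q_def)
  qed
  have P_ideal: "P g i j = 0" if "g \<in> ?I" "i < n" for g i j
  proof -
    have "S (C (g * b j)) = g * b j - f * S (D (g * b j)) - (g * b j - S (C (g * b j)) - f * S (D (g * b j)))"
      by simp
    also have "\<dots> \<in> ?I"
      using gen_ideal_diff[OF gen_ideal_diff[OF gen_ideal_mult_right[OF that(1)] fI] subsetD[OF KI CD]] .
    finally show ?thesis using S_indep that by (auto simp: P_def)
  qed
  have PQ_const: "P (const_xy c) i j = (if i = j then c else 0) \<and> Q (const_xy c) i j = 0"
    if "i < n" "j < n" for c i j
  proof -
    have "const_xy c * b j - S (\<lambda>i. if i = j then c else 0) - f * S (\<lambda>i. 0) \<in> ?K"
      using that by (simp add: S_unit S_zero gen_ideal_zero)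
    from uniq[OF this \<open>i < n\<close>] show ?thesis by (simp add: P_def Q_def)
  qed
  have Q_f: "Q f i j = (if i = j then 1 else 0)" if "i < n" "j < n" for i j
  proof -
    have "f * b j - S (\<lambda>i. 0) - f * S (\<lambda>i. if i = j then 1 else 0) \<in> ?K"
      using that by (simp add: S_unit S_zero gen_ideal_zero)
    from uniq[OF this \<open>i < n\<close>] show ?thesis by (simp add: Q_def)
  qed
  define L where "L a g = (\<Sum>i<n. \<Sum>j<n. P a i j * Q g j i)" for a g
  have "L 1 f = L (1 * deriv_x f) ser_x + L (1 * deriv_y f) ser_y"
  proof (rule derivation_expansion)
    fix a b g show "L (a + b) g = L a g + L b g"
      by (simp add: L_def PQ_add distrib_right sum.distrib)
  next
    fix a g u show "L a (g + u) = L a g + L a u"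
      by (simp add: L_def PQ_add distrib_left sum.distrib)
  next
    fix a g u
    \<comment> \<open>In matrix terms P(gu) = P(g) P(u) and Q(gu) = Q(g) P(u) + P(g) Q(u). The
      exchanges of sums are the cyclicity tr(P(a) Q(g) P(u)) = tr(P(u) P(a) Q(g)).\<close>
    have "L a (g * u) = (\<Sum>i<n. \<Sum>j<n. \<Sum>l<n. P a i j * P u l i * Q g j l)
        + (\<Sum>i<n. \<Sum>j<n. \<Sum>l<n. P g j l * P a i j * Q u l i)"
      by (simp add: L_def PQ_mult distrib_left sum.distrib sum_distrib_left ac_simps)
    also have "(\<Sum>i<n. \<Sum>j<n. \<Sum>l<n. P a i j * P u l i * Q g j l) = (\<Sum>i<n. \<Sum>l<n. \<Sum>j<n. P a i j * P u l i * Q g j l)"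
      by (intro sum.cong refl sum.swap)
    also have "\<dots> = (\<Sum>l<n. \<Sum>i<n. \<Sum>j<n. P a i j * P u l i * Q g j l)" by (rule sum.swap)
    also have "\<dots> = (\<Sum>l<n. \<Sum>j<n. \<Sum>i<n. P a i j * P u l i * Q g j l)"
      by (intro sum.cong refl sum.swap)
    also have "\<dots> = L (u * a) g"
      by (simp add: L_def PQ_mult sum_distrib_right)
    also have "(\<Sum>i<n. \<Sum>j<n. \<Sum>l<n. P g j l * P a i j * Q u l i) = (\<Sum>i<n. \<Sum>l<n. \<Sum>j<n. P g j l * P a i j * Q u l i)"
      by (intro sum.cong refl sum.swap)
    also have "\<dots> = L (a * g) u"
      by (simp add: L_def PQ_mult sum_distrib_right)
    finally show "L a (g * u) = L (a * g) u + L (a * u) g" by (simp add: ac_simps)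
  next
    fix a c show "L a (const_xy c) = 0" by (simp add: L_def PQ_const)
  next
    fix a g :: "'k fps fps" assume "a \<in> max_power N"
    then show "L a g = 0" using NI P_ideal by (auto simp: L_def)
  qed
  also have "\<dots> = 0" using P_ideal[OF fx] P_ideal[OF fy] by (simp add: L_def)
  also have "L 1 f = (\<Sum>i<n. \<Sum>j<n. if i = j then 1 else 0)"
    unfolding L_def using PQ_const[of _ _ 1] by (intro sum.cong) (auto simp: Q_f)
  finally have "of_nat n = (0::'k)" by simp
  \<comment> \<open>Characteristic 0 makes (h, f) the whole ring; as \<open>f\<close> has no
    constant term, \<open>h\<close> must have one.\<close>
  then have "n = 0" by simp
  then obtain r s where "1 = r * h + s * f"
    using S_span[of 1] by (auto simp: S_def gen_ideal_2)
  then have "(1 :: 'k fps fps) $ 0 $ 0 = (r * h + s * f) $ 0 $ 0" by simp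
  then have "h $ 0 $ 0 \<noteq> 0" using f0 by (auto simp: nth00_mult)
  then show ?thesis by (rule ser_unitI)
qed

section \<open>Linear growth and reductions\<close>

lemma exact_order:
  assumes "g \<notin> max_power m"
  obtains p where "p < m" "g \<in> max_power p" "g \<notin> max_power (Suc p)"
proof -
  obtain p where p: "g \<notin> max_power p" "\<forall>i<p. g \<in> max_power i"
    using exists_least_iff[of "\<lambda>i. g \<notin> max_power i"] assms by blast
  then obtain p' where "p = Suc p'" by (cases p) auto
  moreover have "p \<le> m" using p(2) assms not_le by blast
  ultimately show ?thesis using that[of p'] p by auto
qed

lemma leading_coefficient:
  assumes "g \<in> max_power p" "g \<notin> max_power (Suc p)"
  obtains b where "b \<le> p" "g $ b $ (p - b) \<noteq> 0" "\<And>i. i < b \<Longrightarrow> g $ i $ (p - i) = 0"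
proof -
  from assms obtain a b' where "a + b' = p" "g $ b' $ a \<noteq> 0"
    by (auto simp: max_power_def less_Suc_eq)
  then have "b' \<le> p \<and> g $ b' $ (p - b') \<noteq> 0" by auto
  then show ?thesis
    using exists_least_iff[of "\<lambda>b. b \<le> p \<and> g $ b $ (p - b) \<noteq> 0"] that
    by (metis le_trans less_imp_le_nat)
qed

text \<open>Leading terms multiply: among the terms of lowest degree take the one with the smallest
  y-exponent, \<open>b\<close> for \<open>g\<close> and \<open>c\<close> for \<open>h\<close>. Any
  other contribution to the coefficient of the product has too small a degree in one factor, or
  equal degrees and too small a y-exponent in one factor.\<close>

lemma order_mult:
  fixes g h :: "'k::idom fps fps"
  assumes g: "g \<in> max_power p" "g \<notin> max_power (Suc p)"
    and h: "h \<in> max_power q" "h \<notin> max_power (Suc q)"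
  shows "g * h \<notin> max_power (Suc (p + q))"
proof -
  obtain b where b: "b \<le> p" "g $ b $ (p - b) \<noteq> 0" "\<And>i. i < b \<Longrightarrow> g $ i $ (p - i) = 0"
    using leading_coefficient[OF g] by blast
  obtain c where c: "c \<le> q" "h $ c $ (q - c) \<noteq> 0" "\<And>i. i < c \<Longrightarrow> h $ i $ (q - i) = 0"
    using leading_coefficient[OF h] by blast
  let ?a = "p + q - (b + c)"
  have vanish: "g $ i $ j * h $ (b + c - i) $ (?a - j) = 0"
    if "i \<le> b + c" "j \<le> ?a" "(i, j) \<noteq> (b, p - b)" for i j
  proof -
    consider "j + i < p" | "p < j + i" | "j + i = p" by linarith
    then show ?thesis
    proof cases
      case 1
      then show ?thesis using g by (simp add: max_power_def)
    next
      case 2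
      then have "(?a - j) + (b + c - i) < q" using that b c by linarith
      then show ?thesis using h by (simp add: max_power_def)
    next
      case 3
      then have j: "j = p - i" by simp
      show ?thesis
      proof (cases "i < b")
        case True
        then show ?thesis using b j by simp
      next
        case False
        with that j have "b < i" by (cases "i = b") auto
        moreover have "?a - j = q - (b + c - i)" using 3 that b c by linarith
        ultimately show ?thesis using c(3)[of "b + c - i"] that by auto
      qed
    qed
  qed
  have "(g * h) $ (b + c) $ ?a = (\<Sum>i=0..b + c. \<Sum>j=0..?a. g $ i $ j * h $ (b + c - i) $ (?a - j))"
    by (simp add: fps_mult_nth fps_sum_nth)
  also have "\<dots> = (\<Sum>i=0..b + c. if i = b then (\<Sum>j=0..?a. if j = p - b then g $ b $ (p - b) * h $ c $ (q - c) else 0) else 0)"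
  proof (intro sum.cong refl)
    fix i assume i: "i \<in> {0..b + c}"
    have a: "?a - (p - b) = q - c" using b c by linarith
    show "(\<Sum>j=0..?a. g $ i $ j * h $ (b + c - i) $ (?a - j)) =
      (if i = b then (\<Sum>j=0..?a. if j = p - b then g $ b $ (p - b) * h $ c $ (q - c) else 0) else 0)"
    proof (cases "i = b")
      case True
      have "g $ b $ j * h $ (b + c - b) $ (?a - j) = (if j = p - b then g $ b $ (p - b) * h $ c $ (q - c) else 0)"
        if "j \<in> {0..?a}" for j
      proof (cases "j = p - b")
        case True
        then show ?thesis by (simp only: a simp_thms if_True add_diff_cancel_left')
      next
        case False
        then show ?thesis using vanish[of b j] that by auto
      qed
      then have "(\<Sum>j=0..?a. g $ b $ j * h $ (b + c - b) $ (?a - j))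
          = (\<Sum>j=0..?a. if j = p - b then g $ b $ (p - b) * h $ c $ (q - c) else 0)"
        by (intro sum.cong refl)
      then show ?thesis by (simp only: True simp_thms if_True)
    next
      case False
      then show ?thesis using vanish i by (auto intro!: sum.neutral)
    qed
  qed
  also have "\<dots> = g $ b $ (p - b) * h $ c $ (q - c)"
    using b c by auto
  also have "\<dots> \<noteq> 0" using b c by simp
  finally have "(g * h) $ (b + c) $ ?a \<noteq> 0" .
  moreover have "?a + (b + c) < Suc (p + q)" using b c by linarith
  ultimately show ?thesis unfolding max_power_def by blast
qed

lemma max_power_cancel:
  fixes g h :: "'k::idom fps fps"
  assumes "g * h \<in> max_power (m + q)" "h \<in> max_power q" "h \<notin> max_power (Suc q)"
  shows "g \<in> max_power m"
proof (rule ccontr)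
  assume "g \<notin> max_power m"
  then obtain p where p: "p < m" "g \<in> max_power p" "g \<notin> max_power (Suc p)"
    by (rule exact_order)
  have "Suc (p + q) \<le> m + q" using p by simp
  then have "g * h \<in> max_power (Suc (p + q))" using assms(1) max_power_antimono by blast
  then show False using order_mult[OF p(2,3) assms(2,3)] by simp
qed

subsection \<open>Powers of an ideal with two generators\<close>

text \<open>A binary form of degree \<open>s\<close> evaluated at (p, q). Its coefficients are ring
  elements and not unique, so relations can be rewritten by moving factors \<open>p\<close> or
  \<open>q\<close> into them.\<close>

definition form :: "'r::comm_ring_1 \<Rightarrow> 'r \<Rightarrow> nat \<Rightarrow> (nat \<Rightarrow> 'r) \<Rightarrow> 'r" where
  "form p q s C = (\<Sum>i\<le>s. C i * (p ^ (s - i) * q ^ i))"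

lemma form_add: "form p q s C + form p q s D = form p q s (\<lambda>i. C i + D i)"
  and form_diff: "form p q s C - form p q s D = form p q s (\<lambda>i. C i - D i)"
  and form_scale: "r * form p q s C = form p q s (\<lambda>i. r * C i)"
  by (simp_all add: form_def sum.distrib sum_subtractf algebra_simps sum_distrib_left)

lemma form_Suc: "form p q (Suc s) C = p * form p q s C + C (Suc s) * q ^ Suc s"
proof -
  have "(\<Sum>i\<le>s. C i * (p ^ (Suc s - i) * q ^ i)) = p * form p q s C"
    unfolding form_def sum_distrib_left
    by (intro sum.cong refl) (simp add: Suc_diff_le algebra_simps)
  then show ?thesis by (simp add: form_def)
qed

lemma form_times_q: "q * form p q s C = form p q (Suc s) (\<lambda>i. if i = 0 then 0 else C (i - 1))"
  unfolding form_def sum.atMost_Suc_shift by (simp add: sum_distrib_left algebra_simps)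

lemma form_times_p: "p * form p q s C = form p q (Suc s) (\<lambda>i. if i \<le> s then C i else 0)"
  unfolding form_Suc by (simp add: form_def)

lemma form_unit: "b \<le> s \<Longrightarrow> form p q s (\<lambda>i. if i = b then 1 else 0) = p ^ (s - b) * q ^ b"
proof -
  assume "b \<le> s"
  have "form p q s (\<lambda>i. if i = b then 1 else 0) = (\<Sum>i\<le>s. if i = b then p ^ (s - b) * q ^ b else 0)"
    unfolding form_def by (intro sum.cong) auto
  then show ?thesis using \<open>b \<le> s\<close> by simp
qed

lemma ideal_power_gen_ideal: "gen_ideal (ideal_power I s) = ideal_power I s"
proof
  show "gen_ideal (ideal_power I s) \<subseteq> ideal_power I s"
    by (cases s) (auto simp del: UNIV_I intro: gen_ideal_subsetI[THEN subsetD])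
qed (auto intro: gen_ideal_base)

lemmas ideal_power_add = gen_ideal_add[of _ "ideal_power I s" for I s, unfolded ideal_power_gen_ideal]
lemmas ideal_power_diff = gen_ideal_diff[of _ "ideal_power I s" for I s, unfolded ideal_power_gen_ideal]
lemmas ideal_power_zero = gen_ideal_zero[of "ideal_power I s" for I s, unfolded ideal_power_gen_ideal]
lemmas ideal_power_mult = gen_ideal_mult[of _ "ideal_power I s" for I s, unfolded ideal_power_gen_ideal]
lemmas ideal_power_sum = gen_ideal_sum[of _ _ "ideal_power I s" for I s, unfolded ideal_power_gen_ideal]

lemma ideal_power_times:
  "a \<in> I \<Longrightarrow> b \<in> ideal_power I s \<Longrightarrow> a * b \<in> ideal_power I (Suc s)"
  by (auto intro!: gen_ideal_base)

lemma ideal_power_Suc_subset: "ideal_power I (Suc s) \<subseteq> ideal_power I s"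
proof -
  have "ideal_power I (Suc s) \<subseteq> gen_ideal (ideal_power I s)"
    unfolding ideal_power.simps
    by (rule gen_ideal_subsetI) (auto intro: ideal_power_mult simp: ideal_power_gen_ideal)
  then show ?thesis by (simp only: ideal_power_gen_ideal)
qed

lemma ideal_power_antimono: "s \<le> t \<Longrightarrow> ideal_power I t \<subseteq> ideal_power I s"
  by (rule lift_Suc_antimono_le[of "ideal_power I"]) (rule ideal_power_Suc_subset)

lemma ideal_power_form: "ideal_power (gen_ideal {p, q}) s = range (form p q s)"
proof (induction s)
  case 0
  have "u = form p q 0 (\<lambda>_. u)" for u by (simp add: form_def)
  then show ?case by auto
next
  case (Suc s)
  show ?case
  proof
    show "ideal_power (gen_ideal {p, q}) (Suc s) \<subseteq> range (form p q (Suc s))"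
      unfolding ideal_power.simps
    proof (rule gen_ideal_least)
      show "{a * b |a b. a \<in> gen_ideal {p, q} \<and> b \<in> ideal_power (gen_ideal {p, q}) s} \<subseteq> range (form p q (Suc s))"
      proof clarify
        fix a b assume "a \<in> gen_ideal {p, q}" "b \<in> ideal_power (gen_ideal {p, q}) s"
        then obtain r t C where "a = r * p + t * q" "b = form p q s C"
          using Suc by (auto simp: gen_ideal_2)
        then have "a * b = r * (p * form p q s C) + t * (q * form p q s C)"
          by (simp add: algebra_simps)
        then show "a * b \<in> range (form p q (Suc s))"
          by (simp only: form_times_p form_times_q form_scale form_add) simp
      qed
      show "0 \<in> range (form p q (Suc s))"
        by (rule range_eqI[of _ _ "\<lambda>_. 0"]) (simp add: form_def)
    qed (auto simp: form_add form_scale)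
    show "range (form p q (Suc s)) \<subseteq> ideal_power (gen_ideal {p, q}) (Suc s)"
    proof clarify
      fix C
      have "q ^ s = form p q s (\<lambda>i. if i = s then 1 else 0)"
        by (simp add: form_unit)
      then have "q ^ s \<in> ideal_power (gen_ideal {p, q}) s" using Suc by simp
      then have "p * form p q s C + C (Suc s) * (q * q ^ s) \<in> ideal_power (gen_ideal {p, q}) (Suc s)"
        using Suc by (intro ideal_power_add ideal_power_mult ideal_power_times) (auto intro: gen_ideal_base)
      then show "form p q (Suc s) C \<in> ideal_power (gen_ideal {p, q}) (Suc s)"
        by (simp only: form_Suc power_Suc)
    qed
  qed
qed

lemma monomial_in_ideal_power: "p ^ a * q ^ b \<in> ideal_power (gen_ideal {p, q}) (a + b)"
proof -
  have "p ^ a * q ^ b = form p q (a + b) (\<lambda>i. if i = b then 1 else 0)"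
    by (simp add: form_unit)
  then show ?thesis by (simp add: ideal_power_form)
qed

lemma gen_ideal_insert_ideal_power:
  "u \<in> gen_ideal (insert f (ideal_power I s)) \<longleftrightarrow> (\<exists>r. u - r * f \<in> ideal_power I s)"
  by (simp add: gen_ideal_insert ideal_power_gen_ideal)

text \<open>This links the coefficientwise filtration with products of ideals. One variable is split
  off at a time: \<open>u\<close> takes the terms free of y, divided by x, and \<open>v\<close> all
  others, divided by y.\<close>

lemma max_power_add_products:
  fixes g :: "'k::comm_ring_1 fps fps"
  assumes "g \<in> max_power (m + n)"
  shows "g \<in> gen_ideal {a * b | a b. a \<in> max_power m \<and> b \<in> max_power n}"
  using assms
proof (induction m arbitrary: g)
  case 0
  then show ?case by (intro gen_ideal_base) (auto intro: exI[of _ 1])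
next
  case (Suc m)
  let ?T = "\<lambda>m. gen_ideal {a * b | a b. a \<in> max_power m \<and> b \<in> (max_power n :: 'k fps fps set)}"
  define u where "u = fps_const (fps_shift 1 (g $ 0))"
  define v where "v = fps_shift 1 g"
  have g: "g = ser_x * u + ser_y * v"
  proof (rule ser_eqI)
    fix b a show "g $ b $ a = (ser_x * u + ser_y * v) $ b $ a"
      using Suc.prems by (auto simp: u_def v_def fps_X_mult_nth max_power_def)
  qed
  have uv: "u \<in> max_power (m + n)" "v \<in> max_power (m + n)"
    using Suc.prems by (auto simp: u_def v_def max_power_def)
  have step: "z * w \<in> ?T (Suc m)" if "w \<in> ?T m" "z \<in> max_power 1" for z w
    using that(1)
  proof (induction rule: gen_ideal_induct)
    case zero
    then show ?case by (simp add: gen_ideal_zero)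
  next
    case (step c w w')
    then obtain a b where ab: "w = a * b" "a \<in> max_power m" "b \<in> max_power n" by auto
    have "z * a \<in> max_power (Suc m)" using max_power_mult[OF \<open>z \<in> max_power 1\<close> ab(2)] by simp
    then have "(z * a) * b \<in> ?T (Suc m)" using ab(3) by (blast intro: gen_ideal_base)
    then have "c * ((z * a) * b) + z * w' \<in> ?T (Suc m)"
      by (rule gen_ideal_add[OF gen_ideal_mult]) (use step in auto)
    also have "c * ((z * a) * b) + z * w' = z * (c * w + w')" by (simp add: ab algebra_simps)
    finally show ?case .
  qed
  show ?case unfolding g
    by (intro gen_ideal_add step Suc.IH uv ser_x_in_max_power ser_y_in_max_power)
qed

text \<open>Modulo \<open>f\<close> the ideal m^N lies in J = (p, q), so its s-th power lies in J^s;
  two congruences modulo \<open>f\<close> are multiplied in each step.\<close>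

lemma max_power_subset_ideal_power:
  fixes f p q :: "'k::comm_ring_1 fps fps"
  assumes N: "max_power N \<subseteq> gen_ideal {f, p, q}"
  shows "max_power (N * s) \<subseteq> gen_ideal (insert f (ideal_power (gen_ideal {p, q}) s))"
proof (induction s)
  case 0
  show ?case using gen_ideal_base[of _ UNIV] by auto
next
  case (Suc s)
  let ?J = "gen_ideal {p, q}"
  show ?case
  proof
    fix g :: "'k fps fps" assume "g \<in> max_power (N * Suc s)"
    then have "g \<in> gen_ideal {a * b | a b. a \<in> max_power N \<and> b \<in> max_power (N * s)}"
      by (intro max_power_add_products) simp
    moreover have "{a * b | a b. a \<in> max_power N \<and> b \<in> max_power (N * s)}
        \<subseteq> gen_ideal (insert f (ideal_power ?J (Suc s)))"
    proof clarify
      fix a b :: "'k fps fps" assume "a \<in> max_power N" "b \<in> max_power (N * s)"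
      then obtain r r' where r: "a - r * f \<in> ?J" "b - r' * f \<in> ideal_power ?J s"
        using N Suc unfolding gen_ideal_insert[of f] ideal_power_gen_ideal by blast
      have "a * b - (r' * a + r * b - r * r' * f) * f = (a - r * f) * (b - r' * f)"
        by (simp add: algebra_simps)
      also have "\<dots> \<in> ideal_power ?J (Suc s)"
        by (rule ideal_power_times[OF r])
      finally show "a * b \<in> gen_ideal (insert f (ideal_power ?J (Suc s)))"
        unfolding gen_ideal_insert_ideal_power by blast
    qed
    ultimately show "g \<in> gen_ideal (insert f (ideal_power ?J (Suc s)))"
      using gen_ideal_subsetI by blast
  qed
qed

subsection \<open>Existence of a homogeneous relation\<close>

text \<open>The hypothesis \<open>none\<close> says that the fibre cone of (p, q) modulo
  \<open>f\<close> is a polynomial ring in two variables. Coefficients are killed degree by degree: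
  once those below degree k vanish, all terms above degree k lie in J^(k+1), which leaves a form of
  degree k that is a form of degree k+1 modulo \<open>f\<close>.\<close>

lemma monomials_independent:
  fixes f p q :: "'k::field fps fps"
  assumes pq: "p \<in> max_power 1" "q \<in> max_power 1"
    and none: "\<And>s C i. form p q s C \<in> gen_ideal {f} \<Longrightarrow> i \<le> s \<Longrightarrow> C i $ 0 $ 0 = 0"
    and rel: "(\<Sum>(a, b)\<in>corner s. const_xy (c (a, b)) * (p ^ a * q ^ b))
      \<in> gen_ideal (insert f (ideal_power (gen_ideal {p, q}) s))"
    and "a + b < s"
  shows "c (a, b) = 0"
proof -
  let ?J = "gen_ideal {p, q}"
  let ?m = "\<lambda>(a, b). const_xy (c (a, b)) * (p ^ a * q ^ b)"
  have "k \<le> s \<Longrightarrow> \<forall>a b. a + b < k \<longrightarrow> c (a, b) = 0" for k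
  proof (induction k)
    case (Suc k)
    then have IH: "\<And>a b. a + b < k \<Longrightarrow> c (a, b) = 0" by simp
    define A where "A = (\<lambda>i. (k - i, i)) ` {..k}"
    define B where "B = {(a, b) \<in> corner s. k < a + b}"
    have "B \<subseteq> corner s" by (auto simp: B_def)
    then have fin: "finite A" "finite B" by (auto simp: A_def intro: finite_subset)
    have AB: "A \<union> B \<subseteq> corner s" "A \<inter> B = {}"
      using Suc.prems by (auto simp: A_def B_def corner_def)
    have "(\<Sum>x\<in>corner s. ?m x) = (\<Sum>x\<in>A \<union> B. ?m x)"
    proof (rule sum.mono_neutral_right)
      show "\<forall>x\<in>corner s - (A \<union> B). ?m x = 0"
      proof
        fix x assume x: "x \<in> corner s - (A \<union> B)"
        obtain a b where ab': "x = (a, b)" by (cases x)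
        then have ab: "(a, b) \<in> corner s" "(a, b) \<notin> A \<union> B" using x by auto
        then have "a + b \<noteq> k" by (auto simp: A_def image_iff)
        then have "a + b < k" using ab by (auto simp: B_def)
        then show "?m x = 0" using IH ab' by simp
      qed
    qed (use AB in auto)
    also have "\<dots> = (\<Sum>x\<in>A. ?m x) + (\<Sum>x\<in>B. ?m x)"
      using fin AB by (intro sum.union_disjoint) auto
    also have "(\<Sum>x\<in>A. ?m x) = form p q k (\<lambda>i. const_xy (c (k - i, i)))"
      unfolding A_def form_def by (subst sum.reindex) (auto simp: inj_on_def)
    finally have split: "(\<Sum>x\<in>corner s. ?m x) = form p q k (\<lambda>i. const_xy (c (k - i, i))) + (\<Sum>x\<in>B. ?m x)" .
    have B: "(\<Sum>x\<in>B. ?m x) \<in> ideal_power ?J (Suc k)"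
    proof (rule ideal_power_sum, clarify)
      fix a b assume "(a, b) \<in> B"
      then have "ideal_power ?J (a + b) \<subseteq> ideal_power ?J (Suc k)"
        by (intro ideal_power_antimono) (auto simp: B_def)
      then show "const_xy (c (a, b)) * (p ^ a * q ^ b) \<in> ideal_power ?J (Suc k)"
        using monomial_in_ideal_power by (blast intro: ideal_power_mult)
    qed
    obtain r where r: "(\<Sum>x\<in>corner s. ?m x) - r * f \<in> ideal_power ?J s"
      using rel unfolding gen_ideal_insert_ideal_power by blast
    then have "(\<Sum>x\<in>corner s. ?m x) - r * f \<in> ideal_power ?J (Suc k)"
      using ideal_power_antimono[OF Suc.prems] by blast
    from ideal_power_diff[OF this B]
    obtain C where C: "form p q k (\<lambda>i. const_xy (c (k - i, i))) - r * f = form p q (Suc k) C"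
      unfolding split ideal_power_form by (auto simp: algebra_simps)
    \<comment> \<open>The form of degree k+1 is rewritten as one of degree k with coefficients in
      the maximal ideal, as \<open>p\<close> and \<open>q\<close> lie there; \<open>none\<close>
      then sees only the constants \<open>c\<close>.\<close>
    have "C (Suc k) * q ^ Suc k = form p q k (\<lambda>i. C (Suc k) * q * (if i = k then 1 else 0))"
      by (simp add: form_unit flip: form_scale)
    then have "form p q (Suc k) C = form p q k (\<lambda>i. p * C i + C (Suc k) * q * (if i = k then 1 else 0))"
      unfolding form_Suc by (simp add: form_scale form_add)
    then have "form p q k (\<lambda>i. const_xy (c (k - i, i)) - (p * C i + C (Suc k) * q * (if i = k then 1 else 0))) = r * f"
      using C by (simp add: algebra_simps flip: form_diff)
    then have "form p q k (\<lambda>i. const_xy (c (k - i, i)) - (p * C i + C (Suc k) * q * (if i = k then 1 else 0))) \<in> gen_ideal {f}"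
      by (auto simp: gen_ideal_1)
    from none[OF this] pq have "\<And>i. i \<le> k \<Longrightarrow> c (k - i, i) = 0"
      by (simp add: nth00_mult max_power_1 const_xy_nth)
    then have "c (a, b) = 0" if "a + b = k" for a b
      using that by (metis add_diff_cancel_right' le_add2)
    with IH show ?case by (auto simp: less_Suc_eq)
  qed simp
  from this[of s] \<open>a + b < s\<close> show ?thesis by simp
qed

text \<open>
  Otherwise the monomials of degree less than \<open>s\<close> in \<open>p, q\<close>, about \<open>s\<^sup>2/2\<close> in number, are independent
  modulo \<open>(f) + J\<^sup>s\<close>, which contains \<open>(f) + m\<^sup>j\<close> with \<open>j\<close> linear in \<open>s\<close>; but \<open>R/(f, m\<^sup>j)\<close> has
  dimension at most \<open>\<mu> j\<close>, where \<open>\<mu>\<close> is the order of \<open>f\<close>.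
\<close>
lemma homogeneous_relation:
  fixes f p q :: "'k::field fps fps"
  assumes f: "f \<noteq> 0" "f $ 0 $ 0 = 0" and pq: "p \<in> max_power 1" "q \<in> max_power 1"
    and N: "max_power N \<subseteq> gen_ideal {f, p, q}"
  shows "\<exists>s C i. form p q s C \<in> gen_ideal {f} \<and> i \<le> s \<and> C i $ 0 $ 0 \<noteq> 0"
proof (rule ccontr)
  assume "\<not> ?thesis"
  then have none: "\<And>s C i. form p q s C \<in> gen_ideal {f} \<Longrightarrow> i \<le> s \<Longrightarrow> C i $ 0 $ 0 = 0" by blast
  obtain m where "f \<notin> max_power m" using f max_power_Inter by blast
  then obtain \<mu> where \<mu>: "f \<in> max_power \<mu>" "f \<notin> max_power (Suc \<mu>)" by (rule exact_order)
  have "\<mu> > 0" using \<mu> f by (cases \<mu>) (auto simp: max_power_1)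
  \<comment> \<open>The successor keeps \<open>M\<close>, and with it \<open>s\<close>, positive.
    The choices of \<open>s\<close> and \<open>j\<close> give s^2 = 2 \<mu> j, which is just enough:
    the s(s+1)/2 + (j-\<mu>)(j-\<mu>+1)/2 vectors below then outnumber the j(j+1)/2 monomials
    spanning R modulo m^j.\<close>
  define M where "M = Suc N"
  have M: "max_power M \<subseteq> gen_ideal {f, p, q}" using N max_power_antimono[of N M] by (auto simp: M_def)
  define s where "s = 2 * \<mu> * M"
  define j where "j = M * s"
  have js: "s > 0" "\<mu> \<le> j" using \<open>\<mu> > 0\<close> by (auto simp: s_def j_def M_def)
  \<comment> \<open>The multiples of \<open>f\<close> by monomials of degree below j-\<mu> account
    for the ideal (f) modulo m^j; they stay independent because \<open>f\<close> has order exactly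
    \<mu>.\<close>
  let ?v = "case_sum (\<lambda>(a, b). p ^ a * q ^ b) (\<lambda>x. monomial_xy x * f)"
  have "indep_mod scale_xy (max_power j) (corner s <+> corner (j - \<mu>)) ?v"
    unfolding indep_mod_def
  proof (intro allI impI)
    fix c assume "(\<Sum>i\<in>corner s <+> corner (j - \<mu>). scale_xy (c i) (?v i)) \<in> max_power j"
    then have *: "(\<Sum>(a, b)\<in>corner s. const_xy (c (Inl (a, b))) * (p ^ a * q ^ b))
        + (\<Sum>x\<in>corner (j - \<mu>). const_xy (c (Inr x)) * monomial_xy x) * f \<in> max_power j"
      by (simp add: sum.Plus scale_xy_def sum_distrib_right mult.assoc case_prod_unfold)
    let ?S = "\<Sum>(a, b)\<in>corner s. const_xy (c (Inl (a, b))) * (p ^ a * q ^ b)"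
    let ?T = "\<Sum>x\<in>corner (j - \<mu>). const_xy (c (Inr x)) * monomial_xy x"
    let ?K = "gen_ideal (insert f (ideal_power (gen_ideal {p, q}) s))"
    have "?S + ?T * f \<in> ?K"
      using * max_power_subset_ideal_power[OF M, of s] by (auto simp: j_def)
    moreover have "?T * f \<in> ?K" by (intro gen_ideal_mult gen_ideal_base) simp
    ultimately have "(?S + ?T * f) - ?T * f \<in> ?K" by (rule gen_ideal_diff)
    then have "?S \<in> ?K" by simp
    then have c1: "c (Inl (a, b)) = 0" if "a + b < s" for a b
      using that \<open>?S \<in> ?K\<close>
      by (intro monomials_independent[where c = "\<lambda>x. c (Inl x)" and s = s and f = f and p = p and q = q] pq)
        (auto intro: none)
    then have "?S = 0" by (intro sum.neutral) (auto simp: corner_def)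
    with * have "?T * f \<in> max_power (j - \<mu> + \<mu>)" using js by simp
    then have "?T \<in> max_power (j - \<mu>)" by (rule max_power_cancel[OF _ \<mu>])
    then have "c (Inr (a, b)) = 0" if "a + b < j - \<mu>" for a b
      using that sum_corner_nth[of "\<lambda>x. c (Inr x)" "j - \<mu>" b a] by (simp add: max_power_def)
    with c1 show "\<forall>i\<in>corner s <+> corner (j - \<mu>). c i = 0" by (auto simp: corner_def)
  qed
  from xy.card_indep_mod_le_span_mod[OF subspace_max_power _ _ span_mod_max_power this]
  have "card (corner s) + card (corner (j - \<mu>)) \<le> card (corner j)"
    by (simp add: card_Plus)
  then have "s * (s + 1) + (j - \<mu>) * (j - \<mu> + 1) \<le> j * (j + 1)"
    using card_corner[of s] card_corner[of "j - \<mu>"] card_corner[of j] by linarith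
  moreover obtain d where d: "j = d + \<mu>" using js by (metis le_add_diff_inverse2)
  moreover have "s * s = 2 * \<mu> * j" by (simp add: j_def s_def algebra_simps)
  ultimately have "2 * \<mu> * (d + \<mu>) + s + d * (d + 1) \<le> (d + \<mu>) * (d + \<mu> + 1)"
    by (simp add: algebra_simps)
  then have "\<mu> * \<mu> + s \<le> \<mu>" by (simp add: algebra_simps)
  moreover have "\<mu> \<le> \<mu> * \<mu>" using \<open>\<mu> > 0\<close> by simp
  ultimately show False using js by linarith
qed

subsection \<open>Existence of a principal reduction\<close>

text \<open>Substitution of c q for p: the cofactor of p - c q in p^m - (c q)^m has degree m - 1 in
  p, q, so after multiplication by q^i it lies in J^s. The factor in front of the power of
  \<open>q\<close> is the form evaluated at (c, 1).\<close>

lemma form_minus_pure_power: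
  fixes p q :: "'r::comm_ring_1"
  shows "\<exists>w\<in>ideal_power (gen_ideal {p, q}) s.
    form p q (Suc s) C = (p - c * q) * w + (\<Sum>i\<le>Suc s. C i * c ^ (Suc s - i)) * q ^ Suc s"
proof -
  let ?J = "gen_ideal {p, q}"
  have "\<exists>w\<in>ideal_power ?J s. C i * (p ^ (Suc s - i) * q ^ i) = (p - c * q) * w + C i * c ^ (Suc s - i) * q ^ Suc s"
    if i: "i \<le> Suc s" for i
  proof -
    define m where "m = Suc s - i"
    define w where "w = C i * (q ^ i * (\<Sum>a<m. (c * q) ^ (m - Suc a) * p ^ a))"
    have "q ^ i * ((c * q) ^ (m - Suc a) * p ^ a) \<in> ideal_power ?J s" if "a < m" for a
    proof -
      have "a + (m - Suc a + i) = s" using that i by (simp add: m_def)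
      then have "c ^ (m - Suc a) * (p ^ a * q ^ (m - Suc a + i)) \<in> ideal_power ?J s"
        using monomial_in_ideal_power[of p a q "m - Suc a + i"] by (auto intro: ideal_power_mult)
      then show ?thesis by (simp add: power_mult_distrib power_add algebra_simps)
    qed
    then have "w \<in> ideal_power ?J s"
      unfolding w_def sum_distrib_left[of "q ^ i"]
      by (intro ideal_power_mult[OF ideal_power_sum]) auto
    moreover have "(p - c * q) * w = C i * (p ^ m * q ^ i) - C i * c ^ m * q ^ Suc s"
    proof -
      have q: "q ^ Suc s = q ^ m * q ^ i" using i by (simp add: m_def flip: power_add)
      have "(p - c * q) * w = C i * (q ^ i * ((p - c * q) * (\<Sum>a<m. (c * q) ^ (m - Suc a) * p ^ a)))"
        by (simp only: w_def mult.left_commute)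
      also have "\<dots> = C i * (q ^ i * (p ^ m - (c * q) ^ m))"
        by (simp only: power_diff_sumr2)
      also have "\<dots> = C i * (p ^ m * q ^ i) - C i * c ^ m * q ^ Suc s"
        unfolding q power_mult_distrib by (simp add: algebra_simps)
      finally show ?thesis .
    qed
    ultimately show ?thesis by (intro bexI[of _ w]) (simp_all add: m_def)
  qed
  then obtain w where w: "\<And>i. i \<le> Suc s \<Longrightarrow> w i \<in> ideal_power ?J s"
    "\<And>i. i \<le> Suc s \<Longrightarrow> C i * (p ^ (Suc s - i) * q ^ i) = (p - c * q) * w i + C i * c ^ (Suc s - i) * q ^ Suc s"
    by metis
  have "form p q (Suc s) C = (\<Sum>i\<le>Suc s. (p - c * q) * w i + C i * c ^ (Suc s - i) * q ^ Suc s)"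
    unfolding form_def by (intro sum.cong refl w(2)) simp
  also have "\<dots> = (p - c * q) * (\<Sum>i\<le>Suc s. w i) + (\<Sum>i\<le>Suc s. C i * c ^ (Suc s - i)) * q ^ Suc s"
    by (simp only: sum.distrib sum_distrib_left sum_distrib_right)
  finally show ?thesis using w(1) by (intro bexI[of _ "\<Sum>i\<le>Suc s. w i"] ideal_power_sum) auto
qed

text \<open>The dehomogenized form is a nonzero polynomial over an infinite field.\<close>

lemma exists_nonroot:
  fixes a :: "nat \<Rightarrow> 'k::field_char_0"
  assumes "i \<le> s" "a i \<noteq> 0"
  shows "\<exists>c. (\<Sum>i\<le>s. a i * c ^ (s - i)) \<noteq> 0"
proof -
  define P where "P = (\<Sum>i\<le>s. monom (a i) (s - i))"
  have "coeff P (s - i) = (\<Sum>j\<le>s. if j = i then a i else 0)"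
    unfolding P_def coeff_sum using assms(1) by (intro sum.cong) auto
  then have "P \<noteq> 0" using assms by auto
  then have "finite {c. poly P c = 0}" by (rule poly_roots_finite)
  then have "{c. poly P c = 0} \<noteq> UNIV" using infinite_UNIV_char_0 by metis
  then show ?thesis by (auto simp: P_def poly_sum poly_monom)
qed

text \<open>Let a form with a unit coefficient vanish modulo \<open>f\<close>, and choose c with a
  unit value \<open>U\<close> at (c, 1). With l = p - c q the relation reads U q^s \<in> l J^r +
  (f), where s = r+1. Every form of degree s is a multiple of q^s modulo l J^r, so J^(r+1)
  \<subseteq> l J^r + (f), and this iterates. If J contains a unit, that unit serves as
  \<open>l\<close>.\<close>

lemma reduction_exists:
  fixes f p q :: "'k::field_char_0 fps fps"
  assumes f: "f \<noteq> 0" "f $ 0 $ 0 = 0" and N: "max_power N \<subseteq> gen_ideal {f, p, q}"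
  shows "\<exists>l\<in>gen_ideal {p, q}. \<exists>r. \<forall>t. ideal_power (gen_ideal {p, q}) (r + t) \<subseteq> gen_ideal {f, l ^ t}"
proof (cases "p \<in> max_power 1 \<and> q \<in> max_power 1")
  case False
  then have "p dvd 1 \<or> q dvd 1" using ser_unitI by (auto simp: max_power_1)
  then obtain l where l: "l \<in> {p, q}" "l dvd 1" by auto
  then obtain l' where l': "1 = l * l'" by (metis dvdE)
  have "u \<in> gen_ideal {f, l ^ t}" for u t
  proof -
    have "u = u * l' ^ t * l ^ t" using l' by (simp add: mult.assoc mult.commute flip: power_mult_distrib)
    then show ?thesis by (metis gen_ideal_mult gen_ideal_base insertCI)
  qed
  then show ?thesis using l by (intro bexI[of _ l]) (auto intro: gen_ideal_base)
next
  case True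
  let ?J = "gen_ideal {p, q}"
  obtain s C i where C: "form p q s C \<in> gen_ideal {f}" "i \<le> s" "C i $ 0 $ 0 \<noteq> 0"
    using homogeneous_relation[OF f _ _ N] True by blast
  \<comment> \<open>In degree 0 the relation would put a unit into (f).\<close>
  have "s \<noteq> 0"
  proof
    assume "s = 0"
    then obtain w where "C 0 = w * f" using C by (auto simp: form_def gen_ideal_1)
    then show False using C \<open>s = 0\<close> f by (simp add: nth00_mult)
  qed
  then obtain r where r: "s = Suc r" by (cases s) auto
  obtain c where c: "(\<Sum>i\<le>s. C i $ 0 $ 0 * c ^ (s - i)) \<noteq> 0"
    using exists_nonroot[of i s "\<lambda>i. C i $ 0 $ 0"] C by blast
  define l where "l = p - const_xy c * q"
  have lJ: "l \<in> ?J" unfolding l_def by (intro gen_ideal_diff gen_ideal_mult gen_ideal_base) auto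
  obtain w0 where w0: "w0 \<in> ideal_power ?J r"
    "form p q s C = l * w0 + (\<Sum>i\<le>s. C i * const_xy c ^ (s - i)) * q ^ s"
    using form_minus_pure_power[of p q r C "const_xy c"] by (auto simp: r l_def)
  define U where "U = (\<Sum>i\<le>s. C i * const_xy c ^ (s - i))"
  have "U $ 0 $ 0 \<noteq> 0"
    using c by (simp add: U_def fps_sum_nth nth00_mult nth00_power const_xy_nth)
  then obtain U' where U': "1 = U * U'" by (metis ser_unitI dvdE)
  obtain z0 where "form p q s C = z0 * f" using C by (auto simp: gen_ideal_1)
  then have "U * q ^ s = z0 * f - l * w0" using w0 by (simp add: U_def algebra_simps)
  then have "U' * (U * q ^ s) = U' * (z0 * f - l * w0)" by simp
  also have "\<dots> = U' * z0 * f - l * (U' * w0)" by (simp add: algebra_simps)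
  finally have "U' * (U * q ^ s) = U' * z0 * f - l * (U' * w0)" .
  moreover have "U' * (U * q ^ s) = q ^ s" using U' by (metis mult.assoc mult.commute mult_1)
  ultimately have qs: "q ^ s = U' * z0 * f - l * (U' * w0)" by simp
  have reduce: "\<exists>w'\<in>ideal_power ?J r. \<exists>z. w = l * w' + z * f" if w: "w \<in> ideal_power ?J (Suc r)" for w
  proof -
    obtain D where "w = form p q (Suc r) D" using w unfolding ideal_power_form by blast
    then have "w = form p q s D" by (simp only: r)
    moreover obtain w1 where w1: "w1 \<in> ideal_power ?J r"
      "form p q s D = l * w1 + (\<Sum>i\<le>s. D i * const_xy c ^ (s - i)) * q ^ s"
      using form_minus_pure_power[of p q r D "const_xy c"] by (auto simp: r l_def)
    moreover define V where "V = (\<Sum>i\<le>s. D i * const_xy c ^ (s - i))"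
    ultimately have "w = l * (w1 - V * U' * w0) + V * U' * z0 * f"
      by (simp add: qs algebra_simps)
    then show ?thesis using w1 w0 by (blast intro: ideal_power_diff ideal_power_mult)
  qed
  have "\<exists>w'\<in>ideal_power ?J r. \<exists>z. w = l ^ t * w' + z * f" if "w \<in> ideal_power ?J (r + t)" for w t
    using that
  proof (induction t arbitrary: w)
    case 0
    then show ?case by (intro bexI[of _ w] exI[of _ 0]) auto
  next
    case (Suc t)
    have "w \<in> gen_ideal {a * b | a b. a \<in> ?J \<and> b \<in> ideal_power ?J (r + t)}"
      using Suc.prems by simp
    then show ?case
    proof (induction rule: gen_ideal_induct)
      case zero
      show ?case by (intro bexI[of _ 0] exI[of _ 0] ideal_power_zero) simp
    next
      case (step d ab u)
      then obtain a b where ab: "ab = a * b" "a \<in> ?J" "b \<in> ideal_power ?J (r + t)" by auto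
      obtain b' z where b': "b' \<in> ideal_power ?J r" "b = l ^ t * b' + z * f"
        using Suc.IH[OF ab(3)] by blast
      obtain b'' z' where b'': "b'' \<in> ideal_power ?J r" "a * b' = l * b'' + z' * f"
        using reduce[OF ideal_power_times[OF ab(2) b'(1)]] by blast
      obtain u' z'' where u': "u' \<in> ideal_power ?J r" "u = l ^ Suc t * u' + z'' * f"
        using step by blast
      have "d * ab + u = d * (l ^ t * (a * b') + a * z * f) + u"
        by (simp add: ab b' algebra_simps)
      also have "\<dots> = l ^ Suc t * (d * b'' + u') + (d * (l ^ t * z' + a * z) + z'') * f"
        unfolding b''(2) u'(2) by (simp add: algebra_simps)
      finally show ?case using b'' u' by (blast intro: ideal_power_add ideal_power_mult)
    qed
  qed
  then have "ideal_power ?J (r + t) \<subseteq> gen_ideal {f, l ^ t}" for t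
    by (fastforce simp: gen_ideal_2 mult.commute add.commute)
  with lJ show ?thesis by blast
qed

section \<open>The multiplicity of the Jacobian ideal\<close>

text \<open>Lengths add along 0 -> R/(f, l) -> R/(f, a l) -> R/(f, a) -> 0, the first map being
  multiplication by \<open>a\<close>; its injectivity is cancellation of \<open>a\<close> modulo
  \<open>f\<close>. The basis is \<open>b\<close> followed by the multiples of \<open>b'\<close> by
  \<open>a\<close>.\<close>

lemma quot_dim_mult:
  fixes f a l :: "'k::field fps fps"
  assumes a: "quot_dim scale_xy (gen_ideal {f, a}) = enat m"
    and l: "quot_dim scale_xy (gen_ideal {f, l}) = enat n"
  shows "quot_dim scale_xy (gen_ideal {f, a * l}) = enat (m + n)"
proof -
  obtain b where b: "span_mod scale_xy (gen_ideal {f, a}) {..<m} b" "indep_mod scale_xy (gen_ideal {f, a}) {..<m} b"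
    using a by (rule xy.quot_dim_basisE)
  obtain b' where b': "span_mod scale_xy (gen_ideal {f, l}) {..<n} b'" "indep_mod scale_xy (gen_ideal {f, l}) {..<n} b'"
    using l by (rule xy.quot_dim_basisE)
  let ?v = "case_sum b (\<lambda>j. a * b' j)"
  let ?S = "\<lambda>c. \<Sum>i<m. scale_xy (c i) (b i)" and ?S' = "\<lambda>c. \<Sum>j<n. scale_xy (c j) (b' j)"
  have sum: "(\<Sum>i\<in>{..<m} <+> {..<n}. scale_xy (c i) (?v i)) = ?S (c \<circ> Inl) + a * ?S' (c \<circ> Inr)" for c
    by (simp add: sum.Plus scale_xy_def sum_distrib_left mult.left_commute)
  have "span_mod scale_xy (gen_ideal {f, a * l}) ({..<m} <+> {..<n}) ?v"
    unfolding span_mod_def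
  proof
    fix u
    obtain c r s where 1: "u - ?S c = r * f + s * a"
      using b(1) unfolding span_mod_def gen_ideal_2 by blast
    obtain d r' s' where 2: "s - ?S' d = r' * f + s' * l"
      using b'(1) unfolding span_mod_def gen_ideal_2 by blast
    have "u - (?S c + a * ?S' d) = r * f + a * (s - ?S' d)" using 1 by (simp add: algebra_simps)
    also have "\<dots> = (r + a * r') * f + s' * (a * l)" unfolding 2 by (simp add: algebra_simps)
    finally have "u - (?S c + a * ?S' d) \<in> gen_ideal {f, a * l}" unfolding gen_ideal_2 by blast
    then show "\<exists>c. u - (\<Sum>i\<in>{..<m} <+> {..<n}. scale_xy (c i) (?v i)) \<in> gen_ideal {f, a * l}"
      unfolding sum by (intro exI[of _ "case_sum c d"]) (simp add: o_def)
  qed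
  moreover have "indep_mod scale_xy (gen_ideal {f, a * l}) ({..<m} <+> {..<n}) ?v"
    unfolding indep_mod_def sum
  proof (intro allI impI)
    fix c assume "?S (c \<circ> Inl) + a * ?S' (c \<circ> Inr) \<in> gen_ideal {f, a * l}"
    then obtain r s where rs: "?S (c \<circ> Inl) + a * ?S' (c \<circ> Inr) = r * f + s * (a * l)"
      by (auto simp: gen_ideal_2)
    then have "?S (c \<circ> Inl) = r * f + (s * l - ?S' (c \<circ> Inr)) * a" by (simp add: algebra_simps)
    then have "?S (c \<circ> Inl) \<in> gen_ideal {f, a}" unfolding gen_ideal_2 by blast
    then have c1: "\<forall>i<m. c (Inl i) = 0" using b(2) by (auto simp: indep_mod_def)
    then have "?S (c \<circ> Inl) = 0" by simp
    with rs have "(?S' (c \<circ> Inr) - s * l) * a = f * r" by (simp add: algebra_simps)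
    then have "f dvd (?S' (c \<circ> Inr) - s * l) * a" by simp
    moreover have "quot_dim scale_xy (gen_ideal {a, f}) < \<infinity>" using a by (simp add: insert_commute)
    ultimately have "f dvd ?S' (c \<circ> Inr) - s * l" by (rule dvd_cancel_of_finite_colength[rotated])
    then obtain w where "?S' (c \<circ> Inr) - s * l = f * w" by (rule dvdE)
    then have "?S' (c \<circ> Inr) = w * f + s * l" by (simp add: algebra_simps)
    then have "?S' (c \<circ> Inr) \<in> gen_ideal {f, l}" unfolding gen_ideal_2 by blast
    then have "\<forall>i<n. c (Inr i) = 0" using b'(2) by (auto simp: indep_mod_def)
    with c1 show "\<forall>i\<in>{..<m} <+> {..<n}. c i = 0" by auto
  qed
  ultimately have "quot_dim scale_xy (gen_ideal {f, a * l}) = enat (card ({..<m} <+> {..<n}))"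
    by (intro xy.quot_dim_eqI subspace_xy_gen_ideal) auto
  then show ?thesis by (simp add: card_Plus)
qed

lemma quot_dim_UNIV: "quot_dim scale_xy UNIV = enat 0"
  using xy.quot_dim_eqI[of UNIV "{}"] by (simp add: indep_mod_def span_mod_def)

lemma gen_ideal_unit:
  assumes "u \<in> S" "u dvd 1"
  shows "gen_ideal S = UNIV"
proof -
  obtain u' where u: "1 = u * u'" using assms(2) by (rule dvdE)
  have "v \<in> gen_ideal S" for v
  proof -
    have "v * u' * u \<in> gen_ideal S" by (intro gen_ideal_mult gen_ideal_base assms)
    moreover have "v * u' * u = v * (u * u')" by (simp only: ac_simps)
    ultimately show ?thesis using u by simp
  qed
  then show ?thesis by auto
qed

lemma quot_dim_power:
  fixes f l :: "'k::field fps fps"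
  assumes l: "quot_dim scale_xy (gen_ideal {f, l}) = enat n"
  shows "quot_dim scale_xy (gen_ideal {f, l ^ t}) = enat (t * n)"
proof (induction t)
  case 0
  have "gen_ideal {f, 1} = UNIV" by (rule gen_ideal_unit[of 1]) auto
  then show ?case by (simp add: quot_dim_UNIV)
next
  case (Suc t)
  from quot_dim_mult[OF Suc l] show ?case by (simp add: mult.commute add.commute)
qed

lemma planar_icis_nonzero:
  fixes f :: "'k::field ser_xy"
  assumes "planar_icis f"
  shows "f \<noteq> 0"
proof
  assume "f = 0"
  have "deriv_x (0 :: 'k ser_xy) = 0" "deriv_y (0 :: 'k ser_xy) = 0"
    by (rule fps_ext, simp) (simp add: deriv_y_def)
  then have "quot_dim scale_xy (gen_ideal {0 :: 'k ser_xy}) < \<infinity>"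
    using assms \<open>f = 0\<close> by (simp add: planar_icis_def)
  then obtain N where "max_power N \<subseteq> gen_ideal {0 :: 'k ser_xy}"
    by (rule max_power_in_ideal_of_finite_colength)
  then have "(ser_y :: 'k ser_xy) ^ N \<in> gen_ideal {0}" using max_power_power[OF ser_y_in_max_power] by blast
  then show False by (simp add: gen_ideal_1)
qed

lemma power_in_ideal_power: "l \<in> I \<Longrightarrow> l ^ t \<in> ideal_power I t"
  by (induction t) (auto simp del: ideal_power.simps(2) intro: ideal_power_times)

text \<open>Slopes of linear bounds are compared; t = r m + 1 is already large enough to contradict
  m < n.\<close>

lemma nat_eq_limit_bound:
  fixes m n r :: nat
  assumes "\<And>t. t * n \<le> (r + t) * m"
  shows "n \<le> m"
proof (rule ccontr)
  assume "\<not> n \<le> m"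
  then have "(r * m + 1) * (m + 1) \<le> (r * m + 1) * n" by (intro mult_le_mono) auto
  also have "\<dots> \<le> (r + (r * m + 1)) * m" by (rule assms)
  finally show False by (simp add: algebra_simps)
qed

text \<open>If r is the exponent of the reduction \<open>l\<close>, then t n \<le> dim R/(f,
  J^(r+t)), while dim R/(f, J^s) \<le> s n' for every l' \<in> J of finite colength n'. Comparing
  slopes gives minimality of n, and the case n' = n squeezes the limit.\<close>

lemma jacobian_multiplicity_eq_min:
  fixes f :: "'k::field_char_0 ser_xy"
  assumes f: "planar_icis f"
  obtains l n where "l \<in> jacobian_ideal f" "quot_dim scale_xy (gen_ideal {f, l}) = enat n"
    "\<And>l'. l' \<in> jacobian_ideal f \<Longrightarrow> enat n \<le> quot_dim scale_xy (gen_ideal {f, l'})"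
    "normalized_jacobian_length f \<longlonglongrightarrow> ereal (real n)"
proof -
  let ?J = "jacobian_ideal f"
  have f0: "f $ 0 $ 0 = 0" and fin: "quot_dim scale_xy (gen_ideal {f, deriv_x f, deriv_y f}) < \<infinity>"
    using f by (auto simp: planar_icis_def)
  obtain N where N: "max_power N \<subseteq> gen_ideal {f, deriv_x f, deriv_y f}"
    using max_power_in_ideal_of_finite_colength[OF fin] .
  obtain l r where l: "l \<in> ?J" and red: "\<And>t. ideal_power ?J (r + t) \<subseteq> gen_ideal {f, l ^ t}"
    using reduction_exists[OF planar_icis_nonzero[OF f] f0 N] by (auto simp: jacobian_ideal_def)
  have K_sub: "gen_ideal (insert f (ideal_power ?J (r + t))) \<subseteq> gen_ideal {f, l ^ t}" for t
    using red by (intro gen_ideal_subsetI) (auto intro: gen_ideal_base)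
  have "max_power (N * (r + 1)) \<subseteq> gen_ideal (insert f (ideal_power ?J (r + 1)))"
    unfolding jacobian_ideal_def by (rule max_power_subset_ideal_power[OF N])
  also have "\<dots> \<subseteq> gen_ideal {f, l}" using K_sub[of 1] by simp
  finally have "quot_dim scale_xy (gen_ideal {f, l}) < \<infinity>" by (rule finite_colengthI)
  then obtain n where n: "quot_dim scale_xy (gen_ideal {f, l}) = enat n"
    by (cases "quot_dim scale_xy (gen_ideal {f, l})") auto
  have upper: "jacobian_length f s \<le> enat (s * n')"
    if "l' \<in> ?J" "quot_dim scale_xy (gen_ideal {f, l'}) = enat n'" for l' n' s
  proof -
    have "gen_ideal {f, l' ^ s} \<subseteq> gen_ideal (insert f (ideal_power ?J s))"
      using power_in_ideal_power[OF that(1)] by (intro gen_ideal_mono) auto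
    from xy.quot_dim_antimono[OF subspace_xy_gen_ideal subspace_xy_gen_ideal this]
    show ?thesis by (simp add: jacobian_length_def quot_dim_power[OF that(2)])
  qed
  have lower: "enat (t * n) \<le> jacobian_length f (r + t)" for t
    using xy.quot_dim_antimono[OF subspace_xy_gen_ideal subspace_xy_gen_ideal K_sub]
    by (simp add: jacobian_length_def quot_dim_power[OF n])
  have min: "enat n \<le> quot_dim scale_xy (gen_ideal {f, l'})" if "l' \<in> ?J" for l'
  proof (cases "quot_dim scale_xy (gen_ideal {f, l'})")
    case (enat n')
    have "t * n \<le> (r + t) * n'" for t
      using order_trans[OF lower[of t] upper[OF that enat, of "r + t"]] by simp
    then show ?thesis using nat_eq_limit_bound[of n r n'] enat by simp
  qed simp
  define N where "N s = the_enat (jacobian_length f s)" for s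
  have N: "jacobian_length f s = enat (N s)" "N s \<le> s * n" for s
    using upper[OF l n, of s] by (cases "jacobian_length f s"; simp add: N_def)+
  have N_ge: "real n - real r * real n / real s \<le> real (N s) / real s" if "s \<ge> Suc r" for s
  proof -
    have "(s - r) * n \<le> N s" using lower[of "s - r"] N that by simp
    then have "real (s - r) * real n \<le> real (N s)" by (metis of_nat_le_iff of_nat_mult)
    then have "(real s - real r) * real n \<le> real (N s)" using that by (simp add: of_nat_diff)
    then show ?thesis using that by (simp add: field_simps)
  qed
  have "(\<lambda>s. real r * real n / real s) \<longlonglongrightarrow> 0"
    using tendsto_divide_0[OF tendsto_const filterlim_at_top_imp_at_infinity[OF filterlim_real_sequentially]] .
  then have low: "(\<lambda>s. real n - real r * real n / real s) \<longlonglongrightarrow> real n"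
    by (auto intro: tendsto_eq_intros)
  have "(\<lambda>s. real (N s) / real s) \<longlonglongrightarrow> real n"
  proof (rule tendsto_sandwich[OF _ _ low tendsto_const])
    show "\<forall>\<^sub>F s in sequentially. real n - real r * real n / real s \<le> real (N s) / real s"
      using N_ge by (intro eventually_sequentiallyI[of "Suc r"])
    show "\<forall>\<^sub>F s in sequentially. real (N s) / real s \<le> real n"
    proof (rule eventually_mono[OF eventually_gt_at_top[of 0]])
      fix s :: nat assume "0 < s"
      then show "real (N s) / real s \<le> real n"
        using N(2)[of s] by (simp add: divide_le_eq mult.commute flip: of_nat_mult)
    qed
  qed
  then have "(\<lambda>s. ereal (real (N s) / real s)) \<longlonglongrightarrow> ereal (real n)" by simp
  moreover have "\<forall>\<^sub>F s in sequentially. ereal (real (N s) / real s) = normalized_jacobian_length f s"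
    by (rule eventually_mono[OF eventually_gt_at_top[of 0]]) (simp add: normalized_jacobian_length_def N)
  ultimately have "normalized_jacobian_length f \<longlonglongrightarrow> ereal (real n)"
    by (rule Lim_transform_eventually)
  with l n min show ?thesis by (rule that)
qed

section \<open>Evaluation at an element of the maximal ideal\<close>

text \<open>Substitution of \<open>z\<close> for the outer variable. For \<open>z\<close> in the
  maximal ideal z^j has no terms of degree below j, so the coefficient of x^a y^b involves only j
  \<le> a + b.\<close>

definition eval_at :: "'k::comm_ring_1 fps fps \<Rightarrow> 'k fps fps fps \<Rightarrow> 'k fps fps" where
  "eval_at z v = Abs_fps (\<lambda>b. Abs_fps (\<lambda>a. (\<Sum>j\<le>a + b. z ^ j * v $ j) $ b $ a))"

context
  fixes z :: "'k::comm_ring_1 fps fps"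
  assumes z: "z \<in> max_power 1"
begin

lemma eval_at_truncate: "eval_at z v - (\<Sum>j\<le>N. z ^ j * v $ j) \<in> max_power (Suc N)"
proof -
  have "(\<Sum>j\<le>a + b. z ^ j * v $ j) $ b $ a = (\<Sum>j\<le>N. z ^ j * v $ j) $ b $ a" if "a + b \<le> N" for a b
    unfolding fps_sum_nth
  proof (rule sum.mono_neutral_left)
    show "\<forall>i\<in>{..N} - {..a + b}. (z ^ i * v $ i) $ b $ a = 0"
    proof
      fix i assume "i \<in> {..N} - {..a + b}"
      then have "a + b < i" by simp
      moreover have "z ^ i * v $ i \<in> max_power i" by (intro max_power_mult_right max_power_power z)
      ultimately show "(z ^ i * v $ i) $ b $ a = 0" by (simp add: max_power_def)
    qed
  qed (use that in auto)
  then show ?thesis by (simp add: max_power_def eval_at_def)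
qed

lemma eval_at_rec: "eval_at z v = v $ 0 + z * eval_at z (fps_shift 1 v)"
proof -
  have "eval_at z v - (v $ 0 + z * eval_at z (fps_shift 1 v)) \<in> max_power N" for N
  proof -
    let ?S = "\<Sum>j\<le>N. z ^ j * v $ Suc j"
    have "(\<Sum>j\<le>Suc N. z ^ j * v $ j) = v $ 0 + z * ?S"
      unfolding sum.atMost_Suc_shift by (simp add: sum_distrib_left mult.assoc)
    then have "eval_at z v - (v $ 0 + z * eval_at z (fps_shift 1 v))
      = (eval_at z v - (\<Sum>j\<le>Suc N. z ^ j * v $ j)) - z * (eval_at z (fps_shift 1 v) - ?S)"
      by (simp add: algebra_simps)
    also have "\<dots> \<in> max_power (Suc N)"
    proof (rule max_power_diff[OF _ max_power_mult_left])
      show "eval_at z v - (\<Sum>j\<le>Suc N. z ^ j * v $ j) \<in> max_power (Suc N)"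
        using eval_at_truncate[of v "Suc N"] max_power_antimono[of "Suc N" "Suc (Suc N)"] by auto
      show "eval_at z (fps_shift 1 v) - ?S \<in> max_power (Suc N)"
        using eval_at_truncate[of "fps_shift 1 v" N] by simp
    qed
    finally show ?thesis using max_power_antimono[of N "Suc N"] by auto
  qed
  then have "eval_at z v - (v $ 0 + z * eval_at z (fps_shift 1 v)) = 0" by (rule max_power_Inter)
  then show ?thesis by simp
qed

text \<open>Division with remainder by t - z: the coefficients of the quotient are the values at
  \<open>z\<close> of the shifted tails of \<open>v\<close>.\<close>

lemma eval_at_division: "\<exists>q. v = fps_const (eval_at z v) + (fps_X - fps_const z) * q"
proof
  show "v = fps_const (eval_at z v) + (fps_X - fps_const z) * Abs_fps (\<lambda>a. eval_at z (fps_shift (Suc a) v))"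
  proof (rule fps_ext)
    fix n
    have "v $ n = eval_at z (fps_shift n v) - z * eval_at z (fps_shift (Suc n) v)"
    proof -
      have "fps_shift 1 (fps_shift n v) = fps_shift (Suc n) v" by (simp add: fps_eq_iff)
      then show ?thesis using eval_at_rec[of "fps_shift n v"] by simp
    qed
    then show "v $ n = (fps_const (eval_at z v) + (fps_X - fps_const z) * Abs_fps (\<lambda>a. eval_at z (fps_shift (Suc a) v))) $ n"
      by (cases n) (simp_all add: left_diff_distrib fps_X_mult_nth)
  qed
qed

text \<open>Comparing coefficients gives q_n = z q_(n+1), so q_0 is divisible by every power of
  \<open>z\<close> and vanishes, and r = - z q_0.\<close>

lemma const_multiple_eq_0:
  assumes "fps_const r = (fps_X - fps_const z) * q"
  shows "r = 0"
proof -
  have 0: "r = - z * q $ 0" and rec: "q $ n = z * q $ Suc n" for n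
    using arg_cong[OF assms, of "\<lambda>w. w $ 0"] arg_cong[OF assms, of "\<lambda>w. w $ Suc n"]
    by (simp_all add: left_diff_distrib fps_X_mult_nth)
  have "q $ 0 = z ^ n * q $ n" for n
  proof (induction n)
    case (Suc n)
    have "q $ 0 = z ^ n * (z * q $ Suc n)" using Suc.IH by (simp only: rec[of n, symmetric])
    then show ?case by (simp add: ac_simps)
  qed simp
  then have "q $ 0 \<in> max_power n" for n
    by (metis max_power_mult_right max_power_power z)
  then have "q $ 0 = 0" by (rule max_power_Inter)
  with 0 show ?thesis by simp
qed

text \<open>Uniqueness of the remainder. It makes evaluation a ring homomorphism without any
  rearrangement of double series.\<close>

lemma eval_at_eqI:
  assumes "v = fps_const r + (fps_X - fps_const z) * q"
  shows "eval_at z v = r"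
proof -
  obtain e q' where e: "v = fps_const e + (fps_X - fps_const z) * q'" "eval_at z v = e"
    using eval_at_division by blast
  have "fps_const (e - r) = fps_const e - fps_const r" by simp
  also have "\<dots> = (fps_X - fps_const z) * (q - q')"
    using assms e(1) by (simp add: algebra_simps del: fps_const_sub)
  finally show ?thesis using const_multiple_eq_0[of "e - r" "q - q'"] e(2) by simp
qed

lemma eval_at_const: "eval_at z (fps_const r) = r"
  by (rule eval_at_eqI[where q = 0]) simp

lemma eval_at_add: "eval_at z (v + w) = eval_at z v + eval_at z w"
proof -
  obtain e q where v: "v = fps_const e + (fps_X - fps_const z) * q" "eval_at z v = e"
    using eval_at_division by blast
  obtain e' q' where w: "w = fps_const e' + (fps_X - fps_const z) * q'" "eval_at z w = e'"
    using eval_at_division by blast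
  have "v + w = fps_const (e + e') + (fps_X - fps_const z) * (q + q')"
    unfolding v(1) w(1) by (simp add: distrib_left flip: fps_const_add)
  then show ?thesis unfolding v(2) w(2) by (rule eval_at_eqI)
qed

lemma eval_at_mult: "eval_at z (v * w) = eval_at z v * eval_at z w"
proof -
  obtain q q' where v: "v = fps_const (eval_at z v) + (fps_X - fps_const z) * q" and
    w: "w = fps_const (eval_at z w) + (fps_X - fps_const z) * q'"
    using eval_at_division by meson
  have "v * w = fps_const (eval_at z v) * w + (fps_X - fps_const z) * (q * w)"
    by (subst v) (simp only: distrib_right mult.assoc)
  also have "fps_const (eval_at z v) * w = fps_const (eval_at z v * eval_at z w) + (fps_X - fps_const z) * (fps_const (eval_at z v) * q')"
    by (subst w) (simp only: distrib_left fps_const_mult[symmetric] mult.left_commute)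
  finally have "v * w = fps_const (eval_at z v * eval_at z w)
      + (fps_X - fps_const z) * (fps_const (eval_at z v) * q' + q * w)"
    by (simp only: distrib_left add.assoc)
  then show ?thesis by (rule eval_at_eqI)
qed

lemma eval_at_0: "eval_at z 0 = 0"
  using eval_at_const[of 0] by simp

lemma eval_at_diff: "eval_at z (v - w) = eval_at z v - eval_at z w"
  using eval_at_add[of "v - w" w] by simp

text \<open>Evaluation obeys the same recursion as \<open>G\<close>, so their difference is
  divisible by every power of \<open>z\<close>. This identifies substitutions in embedded series,
  where shifting \<open>emb w\<close> amounts to applying \<open>\<sigma>\<close> to
  \<open>w\<close>.\<close>

lemma eval_at_by_recursion:
  assumes "\<And>w. fps_shift 1 (emb w) = emb (\<sigma> w)" "\<And>w. G w = emb w $ 0 + z * G (\<sigma> w)"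
  shows "eval_at z (emb w) = G w"
proof -
  define d where "d w = eval_at z (emb w) - G w" for w
  have d: "d w = z * d (\<sigma> w)" for w
    unfolding d_def using eval_at_rec[of "emb w"] assms[of w] by (simp add: algebra_simps)
  have "d w = z ^ n * d ((\<sigma> ^^ n) w)" for n w
  proof (induction n arbitrary: w)
    case (Suc n)
    have "d w = z * d (\<sigma> w)" by (rule d)
    also have "d (\<sigma> w) = z ^ n * d ((\<sigma> ^^ n) (\<sigma> w))" by (rule Suc.IH)
    finally show ?case by (simp only: funpow_Suc_right o_apply power_Suc mult.assoc)
  qed simp
  then have "d w \<in> max_power n" for n
    by (metis max_power_mult_right max_power_power z)
  then have "d w = 0" by (rule max_power_Inter)
  then show ?thesis by (simp add: d_def)
qed

end

section \<open>Coefficientwise maps\<close>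

lemma fps_map_nth [simp]: "fps_map h g $ n = h (g $ n)"
  by (simp add: fps_map_def)

lemma additive_sum:
  assumes "\<And>a b. h (a + b) = h a + h (b::'a::ab_group_add) " "h 0 = (0::'b::ab_group_add)"
  shows "h (\<Sum>i\<in>A. g i) = (\<Sum>i\<in>A. h (g i))"
  by (induction A rule: infinite_finite_induct) (auto simp: assms)

lemma fps_map_add:
  assumes "\<And>a b. h (a + b) = h a + h b"
  shows "fps_map h (f + g) = fps_map h f + fps_map h g"
  by (auto simp: fps_eq_iff assms)

lemma fps_map_mult:
  fixes h :: "'a::comm_ring_1 \<Rightarrow> 'b::comm_ring_1"
  assumes "\<And>a b. h (a + b) = h a + h b" "h 0 = 0" "\<And>a b. h (a * b) = h a * h b"
  shows "fps_map h (f * g) = fps_map h f * fps_map h g"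
  by (rule fps_ext) (simp add: fps_mult_nth additive_sum[of h] assms)

lemma fps_map_derivation:
  fixes h :: "'a::comm_ring_1 \<Rightarrow> 'a"
  assumes "\<And>a b. h (a + b) = h a + h b" "h 0 = 0" "\<And>a b. h (a * b) = h a * b + a * h b"
  shows "fps_map h (f * g) = fps_map h f * g + f * fps_map h g"
  by (rule fps_ext) (simp add: fps_mult_nth additive_sum[of h] assms sum.distrib)

lemma fps_map_const: "h 0 = 0 \<Longrightarrow> fps_map h (fps_const c) = fps_const (h c)"
  by (auto simp: fps_eq_iff)

lemma fps_map_X: "h 0 = 0 \<Longrightarrow> h 1 = 1 \<Longrightarrow> fps_map h fps_X = fps_X"
  by (auto simp: fps_eq_iff fps_X_def)

lemma fps_map_0: "h 0 = 0 \<Longrightarrow> fps_map h 0 = 0"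
  by (simp add: fps_eq_iff)

lemma fps_map_1: "h 0 = 0 \<Longrightarrow> h 1 = 1 \<Longrightarrow> fps_map h 1 = 1"
  by (auto simp: fps_eq_iff)

lemma fps_map_comp: "fps_map h (fps_map g f) = fps_map (\<lambda>x. h (g x)) f"
  by (auto simp: fps_eq_iff)

lemma deriv_0 [simp]: "deriv_x 0 = 0" "deriv_y 0 = 0"
  by (auto simp: fps_eq_iff deriv_y_def)

section \<open>Restriction to the diagonal\<close>

text \<open>In a series in x', y' over k[[x,y]] the inner evaluation puts x' = x in each
  coefficient, the outer one y' = y.\<close>

definition diag_xy :: "'k::comm_ring_1 ser_xy ser_xy \<Rightarrow> 'k ser_xy" where
  "diag_xy p = eval_at ser_y (fps_map (eval_at ser_x) p)"

lemmas eval_x = eval_at_add[OF ser_x_in_max_power] eval_at_mult[OF ser_x_in_max_power] eval_at_0[OF ser_x_in_max_power]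
lemmas eval_y = eval_at_add[OF ser_y_in_max_power] eval_at_mult[OF ser_y_in_max_power] eval_at_0[OF ser_y_in_max_power]

lemma diag_xy_add: "diag_xy (p + q) = diag_xy p + diag_xy q"
  by (simp add: diag_xy_def fps_map_add eval_x eval_y)

lemma diag_xy_mult: "diag_xy (p * q) = diag_xy p * diag_xy q"
  by (simp add: diag_xy_def fps_map_mult eval_x eval_y)

lemma diag_xy_0 [simp]: "diag_xy 0 = 0"
proof -
  have "fps_map (eval_at ser_x) 0 = (0 :: 'a ser_xy fps)" by (simp add: fps_eq_iff eval_x)
  then show ?thesis by (simp add: diag_xy_def eval_y)
qed

lemma diag_xy_const [simp]: "diag_xy (const_xy r) = r"
  by (simp add: diag_xy_def const_xy_def fps_map_const eval_x
      eval_at_const[OF ser_x_in_max_power] eval_at_const[OF ser_y_in_max_power])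

lemma diag_xy_diff: "diag_xy (p - q) = diag_xy p - diag_xy q"
  using diag_xy_add[of "p - q" q] by simp

lemma diag_xy_right:
  fixes s :: "'k::comm_ring_1 ser_xy"
  shows "diag_xy (fps_map (fps_map const_xy) s) = s"
proof -
  have 1: "eval_at ser_x (fps_map const_xy w) = fps_const w" for w :: "'k fps"
  proof (rule eval_at_by_recursion[OF ser_x_in_max_power, where \<sigma> = "fps_shift 1" and emb = "fps_map const_xy" and G = fps_const])
    fix w :: "'k fps"
    show "fps_shift 1 (fps_map const_xy w) = fps_map const_xy (fps_shift 1 w)"
      by (simp add: fps_eq_iff)
    have "w = fps_const (w $ 0) + fps_X * fps_shift 1 w"
      by (auto simp: fps_eq_iff fps_X_mult_nth)
    then have "fps_const w = fps_const (fps_const (w $ 0) + fps_X * fps_shift 1 w)" by simp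
    then show "fps_const w = fps_map const_xy w $ 0 + ser_x * fps_const (fps_shift 1 w)"
      by (simp add: const_xy_def)
  qed
  have 2: "eval_at ser_y (fps_map fps_const s) = s"
  proof (rule eval_at_by_recursion[OF ser_y_in_max_power, where \<sigma> = "fps_shift 1" and emb = "fps_map fps_const" and G = "\<lambda>s. s"])
    fix w :: "'k ser_xy"
    show "fps_shift 1 (fps_map fps_const w) = fps_map fps_const (fps_shift 1 w)"
      by (simp add: fps_eq_iff)
    show "w = fps_map fps_const w $ 0 + ser_y * fps_shift 1 w"
      by (auto simp: fps_eq_iff fps_X_mult_nth)
  qed
  show ?thesis unfolding diag_xy_def fps_map_comp 1 by (rule 2)
qed

text \<open>These are x' - x and y' - y: at this type \<open>ser_x\<close> is the new variable x',
  and the old x is a constant.\<close>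

abbreviation diff_x :: "'k::comm_ring_1 ser_xy ser_xy" where "diff_x \<equiv> ser_x - const_xy ser_x"
abbreviation diff_y :: "'k::comm_ring_1 ser_xy ser_xy" where "diff_y \<equiv> ser_y - const_xy ser_y"

lemma diag_xy_division: "\<exists>u v. p = const_xy (diag_xy p) + diff_x * u + diff_y * v"
proof -
  have "\<forall>j. \<exists>q. p $ j = fps_const (eval_at ser_x (p $ j)) + (fps_X - fps_const ser_x) * q"
    using eval_at_division[OF ser_x_in_max_power] by blast
  then obtain q where q: "\<And>j. p $ j = fps_const (eval_at ser_x (p $ j)) + (fps_X - fps_const ser_x) * q j"
    by metis
  define w where "w = fps_map (eval_at ser_x) p"
  obtain q' where q': "w = fps_const (eval_at ser_y w) + (fps_X - fps_const ser_y) * q'"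
    using eval_at_division[OF ser_y_in_max_power] by blast
  have "p = fps_map fps_const w + fps_const (fps_X - fps_const ser_x) * Abs_fps q"
  proof (rule fps_ext)
    fix n show "p $ n = (fps_map fps_const w + fps_const (fps_X - fps_const ser_x) * Abs_fps q) $ n"
      using q[of n] by (simp add: w_def)
  qed
  also have "fps_map fps_const w = fps_map fps_const (fps_const (eval_at ser_y w) + (fps_X - fps_const ser_y) * q')"
    using q' by simp
  also have "\<dots> = const_xy (eval_at ser_y w) + (fps_X - const_xy ser_y) * fps_map fps_const q'"
    by (rule fps_ext) (simp add: const_xy_def left_diff_distrib fps_X_mult_nth)
  also have "fps_const (fps_X - fps_const ser_x) = diff_x"
    by (simp add: const_xy_def flip: fps_const_sub)
  finally have "p = const_xy (diag_xy p) + diff_x * Abs_fps q + diff_y * fps_map fps_const q'"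
    by (simp add: w_def diag_xy_def ac_simps)
  then show ?thesis by blast
qed

lemma diag_xy_gens [simp]: "diag_xy (ser_x :: 'k::comm_ring_1 ser_xy ser_xy) = ser_x"
  "diag_xy (ser_y :: 'k::comm_ring_1 ser_xy ser_xy) = ser_y"
  using diag_xy_right[of "ser_x :: 'k ser_xy"] diag_xy_right[of "ser_y :: 'k ser_xy"]
  by (simp_all add: fps_map_const fps_map_X fps_map_0 fps_map_1)

text \<open>Dividing by x' - x, y' - y twice leaves a remainder of second order. The linear
  coefficients are recognized by differentiating in x' or y' and restricting to the
  diagonal.\<close>

lemma taylor_xy:
  "\<exists>a b c. p = const_xy (diag_xy p) + const_xy (diag_xy (deriv_x p)) * diff_x + const_xy (diag_xy (deriv_y p)) * diff_y
    + (diff_x * (diff_x * a) + diff_x * (diff_y * b) + diff_y * (diff_y * c))"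
proof -
  obtain u v where p: "p = const_xy (diag_xy p) + diff_x * u + diff_y * v" using diag_xy_division by blast
  obtain u1 u2 where u: "u = const_xy (diag_xy u) + diff_x * u1 + diff_y * u2" using diag_xy_division by blast
  obtain v1 v2 where v: "v = const_xy (diag_xy v) + diff_x * v1 + diff_y * v2" using diag_xy_division by blast
  have "deriv_x p = u + diff_x * deriv_x u + diff_y * deriv_x v"
    by (subst p) (simp add: deriv_x_add deriv_x_mult deriv_x_diff)
  then have 1: "diag_xy (deriv_x p) = diag_xy u" by (simp add: diag_xy_add diag_xy_mult diag_xy_diff)
  have "deriv_y p = diff_x * deriv_y u + v + diff_y * deriv_y v"
    by (subst p) (simp add: deriv_y_add deriv_y_mult deriv_y_diff)
  then have 2: "diag_xy (deriv_y p) = diag_xy v" by (simp add: diag_xy_add diag_xy_mult diag_xy_diff)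
  have "p = const_xy (diag_xy p) + diff_x * (const_xy (diag_xy u) + diff_x * u1 + diff_y * u2)
      + diff_y * (const_xy (diag_xy v) + diff_x * v1 + diff_y * v2)"
    using p u v by simp
  also have "\<dots> = const_xy (diag_xy p) + const_xy (diag_xy u) * diff_x + const_xy (diag_xy v) * diff_y
    + (diff_x * (diff_x * u1) + diff_x * (diff_y * (u2 + v1)) + diff_y * (diff_y * v2))"
    by (simp only: distrib_left) (simp only: ac_simps)
  finally show ?thesis unfolding 1 2 by blast
qed

section \<open>The dual of the principal parts\<close>

text \<open>Used at two types: on \<open>ser_xyt\<close> these differentiate in x and y, on
  \<open>ser_two\<close> in x' and y' with the left factor constant; t is constant in both
  cases.\<close>

definition pd_x :: "'k::comm_ring_1 ser_xyt \<Rightarrow> 'k ser_xyt" where "pd_x = fps_map deriv_x"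
definition pd_y :: "'k::comm_ring_1 ser_xyt \<Rightarrow> 'k ser_xyt" where "pd_y = fps_map deriv_y"

definition on_diag :: "'k::comm_ring_1 ser_two \<Rightarrow> 'k ser_xyt" where "on_diag = fps_map diag_xy"

definition d1_on_diag :: "'k::comm_ring_1 ser_two \<Rightarrow> 'k ser_xyt" where "d1_on_diag p = on_diag (pd_x p)"
definition d2_on_diag :: "'k::comm_ring_1 ser_two \<Rightarrow> 'k ser_xyt" where "d2_on_diag p = on_diag (pd_y p)"

text \<open>The derivation D applied in the right factor, then restricted to the diagonal. It sends
  \<open>right_incl F\<close> to F_x F_y - F_y F_x = 0, which is why it descends to principal
  parts.\<close>

definition hamiltonian :: "'k::comm_ring_1 ser_xyt \<Rightarrow> 'k ser_two \<Rightarrow> 'k ser_xyt" where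
  "hamiltonian F p = d1_on_diag p * pd_y F - d2_on_diag p * pd_x F"

lemma on_diag_add: "on_diag (p + q) = on_diag p + on_diag q"
  and on_diag_mult: "on_diag (p * q) = on_diag p * on_diag q"
  and on_diag_0 [simp]: "on_diag 0 = 0"
  by (simp_all add: on_diag_def fps_map_add fps_map_mult fps_map_0 diag_xy_add diag_xy_mult)

lemma on_diag_diff: "on_diag (p - q) = on_diag p - on_diag q"
  using on_diag_add[of "p - q" q] by simp

lemma pd_add: "pd_x (p + q) = pd_x p + pd_x q" "pd_y (p + q) = pd_y p + pd_y q"
  and pd_diff: "pd_x (p - q) = pd_x p - pd_x q" "pd_y (p - q) = pd_y p - pd_y q"
  by (simp_all add: pd_x_def pd_y_def fps_eq_iff deriv_x_add deriv_y_add deriv_x_diff deriv_y_diff)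

lemma pd_mult: "pd_x (p * q) = pd_x p * q + p * pd_x q" "pd_y (p * q) = pd_y p * q + p * pd_y q"
  unfolding pd_x_def pd_y_def
  by (rule fps_map_derivation; simp add: deriv_x_add deriv_y_add deriv_x_mult deriv_y_mult)+

lemma on_diag_left [simp]: "on_diag (left_incl s) = s"
  by (simp add: on_diag_def left_incl_def fps_eq_iff)

lemma on_diag_right [simp]: "on_diag (right_incl s) = s"
  by (simp add: on_diag_def right_incl_def fps_eq_iff diag_xy_right)

lemma pd_left [simp]: "pd_x (left_incl s) = 0" "pd_y (left_incl s) = 0"
  by (simp_all add: pd_x_def pd_y_def left_incl_def fps_eq_iff[of "fps_map _ _"])

lemma of_nat_const_xy: "of_nat n = const_xy (of_nat n :: 'k::comm_ring_1)"
  by (induction n) (simp_all add: const_xy_add)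

lemma pd_right: "pd_x (right_incl s) = right_incl (pd_x s)" "pd_y (right_incl s) = right_incl (pd_y s)"
proof -
  have nat: "fps_map const_xy (of_nat n * w) = of_nat n * fps_map const_xy w" for n and w :: "'a fps"
    by (induction n) (simp_all add: fps_map_0 distrib_right fps_map_add const_xy_add)
  have "fps_map (fps_map const_xy) (fps_deriv w) = fps_deriv (fps_map (fps_map const_xy) w)" for w :: "'a ser_xy"
    by (rule fps_ext) (simp only: fps_map_nth fps_deriv_nth nat)
  then show "pd_y (right_incl s) = right_incl (pd_y s)"
    by (simp add: pd_y_def right_incl_def deriv_y_def fps_map_comp)
  show "pd_x (right_incl s) = right_incl (pd_x s)"
    by (simp add: pd_x_def right_incl_def fps_eq_iff[of "fps_map _ _"] fps_eq_iff[of "deriv_x _"]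
        fps_eq_iff[of "fps_deriv _"] of_nat_const_xy const_xy_mult flip: of_nat_Suc)
qed

lemma d_on_diag_add: "d1_on_diag (p + q) = d1_on_diag p + d1_on_diag q"
    "d2_on_diag (p + q) = d2_on_diag p + d2_on_diag q"
  and d_on_diag_mult: "d1_on_diag (p * q) = d1_on_diag p * on_diag q + on_diag p * d1_on_diag q"
    "d2_on_diag (p * q) = d2_on_diag p * on_diag q + on_diag p * d2_on_diag q"
  and d_on_diag_left [simp]: "d1_on_diag (left_incl s) = 0" "d2_on_diag (left_incl s) = 0"
  and d_on_diag_right [simp]: "d1_on_diag (right_incl s) = pd_x s" "d2_on_diag (right_incl s) = pd_y s"
  by (simp_all add: d1_on_diag_def d2_on_diag_def pd_add pd_mult on_diag_add on_diag_mult pd_right)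

abbreviation gen_x :: "'k::comm_ring_1 ser_two" where "gen_x \<equiv> fps_const diff_x"
abbreviation gen_y :: "'k::comm_ring_1 ser_two" where "gen_y \<equiv> fps_const diff_y"

lemma gen_x_eq: "gen_x = right_incl (fps_const ser_x) - left_incl (fps_const ser_x)"
  and gen_y_eq: "gen_y = right_incl (fps_const ser_y) - left_incl (fps_const ser_y)"
  by (simp_all add: right_incl_def left_incl_def fps_map_const fps_map_X fps_map_0 fps_map_1)

lemma gens_in_diagonal_ideal: "gen_x \<in> diagonal_ideal" "gen_y \<in> diagonal_ideal"
  unfolding gen_x_eq gen_y_eq diagonal_ideal_def by (auto intro: gen_ideal_base)

lemma pd_const: "pd_x (fps_const c) = fps_const (deriv_x c)" "pd_y (fps_const c) = fps_const (deriv_y c)"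
  by (simp_all add: pd_x_def pd_y_def fps_map_const)

lemma deriv_1 [simp]: "deriv_x 1 = 0" "deriv_y 1 = 0"
  using deriv_const_xy[of 1] by simp_all

lemma pd_gens: "pd_x (fps_const ser_x) = 1" "pd_y (fps_const ser_x) = 0"
    "pd_x (fps_const ser_y) = 0" "pd_y (fps_const ser_y) = 1"
  by (simp_all add: pd_const)

lemma on_diag_gens [simp]: "on_diag gen_x = 0" "on_diag gen_y = 0"
  and d_on_diag_gens [simp]: "d1_on_diag gen_x = 1" "d2_on_diag gen_x = 0"
    "d1_on_diag gen_y = 0" "d2_on_diag gen_y = 1"
  unfolding gen_x_eq gen_y_eq d1_on_diag_def d2_on_diag_def
  by (simp_all only: pd_diff on_diag_diff on_diag_right on_diag_left pd_left pd_right pd_gens diff_self diff_0_right on_diag_0)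

lemma on_diag_1 [simp]: "on_diag (1 :: 'k::comm_ring_1 ser_two) = 1"
  and d_on_diag_1 [simp]: "d1_on_diag (1 :: 'k ser_two) = 0" "d2_on_diag (1 :: 'k ser_two) = 0"
proof -
  have 1: "left_incl (1 :: 'k ser_xyt) = 1" by (simp add: left_incl_def fps_map_1)
  show "on_diag (1 :: 'k ser_two) = 1" "d1_on_diag (1 :: 'k ser_two) = 0" "d2_on_diag (1 :: 'k ser_two) = 0"
    using on_diag_left[of "1 :: 'k ser_xyt"] d_on_diag_left[of "1 :: 'k ser_xyt"] unfolding 1 by simp_all
qed

text \<open>The expansion is applied to each coefficient in t. It shows that \<open>1\<close>,
  \<open>gen_x\<close> and \<open>gen_y\<close> generate the principal parts of order 2 over the
  left factor, so a functional is determined by three values.\<close>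

lemma taylor_two:
  "p - (left_incl (on_diag p) + left_incl (d1_on_diag p) * gen_x + left_incl (d2_on_diag p) * gen_y)
    \<in> ideal_power diagonal_ideal 2"
proof -
  have "\<forall>n. \<exists>a b c. p $ n = const_xy (diag_xy (p $ n)) + const_xy (diag_xy (deriv_x (p $ n))) * diff_x
      + const_xy (diag_xy (deriv_y (p $ n))) * diff_y
      + (diff_x * (diff_x * a) + diff_x * (diff_y * b) + diff_y * (diff_y * c))"
    using taylor_xy by blast
  then obtain a b c where abc: "\<And>n. p $ n = const_xy (diag_xy (p $ n)) + const_xy (diag_xy (deriv_x (p $ n))) * diff_x
      + const_xy (diag_xy (deriv_y (p $ n))) * diff_y
      + (diff_x * (diff_x * a n) + diff_x * (diff_y * b n) + diff_y * (diff_y * c n))"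
    by metis
  have "p = (left_incl (on_diag p) + left_incl (d1_on_diag p) * gen_x + left_incl (d2_on_diag p) * gen_y)
     + (gen_x * (gen_x * Abs_fps a) + gen_x * (gen_y * Abs_fps b) + gen_y * (gen_y * Abs_fps c))"
  proof (rule fps_ext)
    fix n
    show "p $ n = ((left_incl (on_diag p) + left_incl (d1_on_diag p) * gen_x + left_incl (d2_on_diag p) * gen_y)
     + (gen_x * (gen_x * Abs_fps a) + gen_x * (gen_y * Abs_fps b) + gen_y * (gen_y * Abs_fps c))) $ n"
      by (subst abc) (simp only: left_incl_def on_diag_def d1_on_diag_def d2_on_diag_def pd_x_def pd_y_def
        fps_add_nth fps_map_nth fps_mult_left_const_nth fps_mult_right_const_nth fps_nth_Abs_fps)
  qed
  then have "p - (left_incl (on_diag p) + left_incl (d1_on_diag p) * gen_x + left_incl (d2_on_diag p) * gen_y)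
     = gen_x * (gen_x * Abs_fps a) + gen_x * (gen_y * Abs_fps b) + gen_y * (gen_y * Abs_fps c)"
    by (simp only: diff_eq_eq add.commute)
  also have "\<dots> \<in> ideal_power diagonal_ideal 2"
  proof -
    have "g * (h * r) \<in> ideal_power diagonal_ideal 2"
      if "g \<in> diagonal_ideal" "h \<in> diagonal_ideal" for g h r :: "'a ser_two"
    proof -
      have "h * r \<in> ideal_power diagonal_ideal (Suc 0)"
        using that(2) by (auto intro!: gen_ideal_base)
      with that(1) have "g * (h * r) \<in> ideal_power diagonal_ideal (Suc (Suc 0))"
        unfolding ideal_power.simps(2)[of _ "Suc 0"] by (intro gen_ideal_base) blast
      then show ?thesis by (simp only: numeral_2_eq_2)
    qed
    moreover have "ideal_power diagonal_ideal 2 = gen_ideal {a * b |a b. a \<in> (diagonal_ideal :: 'a ser_two set) \<and> b \<in> ideal_power diagonal_ideal (Suc 0)}"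
      by (simp add: numeral_2_eq_2)
    ultimately show ?thesis using gens_in_diagonal_ideal by (metis (no_types, lifting) gen_ideal_add)
  qed
  finally show ?thesis .
qed

lemma on_diag_diagonal_ideal: "p \<in> diagonal_ideal \<Longrightarrow> on_diag p = 0"
  unfolding diagonal_ideal_def
  by (induction rule: gen_ideal_induct) (auto simp: on_diag_add on_diag_mult on_diag_diff)

lemma functionals_diagonal_ideal_power:
  assumes "p \<in> ideal_power diagonal_ideal 2"
  shows "on_diag p = 0 \<and> d1_on_diag p = 0 \<and> d2_on_diag p = 0"
proof -
  have 1: "on_diag b = 0" if "b \<in> ideal_power diagonal_ideal (Suc 0)" for b :: "'a ser_two"
    using that unfolding ideal_power.simps
    by (induction rule: gen_ideal_induct) (auto simp: on_diag_add on_diag_mult on_diag_diagonal_ideal)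
  have "p \<in> gen_ideal {a * b |a b. a \<in> diagonal_ideal \<and> b \<in> ideal_power diagonal_ideal (Suc 0)}"
    using assms by (simp add: numeral_2_eq_2)
  then show ?thesis
  proof (induction rule: gen_ideal_induct)
    case zero
    show ?case by (simp add: d1_on_diag_def d2_on_diag_def pd_x_def pd_y_def fps_map_0)
  next
    case (step c s y)
    then obtain a b where ab: "s = a * b" "a \<in> diagonal_ideal" "b \<in> ideal_power diagonal_ideal (Suc 0)" by blast
    show ?case
      using step.IH by (simp add: ab(1) on_diag_add on_diag_mult d_on_diag_add d_on_diag_mult
          1[OF ab(3)] on_diag_diagonal_ideal[OF ab(2)])
  qed
qed

lemma functionals_principal_parts_ideal:
  assumes "p \<in> principal_parts_ideal 2 F"
  shows "on_diag p \<in> gen_ideal {F} \<and> hamiltonian F p \<in> gen_ideal {F}"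
  using assms unfolding principal_parts_ideal_def
proof (induction rule: gen_ideal_induct)
  case zero
  show ?case by (simp add: hamiltonian_def d1_on_diag_def d2_on_diag_def pd_x_def pd_y_def fps_map_0 gen_ideal_zero)
next
  case (step c s y)
  have add: "hamiltonian F (c * s + y) = hamiltonian F (c * s) + hamiltonian F y"
    by (simp add: hamiltonian_def d_on_diag_add algebra_simps)
  consider "s = left_incl F" | "s = right_incl F" | "s \<in> ideal_power diagonal_ideal 2"
    using step by auto
  then have "on_diag (c * s) \<in> gen_ideal {F} \<and> hamiltonian F (c * s) \<in> gen_ideal {F}"
  proof cases
    case 1
    then have "hamiltonian F (c * s) = hamiltonian F c * F"
      by (simp add: hamiltonian_def d_on_diag_mult algebra_simps)
    then show ?thesis using 1 by (auto simp: on_diag_mult gen_ideal_1)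
  next
    case 2
    then have "hamiltonian F (c * s) = hamiltonian F c * F"
      by (simp add: hamiltonian_def d_on_diag_mult algebra_simps)
    then show ?thesis using 2 by (auto simp: on_diag_mult gen_ideal_1)
  next
    case 3
    from functionals_diagonal_ideal_power[OF this] show ?thesis
      by (simp add: hamiltonian_def on_diag_mult d_on_diag_mult gen_ideal_zero)
  qed
  then show ?case using step.IH unfolding add on_diag_add by (auto intro: gen_ideal_add)
qed

lemma functionals_in_dual:
  "on_diag \<in> dual_principal_parts 2 F" "hamiltonian F \<in> dual_principal_parts 2 F"
  using functionals_principal_parts_ideal[of _ F]
  by (auto simp: dual_principal_parts_def hom_mod_def on_diag_add on_diag_mult hamiltonian_def
      d_on_diag_add d_on_diag_mult algebra_simps gen_ideal_zero)

text \<open>The first claim applies \<phi> to the Taylor expansion, the second to the equation of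
  the right factor. Together they describe the dual as \<open>O_X\<close> plus the module of
  syzygies of (F_x, F_y) modulo \<open>F\<close>.\<close>

lemma dual_expansion:
  assumes "\<phi> \<in> dual_principal_parts 2 F"
  shows "\<phi> p - (on_diag p * \<phi> 1 + d1_on_diag p * \<phi> gen_x + d2_on_diag p * \<phi> gen_y) \<in> gen_ideal {F}"
    and "pd_x F * \<phi> gen_x + pd_y F * \<phi> gen_y \<in> gen_ideal {F}"
proof -
  let ?I = "gen_ideal {F}"
  have add: "\<phi> (u + v) - (\<phi> u + \<phi> v) \<in> ?I" and scale: "\<phi> (left_incl s * v) - s * \<phi> v \<in> ?I"
    and vanish: "v \<in> principal_parts_ideal 2 F \<Longrightarrow> \<phi> v \<in> ?I" for u v s
    using assms by (auto simp: dual_principal_parts_def hom_mod_def)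
  show exp: "\<phi> p - (on_diag p * \<phi> 1 + d1_on_diag p * \<phi> gen_x + d2_on_diag p * \<phi> gen_y) \<in> ?I" for p
  proof -
    let ?a = "left_incl (on_diag p) * 1" and ?b = "left_incl (d1_on_diag p) * gen_x"
      and ?c = "left_incl (d2_on_diag p) * gen_y"
    let ?r = "p - (?a + ?b + ?c)"
    have "?r \<in> principal_parts_ideal 2 F"
      unfolding principal_parts_ideal_def using taylor_two[of p] by (intro gen_ideal_base) simp
    note rest = vanish[OF this]
    have p: "?a + ?b + ?c + ?r = p" by simp
    have "\<phi> p - (on_diag p * \<phi> 1 + d1_on_diag p * \<phi> gen_x + d2_on_diag p * \<phi> gen_y)
       = (\<phi> (?a + ?b + ?c + ?r) - (\<phi> (?a + ?b + ?c) + \<phi> ?r)) + (\<phi> (?a + ?b + ?c) - (\<phi> (?a + ?b) + \<phi> ?c))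
        + (\<phi> (?a + ?b) - (\<phi> ?a + \<phi> ?b)) + (\<phi> ?a - on_diag p * \<phi> 1)
        + (\<phi> ?b - d1_on_diag p * \<phi> gen_x) + (\<phi> ?c - d2_on_diag p * \<phi> gen_y) + \<phi> ?r"
      unfolding p by (simp only: algebra_simps)
    also have "\<dots> \<in> ?I"
      by (intro gen_ideal_add add scale rest)
    finally show ?thesis .
  qed
  have "right_incl F \<in> principal_parts_ideal 2 F"
    unfolding principal_parts_ideal_def by (intro gen_ideal_base) simp
  from vanish[OF this] have "\<phi> (right_incl F) - F * \<phi> 1 \<in> ?I"
    by (rule gen_ideal_diff) (auto simp: gen_ideal_1 mult.commute)
  from gen_ideal_diff[OF this exp[of "right_incl F"]]
  show "pd_x F * \<phi> gen_x + pd_y F * \<phi> gen_y \<in> ?I" by (simp add: algebra_simps)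
qed

section \<open>Syzygies of two power series\<close>

lemma fps_zero_by_recursion:
  fixes d :: "'w \<Rightarrow> 'a::comm_ring_1 fps"
  assumes "\<And>w. P w \<Longrightarrow> P (\<sigma> w) \<and> d w = fps_X * d (\<sigma> w)" and "P w"
  shows "d w = 0"
proof (rule fps_ext)
  fix n
  have "d w $ n = 0" if "P w" for w
    using that
  proof (induction n arbitrary: w)
    case 0
    then have "d w = fps_X * d (\<sigma> w)" using assms(1) by blast
    then have "d w $ 0 = (fps_X * d (\<sigma> w)) $ 0" by (rule arg_cong)
    then show ?case by simp
  next
    case (Suc n)
    then have "d w = fps_X * d (\<sigma> w)" using assms(1) by blast
    then have "d w $ Suc n = (fps_X * d (\<sigma> w)) $ Suc n" by (rule arg_cong)
    also have "\<dots> = d (\<sigma> w) $ n" by simp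
    also have "\<dots> = 0" using Suc assms(1) by blast
    finally show ?case .
  qed
  then show "d w $ n = 0 $ n" using \<open>P w\<close> by simp
qed

text \<open>Successive approximation: \<open>s\<close> reads off one coefficient and
  \<open>\<sigma>\<close> passes to the remainder divided by the series variable. The collected
  series obeys the recursion that \<open>fps_zero_by_recursion\<close> uses to show that nothing is
  left over.\<close>

lemma fps_series_of_iterates:
  fixes s :: "'w \<Rightarrow> 'a::comm_ring_1"
  shows
  "Abs_fps (\<lambda>n. s ((\<sigma> ^^ n) w)) = fps_const (s w) + fps_X * Abs_fps (\<lambda>n. s ((\<sigma> ^^ n) (\<sigma> w)))"
  by (rule fps_ext) (auto simp: fps_X_mult_nth gr0_conv_Suc funpow_Suc_right simp del: funpow.simps)

text \<open>
  The syzygies are saturated with respect to \<open>y\<close> and any two are proportional, so a generator of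
  their reduction modulo \<open>y\<close> over the discrete valuation ring \<open>k[[x]]\<close> lifts to a generator.
\<close>
lemma syzygy_generator_aux:
  fixes p q m1 m2 :: "'k::field fps fps"
  assumes pq: "p \<noteq> 0 \<or> q \<noteq> 0" and m: "m1 * p + m2 * q = 0" "m1 $ 0 \<noteq> 0"
    and min: "\<And>c1 c2. c1 * p + c2 * q = 0 \<Longrightarrow> c1 $ 0 \<noteq> 0 \<Longrightarrow> subdegree (m1 $ 0) \<le> subdegree (c1 $ 0)"
    and c: "c1 * p + c2 * q = 0"
  shows "\<exists>\<gamma>. c1 = \<gamma> * m1 \<and> c2 = \<gamma> * m2"
proof -
  define M where "M = (\<lambda>(c1, c2). c1 * p + c2 * q = 0)"
  define s where "s = (\<lambda>(c1 :: 'k fps fps, c2 :: 'k fps fps). c1 $ 0 div m1 $ 0)"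
  define \<sigma> where "\<sigma> c = (fps_shift 1 (fst c - fps_const (s c) * m1), fps_shift 1 (snd c - fps_const (s c) * m2))" for c
  define \<gamma> where "\<gamma> c = Abs_fps (\<lambda>n. s ((\<sigma> ^^ n) c))" for c
  have \<gamma>: "\<gamma> c = fps_const (s c) + fps_X * \<gamma> (\<sigma> c)" for c
    unfolding \<gamma>_def by (rule fps_series_of_iterates)
  have step: "M (\<sigma> c) \<and> fst c = fps_const (s c) * m1 + fps_X * fst (\<sigma> c) \<and> snd c = fps_const (s c) * m2 + fps_X * snd (\<sigma> c)"
    if "M c" for c
  proof -
    obtain c1 c2 where c: "c = (c1, c2)" by (cases c)
    have cM: "c1 * p + c2 * q = 0" using that by (simp add: M_def c)
    \<comment> \<open>Two syzygies of a nonzero pair are proportional; hence divisibility is needed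
      for the first entry only.\<close>
    have "p * (c1 * m2 - c2 * m1) = m2 * (c1 * p + c2 * q) - c2 * (m1 * p + m2 * q)"
      and "q * (c1 * m2 - c2 * m1) = c1 * (m1 * p + m2 * q) - m1 * (c1 * p + c2 * q)"
      by (simp_all add: algebra_simps)
    then have "p * (c1 * m2 - c2 * m1) = 0" "q * (c1 * m2 - c2 * m1) = 0" by (simp_all add: cM m)
    with pq have cross: "c1 * m2 = c2 * m1" by auto
    have "m1 $ 0 dvd c1 $ 0"
      using min[OF cM] m(2) by (cases "c1 $ 0 = 0") (auto simp: fps_dvd_iff)
    then have s1: "c1 $ 0 = s c * m1 $ 0" by (simp add: s_def c)
    have "c2 $ 0 * m1 $ 0 = s c * m2 $ 0 * m1 $ 0"
    proof -
      have "c1 $ 0 * m2 $ 0 = c2 $ 0 * m1 $ 0"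
        using arg_cong[OF cross, of "\<lambda>u. u $ 0"] by simp
      then show ?thesis unfolding s1 by (simp only: ac_simps)
    qed
    then have s2: "c2 $ 0 = s c * m2 $ 0" using m(2) by simp
    have X: "u = fps_X * fps_shift 1 u" if "u $ 0 = 0" for u :: "'k fps fps"
      using that by (auto simp: fps_eq_iff fps_X_mult_nth)
    have e1: "c1 - fps_const (s c) * m1 = fps_X * fst (\<sigma> c)"
      using X[of "c1 - fps_const (s c) * m1"] s1 by (simp add: \<sigma>_def c)
    have e2: "c2 - fps_const (s c) * m2 = fps_X * snd (\<sigma> c)"
      using X[of "c2 - fps_const (s c) * m2"] s2 by (simp add: \<sigma>_def c)
    have "fps_X * (fst (\<sigma> c) * p + snd (\<sigma> c) * q) = (c1 - fps_const (s c) * m1) * p + (c2 - fps_const (s c) * m2) * q"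
      unfolding e1 e2 by (simp add: algebra_simps)
    also have "\<dots> = (c1 * p + c2 * q) - fps_const (s c) * (m1 * p + m2 * q)"
      by (simp add: algebra_simps)
    also have "\<dots> = 0" by (simp add: cM m)
    finally have "M (\<sigma> c)" by (simp add: M_def case_prod_unfold)
    with e1 e2 show ?thesis by (simp add: c algebra_simps)
  qed
  have "fst w - \<gamma> w * m1 = 0" if "M w" for w
  proof (rule fps_zero_by_recursion[where P = M and \<sigma> = \<sigma> and d = "\<lambda>w. fst w - \<gamma> w * m1", OF _ that])
    fix w assume w: "M w"
    have "fst w - \<gamma> w * m1 = (fps_const (s w) * m1 + fps_X * fst (\<sigma> w)) - (fps_const (s w) + fps_X * \<gamma> (\<sigma> w)) * m1"
      using step[OF w] \<gamma>[of w] by simp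
    also have "\<dots> = fps_X * (fst (\<sigma> w) - \<gamma> (\<sigma> w) * m1)" by (simp add: algebra_simps)
    finally show "M (\<sigma> w) \<and> fst w - \<gamma> w * m1 = fps_X * (fst (\<sigma> w) - \<gamma> (\<sigma> w) * m1)"
      using step[OF w] by blast
  qed
  moreover have "snd w - \<gamma> w * m2 = 0" if "M w" for w
  proof (rule fps_zero_by_recursion[where P = M and \<sigma> = \<sigma> and d = "\<lambda>w. snd w - \<gamma> w * m2", OF _ that])
    fix w assume w: "M w"
    have "snd w - \<gamma> w * m2 = (fps_const (s w) * m2 + fps_X * snd (\<sigma> w)) - (fps_const (s w) + fps_X * \<gamma> (\<sigma> w)) * m2"
      using step[OF w] \<gamma>[of w] by simp
    also have "\<dots> = fps_X * (snd (\<sigma> w) - \<gamma> (\<sigma> w) * m2)" by (simp add: algebra_simps)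
    finally show "M (\<sigma> w) \<and> snd w - \<gamma> w * m2 = fps_X * (snd (\<sigma> w) - \<gamma> (\<sigma> w) * m2)"
      using step[OF w] by blast
  qed
  moreover have "M (c1, c2)" using c by (simp add: M_def)
  ultimately show ?thesis by (intro exI[of _ "\<gamma> (c1, c2)"]) (metis eq_iff_diff_eq_0 fst_conv snd_conv)
qed

text \<open>Dividing the Koszul syzygy (q, -p) by the common power of y gives a syzygy that is
  nonzero modulo y. The least x-order found in either entry of such syzygies selects the generator,
  the two cases being symmetric.\<close>

lemma syzygy_generator:
  fixes p q :: "'k::field fps fps"
  assumes pq: "p \<noteq> 0 \<or> q \<noteq> 0"
  obtains m1 m2 where "m1 * p + m2 * q = 0"
    "\<And>c1 c2. c1 * p + c2 * q = 0 \<Longrightarrow> \<exists>\<gamma>. c1 = \<gamma> * m1 \<and> c2 = \<gamma> * m2"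
proof -
  define A where "A n \<longleftrightarrow> (\<exists>c1 c2. c1 * p + c2 * q = 0 \<and>
    (c1 $ 0 \<noteq> 0 \<and> subdegree (c1 $ 0) = n \<or> c2 $ 0 \<noteq> 0 \<and> subdegree (c2 $ 0) = n))" for n
  have "\<exists>n. A n"
  proof -
    have "\<exists>n. q $ n \<noteq> 0 \<or> p $ n \<noteq> 0" using pq by (auto simp: fps_eq_iff)
    then obtain n where n: "q $ n \<noteq> 0 \<or> p $ n \<noteq> 0" "\<forall>i<n. \<not> (q $ i \<noteq> 0 \<or> p $ i \<noteq> 0)"
      using exists_least_iff[of "\<lambda>n. q $ n \<noteq> 0 \<or> p $ n \<noteq> 0"] by blast
    have "q = fps_X ^ n * fps_shift n q" "p = fps_X ^ n * fps_shift n p"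
      using n(2) by (auto simp: fps_eq_iff fps_X_power_mult_nth)
    then have "fps_X ^ n * (fps_shift n q * p + (- fps_shift n p) * q) = 0"
      by (metis (no_types, lifting) add.right_inverse distrib_left mult.assoc mult.commute mult_minus_left)
    then have "fps_shift n q * p + (- fps_shift n p) * q = 0" by simp
    moreover have "fps_shift n q $ 0 \<noteq> 0 \<or> (- fps_shift n p) $ 0 \<noteq> 0" using n by simp
    ultimately show ?thesis unfolding A_def by blast
  qed
  then obtain n where n: "A n" "\<forall>i<n. \<not> A i" using exists_least_iff[of A] by blast
  have min: "n \<le> subdegree (c1 $ 0)" if "c1 * p + c2 * q = 0" "c1 $ 0 \<noteq> 0" for c1 c2
    using n(2) that unfolding A_def by (metis not_le)
  have min': "n \<le> subdegree (c2 $ 0)" if "c2 * q + c1 * p = 0" "c2 $ 0 \<noteq> 0" for c1 c2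
    using n(2) that unfolding A_def by (metis add.commute not_le)
  obtain m1 m2 where m: "m1 * p + m2 * q = 0"
    "m1 $ 0 \<noteq> 0 \<and> subdegree (m1 $ 0) = n \<or> m2 $ 0 \<noteq> 0 \<and> subdegree (m2 $ 0) = n"
    using n(1) unfolding A_def by blast
  from m(2) have "\<exists>\<gamma>. c1 = \<gamma> * m1 \<and> c2 = \<gamma> * m2" if c: "c1 * p + c2 * q = 0" for c1 c2
  proof
    assume "m1 $ 0 \<noteq> 0 \<and> subdegree (m1 $ 0) = n"
    then show ?thesis using syzygy_generator_aux[OF pq m(1) _ _ c] min by auto
  next
    assume m2: "m2 $ 0 \<noteq> 0 \<and> subdegree (m2 $ 0) = n"
    have "\<exists>\<gamma>. c2 = \<gamma> * m2 \<and> c1 = \<gamma> * m1"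
    proof (rule syzygy_generator_aux)
      show "q \<noteq> 0 \<or> p \<noteq> 0" using pq by blast
      show "m2 * q + m1 * p = 0" "c2 * q + c1 * p = 0" using m c by (simp_all add: add.commute)
    qed (use m2 min' in auto)
    then show ?thesis by blast
  qed
  then show ?thesis using that m(1) by blast
qed

text \<open>The Koszul syzygy is \<open>h\<close> times a generator. Then \<open>h\<close> divides
  both partial derivatives, so it is a unit by \<open>unit_of_partials_in_ideal\<close>, and the
  Koszul syzygy generates. If both partials vanished, the same lemma would make 0 a unit.\<close>

lemma partials_regular:
  fixes \<phi> :: "'k::field_char_0 ser_xy"
  assumes \<phi>: "planar_icis \<phi>"
  shows "deriv_x \<phi> \<noteq> 0 \<or> deriv_y \<phi> \<noteq> 0"
    and "c1 * deriv_x \<phi> + c2 * deriv_y \<phi> = 0 \<Longrightarrow> \<exists>\<gamma>. c1 = \<gamma> * deriv_y \<phi> \<and> c2 = - \<gamma> * deriv_x \<phi>"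
proof -
  have \<phi>0: "\<phi> $ 0 $ 0 = 0" and fin: "quot_dim scale_xy (gen_ideal {\<phi>, deriv_x \<phi>, deriv_y \<phi>}) < \<infinity>"
    using \<phi> by (auto simp: planar_icis_def)
  show nz: "deriv_x \<phi> \<noteq> 0 \<or> deriv_y \<phi> \<noteq> 0"
  proof (rule ccontr)
    assume "\<not> ?thesis"
    then have "(0 :: 'k ser_xy) dvd 1"
      by (intro unit_of_partials_in_ideal[OF \<phi>0 fin]) (auto intro: gen_ideal_zero)
    then show False by simp
  qed
  assume c: "c1 * deriv_x \<phi> + c2 * deriv_y \<phi> = 0"
  obtain m1 m2 where m: "m1 * deriv_x \<phi> + m2 * deriv_y \<phi> = 0"
    "\<And>c1 c2. c1 * deriv_x \<phi> + c2 * deriv_y \<phi> = 0 \<Longrightarrow> \<exists>\<gamma>. c1 = \<gamma> * m1 \<and> c2 = \<gamma> * m2"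
    using syzygy_generator[OF nz] by blast
  obtain h where h: "deriv_y \<phi> = h * m1" "- deriv_x \<phi> = h * m2"
    using m(2)[of "deriv_y \<phi>" "- deriv_x \<phi>"] by (auto simp: mult.commute)
  have "h dvd 1"
  proof (rule unit_of_partials_in_ideal[OF \<phi>0 fin])
    have "deriv_x \<phi> = (- m2) * h + 0 * \<phi>" "deriv_y \<phi> = m1 * h + 0 * \<phi>"
      using h by (simp_all add: minus_equation_iff[of "deriv_x \<phi>"] mult.commute)
    then show "deriv_x \<phi> \<in> gen_ideal {h, \<phi>}" "deriv_y \<phi> \<in> gen_ideal {h, \<phi>}"
      unfolding gen_ideal_2 by blast+
  qed
  then obtain h' where h': "h' * h = 1" by (metis dvdE mult.commute)
  obtain \<gamma> where \<gamma>: "c1 = \<gamma> * m1" "c2 = \<gamma> * m2" using m(2)[OF c] by blast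
  have "m1 = h' * deriv_y \<phi>" "m2 = - h' * deriv_x \<phi>"
    using h h' by (metis mult.assoc mult_1, metis mult.assoc mult_1 mult_minus_left mult_minus_right)
  then show "\<exists>\<gamma>. c1 = \<gamma> * deriv_y \<phi> \<and> c2 = - \<gamma> * deriv_x \<phi>"
    using \<gamma> by (intro exI[of _ "\<gamma> * h'"]) (simp add: mult.assoc)
qed

section \<open>Deformations whose dual of principal parts is free\<close>

text \<open>Over \<open>O_X\<close> the syzygies of (F_x, F_y) are free on (F_y, -F_x): the first
  clause is generation, the second the injectivity of \<gamma> \<mapsto> \<gamma> (F_y,
  -F_x).\<close>

definition hamiltonian_generates :: "'k::comm_ring_1 ser_xyt \<Rightarrow> bool" where
  "hamiltonian_generates F \<longleftrightarrow>
    (\<forall>c1 c2. pd_x F * c1 + pd_y F * c2 \<in> gen_ideal {F} \<longrightarrow>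
      (\<exists>\<gamma>. c1 - \<gamma> * pd_y F \<in> gen_ideal {F} \<and> c2 + \<gamma> * pd_x F \<in> gen_ideal {F})) \<and>
    (\<forall>c. c * pd_x F \<in> gen_ideal {F} \<longrightarrow> c * pd_y F \<in> gen_ideal {F} \<longrightarrow> c \<in> gen_ideal {F})"

definition standard_basis :: "'k::comm_ring_1 ser_xyt \<Rightarrow> nat \<Rightarrow> 'k ser_two \<Rightarrow> 'k ser_xyt" where
  "standard_basis F i = (if i = 0 then on_diag else hamiltonian F)"

lemma standard_basis_simps [simp]:
  "standard_basis F 0 = on_diag" "standard_basis F (Suc 0) = hamiltonian F"
  by (simp_all add: standard_basis_def)

lemma standard_dual_basis:
  assumes "hamiltonian_generates F"
  shows "dual_basis 2 F (standard_basis F)"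
  unfolding dual_basis_def basis_mod_def
proof (intro conjI ballI allI impI)
  fix i :: nat
  show "standard_basis F i \<in> dual_principal_parts 2 F"
    using functionals_in_dual[of F] by (simp add: standard_basis_def)
next
  fix \<phi> assume \<phi>: "\<phi> \<in> dual_principal_parts 2 F"
  obtain \<gamma> where \<gamma>: "\<phi> gen_x - \<gamma> * pd_y F \<in> gen_ideal {F}" "\<phi> gen_y + \<gamma> * pd_x F \<in> gen_ideal {F}"
    using dual_expansion(2)[OF \<phi>] assms unfolding hamiltonian_generates_def by blast
  have "\<phi> p - (\<phi> 1 * on_diag p + \<gamma> * hamiltonian F p) \<in> gen_ideal {F}" for p
  proof -
    have "\<phi> p - (\<phi> 1 * on_diag p + \<gamma> * hamiltonian F p)
      = (\<phi> p - (on_diag p * \<phi> 1 + d1_on_diag p * \<phi> gen_x + d2_on_diag p * \<phi> gen_y))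
        + (d1_on_diag p * (\<phi> gen_x - \<gamma> * pd_y F) + d2_on_diag p * (\<phi> gen_y + \<gamma> * pd_x F))"
      by (simp add: hamiltonian_def algebra_simps)
    also have "\<dots> \<in> gen_ideal {F}"
      by (intro gen_ideal_add gen_ideal_mult dual_expansion(1)[OF \<phi>] \<gamma>)
    finally show ?thesis .
  qed
  then show "\<exists>c. \<phi> - (\<Sum>i<2. (\<lambda>p. c i * standard_basis F i p)) \<in> {\<phi>. \<forall>p. \<phi> p \<in> gen_ideal {F}}"
    by (intro exI[of _ "\<lambda>i. if i = 0 then \<phi> 1 else \<gamma>"]) (simp add: numeral_2_eq_2 lessThan_Suc add.commute)
next
  fix c i assume "(\<Sum>i<2. (\<lambda>p. c i * standard_basis F i p)) \<in> {\<phi>. \<forall>p. \<phi> p \<in> gen_ideal {F}}" and i: "i < (2::nat)"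
  then have c: "c 0 * on_diag p + c 1 * hamiltonian F p \<in> gen_ideal {F}" for p
    by (simp add: numeral_2_eq_2 lessThan_Suc add.commute)
  have "c 0 \<in> gen_ideal {F}" using c[of 1] by (simp add: hamiltonian_def)
  moreover have "c 1 * pd_y F \<in> gen_ideal {F}" using c[of gen_x] by (simp add: hamiltonian_def)
  moreover have "c 1 * pd_x F \<in> gen_ideal {F}"
    using gen_ideal_neg[OF c[of gen_y]] by (simp add: hamiltonian_def)
  ultimately have "c 0 \<in> gen_ideal {F}" "c 1 \<in> gen_ideal {F}"
    using assms unfolding hamiltonian_generates_def by auto
  then show "c i \<in> gen_ideal {F}" using i by (auto simp: numeral_2_eq_2 less_Suc_eq)
qed

text \<open>If one partial derivative has an inverse u, one entry determines a syzygy: \<gamma> is -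
  u c2 when F_x is the unit and u c1 when F_y is.\<close>

lemma hamiltonian_generates_smooth:
  fixes F :: "'k::field ser_xyt"
  assumes "pd_x F dvd 1 \<or> pd_y F dvd 1"
  shows "hamiltonian_generates F"
  using assms
proof
  assume "pd_x F dvd 1"
  then obtain u where u: "1 = pd_x F * u" by (rule dvdE)
  have c: "c = u * (c * pd_x F)" for c
    using u by (metis mult.commute mult.left_commute mult_1_right)
  show ?thesis unfolding hamiltonian_generates_def
  proof (intro conjI allI impI)
    fix c1 c2 assume a: "pd_x F * c1 + pd_y F * c2 \<in> gen_ideal {F}"
    have "c1 - (- u * c2) * pd_y F = u * (pd_x F * c1 + pd_y F * c2)"
      by (subst c[of c1]) (simp add: algebra_simps)
    then have "c1 - (- u * c2) * pd_y F \<in> gen_ideal {F}" using a by (simp add: gen_ideal_mult)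
    moreover have "(- u * c2) * pd_x F = - c2" by (simp only: mult_minus_left mult.assoc c[symmetric])
    then have "c2 + (- u * c2) * pd_x F \<in> gen_ideal {F}" by (simp only: add.right_inverse gen_ideal_zero)
    ultimately show "\<exists>\<gamma>. c1 - \<gamma> * pd_y F \<in> gen_ideal {F} \<and> c2 + \<gamma> * pd_x F \<in> gen_ideal {F}" by blast
  next
    fix k assume "k * pd_x F \<in> gen_ideal {F}"
    then show "k \<in> gen_ideal {F}" using c[of k] gen_ideal_mult by metis
  qed
next
  assume "pd_y F dvd 1"
  then obtain u where u: "1 = pd_y F * u" by (rule dvdE)
  have c: "c = u * (c * pd_y F)" for c
    using u by (metis mult.commute mult.left_commute mult_1_right)
  show ?thesis unfolding hamiltonian_generates_def
  proof (intro conjI allI impI)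
    fix c1 c2 assume a: "pd_x F * c1 + pd_y F * c2 \<in> gen_ideal {F}"
    have "c2 + (u * c1) * pd_x F = u * (pd_x F * c1 + pd_y F * c2)"
      by (subst c[of c2]) (simp add: algebra_simps)
    then have "c2 + (u * c1) * pd_x F \<in> gen_ideal {F}" using a by (simp add: gen_ideal_mult)
    moreover have "(u * c1) * pd_y F = c1" by (simp only: mult.assoc c[symmetric])
    then have "c1 - (u * c1) * pd_y F \<in> gen_ideal {F}" by (simp only: diff_self gen_ideal_zero)
    ultimately show "\<exists>\<gamma>. c1 - \<gamma> * pd_y F \<in> gen_ideal {F} \<and> c2 + \<gamma> * pd_x F \<in> gen_ideal {F}" by blast
  next
    fix k assume "k * pd_y F \<in> gen_ideal {F}"
    then show "k \<in> gen_ideal {F}" using c[of k] gen_ideal_mult by metis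
  qed
qed

text \<open>
  If \<open>g\<close> is a unit, then \<open>t \<mapsto> - f/g\<close> identifies \<open>k[[x,y]][[t]]/(f + t g)\<close> with \<open>k[[x,y]]\<close> and takes
  the relative partial derivatives of the equation to those of \<open>\<phi> = f/g\<close>, up to the unit \<open>g\<close>.
\<close>
lemma hamiltonian_generates_smoothing:
  fixes f g :: "'k::field_char_0 ser_xy"
  assumes f: "planar_icis f" and g: "g dvd 1"
  shows "hamiltonian_generates (fps_const f + fps_X * fps_const g)"
proof -
  let ?F = "fps_const f + fps_X * fps_const g"
  have f0: "f $ 0 $ 0 = 0" and fin: "quot_dim scale_xy (gen_ideal {f, deriv_x f, deriv_y f}) < \<infinity>"
    using f by (auto simp: planar_icis_def)
  obtain g' where g': "1 = g * g'" using g by (rule dvdE)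
  define \<phi> where "\<phi> = g' * f"
  have f_eq: "f = g * \<phi>" using g' by (simp add: \<phi>_def flip: mult.assoc)
  have fx: "deriv_x f = deriv_x g * \<phi> + g * deriv_x \<phi>" and fy: "deriv_y f = deriv_y g * \<phi> + g * deriv_y \<phi>"
    by (simp_all add: f_eq deriv_x_mult deriv_y_mult)
  have \<phi>0: "\<phi> $ 0 $ 0 = 0" by (simp add: \<phi>_def nth00_mult f0)
  let ?K = "gen_ideal {\<phi>, deriv_x \<phi>, deriv_y \<phi>}"
  have "\<phi> \<in> ?K" "deriv_x \<phi> \<in> ?K" "deriv_y \<phi> \<in> ?K" by (auto intro: gen_ideal_base)
  then have "g * \<phi> \<in> ?K" "deriv_x f \<in> ?K" "deriv_y f \<in> ?K"
    unfolding fx fy by (auto intro: gen_ideal_add gen_ideal_mult)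
  then have "{f, deriv_x f, deriv_y f} \<subseteq> ?K" using f_eq by auto
  then have "quot_dim scale_xy (gen_ideal {\<phi>, deriv_x \<phi>, deriv_y \<phi>}) \<le> quot_dim scale_xy (gen_ideal {f, deriv_x f, deriv_y f})"
    by (intro xy.quot_dim_antimono subspace_xy_gen_ideal gen_ideal_subsetI)
  then have \<phi>: "planar_icis \<phi>"
    unfolding planar_icis_def using le_less_trans[OF _ fin] \<phi>0 by blast
  have z: "- \<phi> \<in> max_power 1" using \<phi>0 by (simp add: max_power_1)
  define ev where "ev = eval_at (- \<phi>)"
  note ev_simps = eval_at_add[OF z, folded ev_def] eval_at_mult[OF z, folded ev_def]
    eval_at_const[OF z, folded ev_def] eval_at_diff[OF z, folded ev_def]
  have ev_X: "ev fps_X = - \<phi>"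
    unfolding ev_def by (rule eval_at_eqI[OF z, where q = 1]) simp
  have F: "?F = fps_const g * (fps_X - fps_const (- \<phi>))"
    by (simp add: right_diff_distrib f_eq mult.commute flip: fps_const_mult)
  have ker: "u \<in> gen_ideal {?F} \<longleftrightarrow> ev u = 0" for u
  proof
    assume "u \<in> gen_ideal {?F}"
    then obtain r where "u = r * ?F" by (auto simp: gen_ideal_1)
    then show "ev u = 0" by (simp add: ev_simps ev_X f_eq mult.commute)
  next
    assume "ev u = 0"
    then obtain q where "u = (fps_X - fps_const (- \<phi>)) * q"
      using eval_at_division[OF z, of u] by (auto simp: ev_def)
    also have "\<dots> = (fps_const g' * q) * ?F"
    proof -
      have 1: "fps_const g * fps_const g' = 1" by (simp flip: g')
      have "(fps_const g' * q) * ?F = (fps_const g * fps_const g') * ((fps_X - fps_const (- \<phi>)) * q)"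
        unfolding F by (simp only: ac_simps)
      then show ?thesis by (simp only: 1 mult_1)
    qed
    finally show "u \<in> gen_ideal {?F}" by (auto simp: gen_ideal_1)
  qed
  have pd: "pd_x ?F = fps_const (deriv_x f) + fps_X * fps_const (deriv_x g)"
    "pd_y ?F = fps_const (deriv_y f) + fps_X * fps_const (deriv_y g)"
    by (rule fps_ext, simp add: pd_x_def pd_y_def deriv_x_add deriv_y_add fps_X_mult_nth)+
  \<comment> \<open>At t = -\<phi> the terms with derivatives of \<open>g\<close> cancel: f_x + t
    g_x = (g_x \<phi> + g \<phi>_x) - \<phi> g_x.\<close>
  have ev_pd: "ev (pd_x ?F) = g * deriv_x \<phi>" "ev (pd_y ?F) = g * deriv_y \<phi>"
    unfolding pd by (simp_all add: ev_simps ev_X fx fy mult.commute)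
  have g_cancel: "u = 0" if "g * u = 0" for u using that g' by auto
  show ?thesis unfolding hamiltonian_generates_def ker
  proof (intro conjI allI impI)
    fix c1 c2 assume "ev (pd_x ?F * c1 + pd_y ?F * c2) = 0"
    then have "g * (ev c1 * deriv_x \<phi> + ev c2 * deriv_y \<phi>) = 0"
      by (simp add: ev_simps ev_pd algebra_simps)
    then obtain \<gamma> where \<gamma>: "ev c1 = \<gamma> * deriv_y \<phi>" "ev c2 = - \<gamma> * deriv_x \<phi>"
      using partials_regular(2)[OF \<phi>] g_cancel by blast
    \<comment> \<open>The inverse \<open>g'\<close> absorbs the unit by which the evaluated partials
      differ from those of \<phi>.\<close>
    have "(\<gamma> * g') * (g * u) = \<gamma> * u" for u
    proof -
      have "(\<gamma> * g') * (g * u) = (g * g') * (\<gamma> * u)" by (simp only: ac_simps)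
      then show ?thesis by (simp flip: g')
    qed
    then have "ev (c1 - fps_const (\<gamma> * g') * pd_y ?F) = 0 \<and> ev (c2 + fps_const (\<gamma> * g') * pd_x ?F) = 0"
      by (simp add: ev_simps ev_pd \<gamma>)
    then show "\<exists>\<gamma>. ev (c1 - \<gamma> * pd_y ?F) = 0 \<and> ev (c2 + \<gamma> * pd_x ?F) = 0" by blast
  next
    fix c assume "ev (c * pd_x ?F) = 0" "ev (c * pd_y ?F) = 0"
    then have e: "g * (ev c * deriv_x \<phi>) = 0" "g * (ev c * deriv_y \<phi>) = 0"
      by (simp_all add: ev_simps ev_pd mult.left_commute)
    then show "ev c = 0"
      using partials_regular(1)[OF \<phi>] g_cancel[OF e(1)] g_cancel[OF e(2)] by auto
  qed
qed

section \<open>Flatness over the base of the deformation\<close>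

lemma fps_eq_X_times_shift: "u $ 0 = 0 \<Longrightarrow> u = fps_X * fps_shift 1 (u :: 'a::comm_ring_1 fps)"
  by (auto simp: fps_eq_iff fps_X_mult_nth)

text \<open>Combinations over k[[t]] of a basis of the special fibre, lifted as series constant in
  t.\<close>

definition lifted_comb :: "(nat \<Rightarrow> 'k::comm_ring_1 ser_xy) \<Rightarrow> nat \<Rightarrow> (nat \<Rightarrow> 'k fps) \<Rightarrow> 'k ser_xyt" where
  "lifted_comb b n C = (\<Sum>i<n. base_scale (C i) (fps_const (b i)))"

lemma base_scale_add_left: "base_scale (c + c') u = base_scale c u + base_scale c' u"
  and base_scale_mult: "base_scale (c * c') u = base_scale c (base_scale c' u)"
  and base_scale_const: "base_scale (fps_const a) u = fps_const (const_xy a) * u"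
  and base_scale_X: "base_scale fps_X u = fps_X * u"
  by (simp_all add: base_scale_def fps_map_add fps_map_mult const_xy_add const_xy_mult distrib_left distrib_right
      fps_map_const fps_map_X mult.assoc)

lemma base_scale_0 [simp]: "base_scale 0 u = 0" and base_scale_1 [simp]: "base_scale 1 u = u"
  using base_scale_const[of 0 u] base_scale_const[of 1 u] by simp_all

lemma lifted_comb_add: "lifted_comb b n (\<lambda>i. C i + D i) = lifted_comb b n C + lifted_comb b n D"
  by (simp add: lifted_comb_def base_scale_add_left sum.distrib)

lemma lifted_comb_scale: "lifted_comb b n (\<lambda>i. c * C i) = base_scale c (lifted_comb b n C)"
  unfolding lifted_comb_def base_scale_mult by (simp add: base_scale_def sum_distrib_left)

lemma lifted_comb_diff: "lifted_comb b n (\<lambda>i. C i - D i) = lifted_comb b n C - lifted_comb b n D"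
  using lifted_comb_add[of b n "\<lambda>i. C i - D i" D] by simp

lemma lifted_comb_unit:
  assumes "j < n"
  shows "lifted_comb b n (\<lambda>i. if i = j then 1 else 0) = fps_const (b j)"
proof -
  have "lifted_comb b n (\<lambda>i. if i = j then 1 else 0) = (\<Sum>i<n. if i = j then fps_const (b j) else 0)"
    unfolding lifted_comb_def by (intro sum.cong) auto
  then show ?thesis using assms by simp
qed

lemma lifted_comb_nth_0: "lifted_comb b n C $ 0 = (\<Sum>i<n. const_xy (C i $ 0) * b i)"
  by (simp add: lifted_comb_def base_scale_def fps_sum_nth)

text \<open>At t = 0 the relation becomes a syzygy of two coprime series, so it is \<gamma> times
  the Koszul one. Subtracting \<gamma> times the Koszul relation between \<open>F\<close> and
  \<Delta> makes both coefficients divisible by t.\<close>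

lemma X_torsion_free:
  fixes F \<Delta> :: "'k::field ser_xyt"
  assumes fin: "quot_dim scale_xy (gen_ideal {F $ 0, \<Delta> $ 0}) < \<infinity>" and nu: "\<not> F $ 0 dvd 1"
    and u: "fps_X * u \<in> gen_ideal {F, \<Delta>}"
  shows "u \<in> gen_ideal {F, \<Delta>}"
proof -
  obtain \<alpha> \<beta> where e: "fps_X * u = \<alpha> * F + \<beta> * \<Delta>" using u by (auto simp: gen_ideal_2)
  have "0 = (fps_X * u) $ 0" by simp
  also have "\<dots> = \<alpha> $ 0 * F $ 0 + \<beta> $ 0 * \<Delta> $ 0" unfolding e by simp
  finally have 0: "\<alpha> $ 0 * F $ 0 + \<beta> $ 0 * \<Delta> $ 0 = 0" by simp
  have \<Delta>0: "\<Delta> $ 0 \<noteq> 0"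
  proof
    assume "\<Delta> $ 0 = 0"
    then have "F $ 0 dvd 1"
      using fin dvd_cancel_of_finite_colength[of "\<Delta> $ 0" "F $ 0" 1] by (simp add: insert_commute)
    with nu show False by simp
  qed
  have "\<alpha> $ 0 * F $ 0 = \<Delta> $ 0 * (- \<beta> $ 0)" using 0 by (simp add: add_eq_0_iff mult.commute)
  then have "\<Delta> $ 0 dvd \<alpha> $ 0 * F $ 0" by simp
  with fin have "\<Delta> $ 0 dvd \<alpha> $ 0" by (rule dvd_cancel_of_finite_colength)
  then obtain \<gamma> where \<gamma>: "\<alpha> $ 0 = \<Delta> $ 0 * \<gamma>" by (rule dvdE)
  have "\<Delta> $ 0 * (\<gamma> * F $ 0 + \<beta> $ 0) = 0" using 0 by (simp add: \<gamma> algebra_simps)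
  then have \<beta>: "\<beta> $ 0 = - \<gamma> * F $ 0" using \<Delta>0 by (simp add: add_eq_0_iff)
  have a: "\<alpha> - fps_const \<gamma> * \<Delta> = fps_X * fps_shift 1 (\<alpha> - fps_const \<gamma> * \<Delta>)"
    by (rule fps_eq_X_times_shift) (simp add: \<gamma> mult.commute)
  have b: "\<beta> + fps_const \<gamma> * F = fps_X * fps_shift 1 (\<beta> + fps_const \<gamma> * F)"
    by (rule fps_eq_X_times_shift) (simp add: \<beta>)
  have "fps_X * u = (\<alpha> - fps_const \<gamma> * \<Delta>) * F + (\<beta> + fps_const \<gamma> * F) * \<Delta>"
    using e by (simp add: algebra_simps)
  also have "\<dots> = fps_X * (fps_shift 1 (\<alpha> - fps_const \<gamma> * \<Delta>) * F + fps_shift 1 (\<beta> + fps_const \<gamma> * F) * \<Delta>)"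
    by (subst a, subst b) (simp only: distrib_left mult.assoc)
  finally have "u = fps_shift 1 (\<alpha> - fps_const \<gamma> * \<Delta>) * F + fps_shift 1 (\<beta> + fps_const \<gamma> * F) * \<Delta>"
    by simp
  then show ?thesis unfolding gen_ideal_2 by blast
qed

text \<open>Independence in the special fibre kills all constant terms; torsion-freeness then
  permits division by t, and the argument repeats for the next coefficient.\<close>

lemma lifted_basis_independent:
  fixes F \<Delta> :: "'k::field ser_xyt"
  assumes fin: "quot_dim scale_xy (gen_ideal {F $ 0, \<Delta> $ 0}) < \<infinity>" and nu: "\<not> F $ 0 dvd 1"
    and b: "indep_mod scale_xy (gen_ideal {F $ 0, \<Delta> $ 0}) {..<n} b"
    and C: "lifted_comb b n C \<in> gen_ideal {F, \<Delta>}" and "i < n"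
  shows "C i = 0"
proof -
  have nth0: "\<forall>i<n. C i $ 0 = 0" if L: "lifted_comb b n C \<in> gen_ideal {F, \<Delta>}" for C
  proof -
    obtain r s where "lifted_comb b n C = r * F + s * \<Delta>" using L by (auto simp: gen_ideal_2)
    then have "lifted_comb b n C $ 0 = r $ 0 * F $ 0 + s $ 0 * \<Delta> $ 0" by simp
    then have "(\<Sum>i<n. scale_xy (C i $ 0) (b i)) \<in> gen_ideal {F $ 0, \<Delta> $ 0}"
      unfolding lifted_comb_nth_0 scale_xy_def gen_ideal_2 by blast
    then show ?thesis using b[unfolded indep_mod_def, rule_format, of "\<lambda>i. C i $ 0"] by auto
  qed
  have "\<forall>i<n. C i $ N = 0" if "lifted_comb b n C \<in> gen_ideal {F, \<Delta>}" for N C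
    using that
  proof (induction N arbitrary: C)
    case 0
    then show ?case by (rule nth0)
  next
    case (Suc N)
    have "lifted_comb b n C = lifted_comb b n (\<lambda>i. fps_X * fps_shift 1 (C i))"
      unfolding lifted_comb_def
      using nth0[OF Suc.prems] fps_eq_X_times_shift[of "C _"] by (intro sum.cong refl) (metis lessThan_iff)
    also have "\<dots> = fps_X * lifted_comb b n (\<lambda>i. fps_shift 1 (C i))"
      by (simp add: lifted_comb_scale base_scale_X)
    finally have "lifted_comb b n (\<lambda>i. fps_shift 1 (C i)) \<in> gen_ideal {F, \<Delta>}"
      using X_torsion_free[OF fin nu] Suc.prems by simp
    from Suc.IH[OF this] show ?case by simp
  qed
  with C \<open>i < n\<close> show ?thesis by (auto simp: fps_eq_iff)
qed

text \<open>Nakayama by successive approximation in t. The multipliers of \<open>F\<close> and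
  \<Delta> are collected as series \<open>A\<close> and \<open>B\<close> too, so the limit lies in
  the ideal with no appeal to its being closed.\<close>

lemma lifted_basis_spans:
  fixes F \<Delta> :: "'k::field ser_xyt"
  assumes b: "span_mod scale_xy (gen_ideal {F $ 0, \<Delta> $ 0}) {..<n} b"
  shows "\<exists>C. u - lifted_comb b n C \<in> gen_ideal {F, \<Delta>}"
proof -
  have "\<forall>w. \<exists>c r s. w - (\<Sum>i<n. const_xy (c i) * b i) = r * F $ 0 + s * \<Delta> $ 0"
    using b unfolding span_mod_def scale_xy_def gen_ideal_2 by blast
  then obtain c r s where crs: "\<And>w. w - (\<Sum>i<n. const_xy (c w i) * b i) = r w * F $ 0 + s w * \<Delta> $ 0"
    by metis
  define c0 where "c0 u = lifted_comb b n (\<lambda>i. fps_const (c (u $ 0) i)) + fps_const (r (u $ 0)) * F + fps_const (s (u $ 0)) * \<Delta>" for u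
  define \<sigma> where "\<sigma> u = fps_shift 1 (u - c0 u)" for u
  define C where "C u i = Abs_fps (\<lambda>m. c ((\<sigma> ^^ m) u $ 0) i)" for u i
  define A where "A u = Abs_fps (\<lambda>m. r ((\<sigma> ^^ m) u $ 0))" for u
  define B where "B u = Abs_fps (\<lambda>m. s ((\<sigma> ^^ m) u $ 0))" for u
  have C: "C u i = fps_const (c (u $ 0) i) + fps_X * C (\<sigma> u) i" for u i
    unfolding C_def by (rule fps_series_of_iterates)
  have A: "A u = fps_const (r (u $ 0)) + fps_X * A (\<sigma> u)" for u
    unfolding A_def by (rule fps_series_of_iterates)
  have B: "B u = fps_const (s (u $ 0)) + fps_X * B (\<sigma> u)" for u
    unfolding B_def by (rule fps_series_of_iterates)
  define d where "d u = u - (lifted_comb b n (C u) + A u * F + B u * \<Delta>)" for u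
  have "d u = 0"
  proof (rule fps_zero_by_recursion[where P = "\<lambda>_. True" and \<sigma> = \<sigma> and d = d])
    fix u
    have "(u - c0 u) $ 0 = 0"
      using crs[of "u $ 0"] by (simp add: c0_def lifted_comb_nth_0 algebra_simps)
    then have u: "u - c0 u = fps_X * \<sigma> u" unfolding \<sigma>_def by (rule fps_eq_X_times_shift)
    have "lifted_comb b n (C u) = lifted_comb b n (\<lambda>i. fps_const (c (u $ 0) i)) + fps_X * lifted_comb b n (C (\<sigma> u))"
    proof -
      have "C u = (\<lambda>i. fps_const (c (u $ 0) i) + fps_X * C (\<sigma> u) i)" using C by blast
      then show ?thesis by (simp only: lifted_comb_add lifted_comb_scale base_scale_X)
    qed
    then have "d u = (u - c0 u) - fps_X * (lifted_comb b n (C (\<sigma> u)) + A (\<sigma> u) * F + B (\<sigma> u) * \<Delta>)"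
      unfolding d_def c0_def A[of u] B[of u] by (simp add: algebra_simps)
    also have "\<dots> = fps_X * d (\<sigma> u)" unfolding u d_def by (simp add: algebra_simps)
    finally show "True \<and> d u = fps_X * d (\<sigma> u)" by blast
  qed simp
  then have "u - lifted_comb b n (C u) = A u * F + B u * \<Delta>" by (simp add: d_def algebra_simps)
  then show ?thesis unfolding gen_ideal_2 by blast
qed

section \<open>Base change to the geometric generic fibre\<close>

global_interpretation pm: vector_space "pm_scale :: 'c::field \<Rightarrow> ('m \<Rightarrow>\<^sub>0 'c) \<Rightarrow> _"
proof -
  have l: "Poly_Mapping.lookup (pm_scale c p) k = c * Poly_Mapping.lookup p k" for c :: 'c and p :: "'m \<Rightarrow>\<^sub>0 'c" and k
    by (simp add: pm_scale_def map.rep_eq when_def)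
  show "vector_space (pm_scale :: 'c \<Rightarrow> ('m \<Rightarrow>\<^sub>0 'c) \<Rightarrow> _)"
    by unfold_locales (auto intro!: poly_mapping_eqI simp: l lookup_add algebra_simps)
qed

lemma lookup_pm_scale [simp]: "Poly_Mapping.lookup (pm_scale c p) k = c * Poly_Mapping.lookup p k"
  by (simp add: pm_scale_def map.rep_eq when_def)

lemma pm_scale_single: "pm_scale c (Poly_Mapping.single m x) = Poly_Mapping.single m (c * x)"
  by (rule poly_mapping_eqI) (simp add: lookup_single when_def)

text \<open>The quotient is free over k[[t]] on the lifted basis, with coordinates \<open>C\<close>.
  The relations reduce every symbol to the symbols of basis elements, and the coordinates provide
  functionals that detect their independence.\<close>

lemma base_change_dim_flat:
  fixes F \<Delta> :: "'k::field ser_xyt" and \<beta> :: "'k fps \<Rightarrow> 'c::field"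
  assumes n: "quot_dim scale_xy (gen_ideal {F $ 0, \<Delta> $ 0}) = enat n" and nu: "\<not> F $ 0 dvd 1"
    and \<beta>: "\<And>a b. \<beta> (a + b) = \<beta> a + \<beta> b" "\<And>a b. \<beta> (a * b) = \<beta> a * \<beta> b" "\<beta> 0 = 0" "\<beta> 1 = 1"
  shows "base_change_dim base_scale \<beta> (gen_ideal {F, \<Delta>}) = enat n"
proof -
  let ?Q = "gen_ideal {F, \<Delta>}"
  let ?W = "pm.span (base_change_relations base_scale \<beta> ?Q)"
  have fin: "quot_dim scale_xy (gen_ideal {F $ 0, \<Delta> $ 0}) < \<infinity>" using n by simp
  obtain b where b: "span_mod scale_xy (gen_ideal {F $ 0, \<Delta> $ 0}) {..<n} b"
    "indep_mod scale_xy (gen_ideal {F $ 0, \<Delta> $ 0}) {..<n} b"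
    using n by (rule xy.quot_dim_basisE)
  have "\<exists>C. \<forall>u. u - lifted_comb b n (C u) \<in> ?Q" using lifted_basis_spans[OF b(1)] by metis
  then obtain C where C: "\<And>u. u - lifted_comb b n (C u) \<in> ?Q" by blast
  have uniq: "C u i = D i" if "u - lifted_comb b n D \<in> ?Q" "i < n" for u D i
  proof -
    have "lifted_comb b n (\<lambda>i. C u i - D i) = (u - lifted_comb b n D) - (u - lifted_comb b n (C u))"
      by (simp add: lifted_comb_diff)
    also have "\<dots> \<in> ?Q" by (intro gen_ideal_diff that C)
    finally have "C u i - D i = 0"
      using lifted_basis_independent[OF fin nu b(2)] \<open>i < n\<close> by blast
    then show ?thesis by simp
  qed
  have C_add: "C (u + v) i = C u i + C v i" if "i < n" for u v i
  proof (rule uniq[OF _ that])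
    have "u + v - lifted_comb b n (\<lambda>i. C u i + C v i) = (u - lifted_comb b n (C u)) + (v - lifted_comb b n (C v))"
      by (simp add: lifted_comb_add)
    also have "\<dots> \<in> ?Q" by (intro gen_ideal_add C)
    finally show "u + v - lifted_comb b n (\<lambda>i. C u i + C v i) \<in> ?Q" .
  qed
  have C_scale: "C (base_scale c u) i = c * C u i" if "i < n" for c u i
  proof (rule uniq[OF _ that])
    have "base_scale c u - lifted_comb b n (\<lambda>i. c * C u i) = fps_map const_xy c * (u - lifted_comb b n (C u))"
      by (simp add: lifted_comb_scale base_scale_def right_diff_distrib)
    also have "\<dots> \<in> ?Q" by (intro gen_ideal_mult C)
    finally show "base_scale c u - lifted_comb b n (\<lambda>i. c * C u i) \<in> ?Q" .
  qed
  have C_Q: "C u i = 0" if "u \<in> ?Q" "i < n" for u i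
    by (rule uniq[OF _ that(2)]) (use that(1) in \<open>simp add: lifted_comb_def\<close>)
  have C_b: "C (fps_const (b j)) i = (if i = j then 1 else 0)" if "i < n" "j < n" for i j
    by (rule uniq[OF _ that(1)]) (use that(2) in \<open>simp add: lifted_comb_unit gen_ideal_zero\<close>)
  let ?s = "\<lambda>m. Poly_Mapping.single m (1 :: 'c)"
  \<comment> \<open>The linear functional with m \<otimes> 1 \<mapsto> \<beta> of the i-th
    coordinate of m; it respects the relations because \<open>C\<close> is linear over k[[t]] and
    vanishes on the ideal.\<close>
  define \<Lambda> where "\<Lambda> i p = (\<Sum>m\<in>Poly_Mapping.keys p. Poly_Mapping.lookup p m * \<beta> (C m i))" for i p
  have \<Lambda>_add: "\<Lambda> i (p + q) = \<Lambda> i p + \<Lambda> i q" for i p q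
    unfolding \<Lambda>_def using setsum_keys_plus_distrib[of "\<lambda>m x. x * \<beta> (C m i)" p q]
    by (simp add: distrib_right)
  have \<Lambda>_super: "\<Lambda> i p = (\<Sum>m\<in>S. Poly_Mapping.lookup p m * \<beta> (C m i))" if "finite S" "Poly_Mapping.keys p \<subseteq> S" for i p S
    unfolding \<Lambda>_def using that by (intro sum.mono_neutral_left) (auto simp: in_keys_iff)
  have \<Lambda>_scale: "\<Lambda> i (pm_scale c p) = c * \<Lambda> i p" for i c p
  proof -
    have "Poly_Mapping.keys (pm_scale c p) \<subseteq> Poly_Mapping.keys p" by (auto simp: in_keys_iff)
    from \<Lambda>_super[OF finite_keys this] show ?thesis
      by (simp add: \<Lambda>_def sum_distrib_left mult.assoc)
  qed
  have \<Lambda>_single: "\<Lambda> i (Poly_Mapping.single m x) = x * \<beta> (C m i)" for i m x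
    using \<Lambda>_super[of "{m}" "Poly_Mapping.single m x" i] by simp
  have \<Lambda>_diff: "\<Lambda> i (p - q) = \<Lambda> i p - \<Lambda> i q" for i p q
    using \<Lambda>_add[of i "p - q" q] by simp
  have \<Lambda>_W: "\<Lambda> i p = 0" if "p \<in> ?W" "i < n" for i p
    using that(1)
  proof (induction rule: pm.span_induct_alt)
    case base
    show ?case by (simp add: \<Lambda>_def)
  next
    case (step c x y)
    have "\<Lambda> i x = 0" using step(1) \<open>i < n\<close>
      by (auto simp: base_change_relations_def \<Lambda>_diff \<Lambda>_single C_add C_scale C_Q \<beta>)
    then show ?case using step(2) by (simp add: \<Lambda>_add \<Lambda>_scale)
  qed
  have rel: "?s (u + v) - ?s u - ?s v \<in> ?W" "?s (base_scale c u) - Poly_Mapping.single u (\<beta> c) \<in> ?W"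
    "q \<in> ?Q \<Longrightarrow> ?s q \<in> ?W" for u v c q
    by (rule pm.span_base; force simp: base_change_relations_def)+
  have sum_rel: "?s (\<Sum>i<j. g i) - (\<Sum>i<j. ?s (g i)) \<in> ?W" for g :: "nat \<Rightarrow> 'k ser_xyt" and j :: nat
  proof (induction j)
    case 0
    show ?case using rel(3)[of 0] by (simp add: gen_ideal_zero)
  next
    case (Suc j)
    have "?s (\<Sum>i<Suc j. g i) - (\<Sum>i<Suc j. ?s (g i))
      = (?s ((\<Sum>i<j. g i) + g j) - ?s (\<Sum>i<j. g i) - ?s (g j)) + (?s (\<Sum>i<j. g i) - (\<Sum>i<j. ?s (g i)))"
      by (simp add: algebra_simps)
    also have "\<dots> \<in> ?W" by (intro pm.span_add rel(1) Suc)
    finally show ?case .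
  qed
  have single_rel: "?s m - (\<Sum>i<n. pm_scale (\<beta> (C m i)) (?s (fps_const (b i)))) \<in> ?W" for m
  proof -
    let ?L = "lifted_comb b n (C m)"
    let ?g = "\<lambda>i. base_scale (C m i) (fps_const (b i))"
    have 1: "?s (?L + (m - ?L)) - ?s ?L - ?s (m - ?L) \<in> ?W" by (rule rel(1))
    have 2: "?s (m - ?L) \<in> ?W" by (rule rel(3)[OF C])
    have 3: "?s ?L - (\<Sum>i<n. ?s (?g i)) \<in> ?W" unfolding lifted_comb_def by (rule sum_rel)
    have 4: "(\<Sum>i<n. ?s (?g i) - Poly_Mapping.single (fps_const (b i)) (\<beta> (C m i))) \<in> ?W"
      by (intro pm.span_sum rel(2))
    have "?s m - (\<Sum>i<n. pm_scale (\<beta> (C m i)) (?s (fps_const (b i))))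
      = (?s (?L + (m - ?L)) - ?s ?L - ?s (m - ?L)) + ?s (m - ?L) + (?s ?L - (\<Sum>i<n. ?s (?g i)))
        + (\<Sum>i<n. ?s (?g i) - Poly_Mapping.single (fps_const (b i)) (\<beta> (C m i)))"
      by (simp add: pm_scale_single sum_subtractf)
    also have "\<dots> \<in> ?W" by (intro pm.span_add 1 2 3 4)
    finally show ?thesis .
  qed
  have "span_mod pm_scale ?W {..<n} (\<lambda>i. ?s (fps_const (b i)))"
    unfolding span_mod_def
  proof
    fix p
    show "\<exists>c. p - (\<Sum>i<n. pm_scale (c i) (?s (fps_const (b i)))) \<in> ?W"
    proof (induction p rule: update_induct)
      case const
      show ?case by (intro exI[of _ "\<lambda>_. 0"]) (simp add: pm.span_zero)
    next
      case (update p m x)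
      then obtain c where c: "p - (\<Sum>i<n. pm_scale (c i) (?s (fps_const (b i)))) \<in> ?W" by blast
      have "Poly_Mapping.update m x p = p + pm_scale x (?s m)"
        using update(1) by (intro poly_mapping_eqI) (auto simp: lookup_update lookup_add lookup_single when_def in_keys_iff)
      then have "Poly_Mapping.update m x p - (\<Sum>i<n. pm_scale (c i + x * \<beta> (C m i)) (?s (fps_const (b i))))
        = (p - (\<Sum>i<n. pm_scale (c i) (?s (fps_const (b i)))))
          + pm_scale x (?s m - (\<Sum>i<n. pm_scale (\<beta> (C m i)) (?s (fps_const (b i)))))"
        by (simp add: pm.scale_left_distrib pm.scale_right_diff_distrib pm.scale_sum_right sum.distrib)
      also have "\<dots> \<in> ?W" by (intro pm.span_add pm.span_scale c single_rel)
      finally show ?case by (intro exI)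
    qed
  qed
  moreover have "indep_mod pm_scale ?W {..<n} (\<lambda>i. ?s (fps_const (b i)))"
    unfolding indep_mod_def
  proof (intro allI impI ballI)
    fix c j assume c: "(\<Sum>i<n. pm_scale (c i) (?s (fps_const (b i)))) \<in> ?W" and j: "j \<in> {..<n}"
    have "\<Lambda> j (\<Sum>i<n. pm_scale (c i) (?s (fps_const (b i)))) = (\<Sum>i<n. c i * \<beta> (C (fps_const (b i)) j))"
      by (subst additive_sum[of "\<Lambda> j"]) (simp_all add: \<Lambda>_add \<Lambda>_scale \<Lambda>_single, simp add: \<Lambda>_def)
    also have "\<dots> = (\<Sum>i<n. if i = j then c j else 0)"
      using j by (intro sum.cong) (auto simp: C_b \<beta>)
    also have "\<dots> = c j" using j by simp
    finally show "c j = 0" using \<Lambda>_W[OF c] j by simp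
  qed
  ultimately show ?thesis
    unfolding base_change_dim_def using pm.quot_dim_eqI[OF pm.subspace_span, of "{..<n}"] by simp
qed

section \<open>The special fibre\<close>

lemma gen_ideal_idem: "gen_ideal (gen_ideal S) = gen_ideal S"
  by (intro equalityI gen_ideal_subsetI) (auto intro: gen_ideal_base)

lemma special_fibre_ideal:
  "u \<in> gen_ideal (insert fps_X (gen_ideal {F, \<Delta>})) \<longleftrightarrow> u $ 0 \<in> gen_ideal {F $ 0, \<Delta> $ 0}"
  for F \<Delta> :: "'a::comm_ring_1 fps"
proof
  assume "u \<in> gen_ideal (insert fps_X (gen_ideal {F, \<Delta>}))"
  then obtain r a b where "u - r * fps_X = a * F + b * \<Delta>"
    by (auto simp: gen_ideal_insert[of fps_X] gen_ideal_idem gen_ideal_2)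
  then have "(u - r * fps_X) $ 0 = a $ 0 * F $ 0 + b $ 0 * \<Delta> $ 0" by simp
  then show "u $ 0 \<in> gen_ideal {F $ 0, \<Delta> $ 0}" by (auto simp: gen_ideal_2)
next
  assume "u $ 0 \<in> gen_ideal {F $ 0, \<Delta> $ 0}"
  then obtain a b where ab: "u $ 0 = a * F $ 0 + b * \<Delta> $ 0" by (auto simp: gen_ideal_2)
  define w where "w = u - (fps_const a * F + fps_const b * \<Delta>)"
  have "w = fps_X * fps_shift 1 w"
    by (rule fps_eq_X_times_shift) (simp add: w_def ab)
  then have "u - fps_shift 1 w * fps_X = fps_const a * F + fps_const b * \<Delta>"
    by (simp add: w_def algebra_simps)
  then show "u \<in> gen_ideal (insert fps_X (gen_ideal {F, \<Delta>}))"
    by (auto simp: gen_ideal_insert[of fps_X] gen_ideal_idem gen_ideal_2)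
qed

lemma quot_dim_nth_0:
  "quot_dim scale_xyt {u. u $ 0 \<in> W} = quot_dim scale_xy (W :: 'k::field ser_xy set)"
proof -
  have nth0: "(u - (\<Sum>i<n. scale_xyt (c i) (b i))) $ 0 = u $ 0 - (\<Sum>i<n. scale_xy (c i) (b i $ 0))"
    "(\<Sum>i<n. scale_xyt (c i) (b i)) $ 0 = (\<Sum>i<n. scale_xy (c i) (b i $ 0))" for u c n and b :: "nat \<Rightarrow> 'k ser_xyt"
    by (simp_all add: scale_xyt_def scale_xy_def fps_sum_nth)
  have iff: "basis_mod scale_xyt {0} UNIV {u. u $ 0 \<in> W} n b \<longleftrightarrow> basis_mod scale_xy {0} UNIV W n (\<lambda>i. b i $ 0)" for n b
  proof -
    have "(\<forall>u. \<exists>c. u $ 0 - (\<Sum>i<n. scale_xy (c i) (b i $ 0)) \<in> W) \<longleftrightarrow> (\<forall>w. \<exists>c. w - (\<Sum>i<n. scale_xy (c i) (b i $ 0)) \<in> W)"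
    proof (intro iffI allI)
      fix w assume "\<forall>u. \<exists>c. u $ 0 - (\<Sum>i<n. scale_xy (c i) (b i $ 0)) \<in> W"
      then have "\<exists>c. fps_const w $ 0 - (\<Sum>i<n. scale_xy (c i) (b i $ 0)) \<in> W" by blast
      then show "\<exists>c. w - (\<Sum>i<n. scale_xy (c i) (b i $ 0)) \<in> W" by simp
    qed blast
    then show ?thesis
      by (simp add: basis_mod_iff span_mod_def indep_mod_def nth0 del: fps_sub_nth)
  qed
  have "(\<exists>b. basis_mod scale_xyt {0} UNIV {u. u $ 0 \<in> W} n b) \<longleftrightarrow> (\<exists>b. basis_mod scale_xy {0} UNIV W n b)" for n
  proof
    assume "\<exists>b. basis_mod scale_xy {0} UNIV W n b"
    then obtain b where "basis_mod scale_xy {0} UNIV W n b" by blast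
    then have "basis_mod scale_xyt {0} UNIV {u. u $ 0 \<in> W} n (\<lambda>i. fps_const (b i))" by (simp add: iff)
    then show "\<exists>b. basis_mod scale_xyt {0} UNIV {u. u $ 0 \<in> W} n b" by blast
  qed (auto simp: iff)
  then show ?thesis by (simp add: quot_dim_def)
qed

section \<open>Wronskians of two principal parts\<close>

lemma det_2:
  assumes "A \<in> carrier_mat 2 2"
  shows "det (A :: 'a::comm_ring_1 mat) = A $$ (0, 0) * A $$ (1, 1) - A $$ (0, 1) * A $$ (1, 0)"
proof -
  have c: "mat_delete A 0 j \<in> carrier_mat 1 1" for j using assms by (auto simp: mat_delete_def)
  have "det A = A $$ (0, 0) * det (mat_delete A 0 0) - A $$ (0, 1) * det (mat_delete A 0 1)"
    using laplace_expansion_row[OF assms, of 0]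
    by (simp add: numeral_2_eq_2 lessThan_Suc add.commute cofactor_def)
  then show ?thesis
    unfolding det_single[OF c] using assms by (simp add: mat_delete_def)
qed

text \<open>The determinant for m = 2. For \<open>standard_basis\<close> the two rows are the values
  on the diagonal and those of D, as in a classical Wronskian.\<close>

definition wronskian :: "(nat \<Rightarrow> 'p \<Rightarrow> 'a) \<Rightarrow> 'p \<Rightarrow> 'p \<Rightarrow> 'a::comm_ring_1" where
  "wronskian e u v = e 0 u * e 1 v - e 0 v * e 1 u"

lemma inflection_ideal_2: "inflection_ideal 2 F e \<tau> = gen_ideal {F, wronskian e (\<tau> 0) (\<tau> 1)}"
  by (simp add: inflection_ideal_def det_2 wronskian_def)

lemma special_fibre_length_2:
  "special_fibre_length 2 F e \<tau> = quot_dim scale_xy (gen_ideal {F $ 0, wronskian e (\<tau> 0) (\<tau> 1) $ 0})"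
proof -
  let ?\<Delta> = "wronskian e (\<tau> 0) (\<tau> 1)"
  have "gen_ideal (insert fps_X (gen_ideal {F, ?\<Delta>})) = {u. u $ 0 \<in> gen_ideal {F $ 0, ?\<Delta> $ 0}}"
    using special_fibre_ideal by blast
  then show ?thesis
    by (simp only: special_fibre_length_def inflection_ideal_2 quot_dim_nth_0)
qed

text \<open>
  The partial derivatives of the equation are values of the Wronskian of the standard functionals,
  hence multiples of the determinant \<open>h\<close> relating these to another basis; so \<open>h\<close> is a unit.
\<close>
lemma wronskian_of_dual_basis:
  fixes f :: "'k::field_char_0 ser_xy"
  assumes f: "planar_icis f" and F0: "F $ 0 = f" and e: "dual_basis 2 F e"
  shows "\<exists>l\<in>jacobian_ideal f. gen_ideal {f, wronskian e u v $ 0} = gen_ideal {f, l}"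
proof -
  let ?I = "gen_ideal {F}"
  have "\<exists>(c :: nat \<Rightarrow> 'k ser_xyt) r. \<forall>p. \<phi> p = c 0 * e 0 p + c 1 * e 1 p + r p * F"
    if \<phi>: "\<phi> \<in> dual_principal_parts 2 F" for \<phi> :: "'k ser_two \<Rightarrow> 'k ser_xyt"
  proof -
    obtain c where "\<phi> - (\<Sum>i<2. (\<lambda>p. c i * e i p)) \<in> {\<phi>. \<forall>p. \<phi> p \<in> ?I}"
      using bspec[OF e[unfolded dual_basis_def basis_mod_def, THEN conjunct2, THEN conjunct1] \<phi>] by blast
    then have "\<forall>p. \<phi> p - (c 0 * e 0 p + c 1 * e 1 p) \<in> ?I"
      by (simp add: numeral_2_eq_2 lessThan_Suc add.commute)
    then have "\<forall>p. \<exists>r. \<phi> p = c 0 * e 0 p + c 1 * e 1 p + r * F"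
      by (metis add_diff_cancel_left' diff_add_cancel add.commute gen_ideal_1)
    from choice[OF this] show ?thesis by blast
  qed
  note expand = this
  obtain a :: "nat \<Rightarrow> 'k ser_xyt" and r where a: "\<And>p. on_diag p = a 0 * e 0 p + a 1 * e 1 p + r p * F"
    using expand[OF functionals_in_dual(1)] by blast
  obtain a' :: "nat \<Rightarrow> 'k ser_xyt" and r' where a': "\<And>p. hamiltonian F p = a' 0 * e 0 p + a' 1 * e 1 p + r' p * F"
    using expand[OF functionals_in_dual(2)] by blast
  define h where "h = a 0 * a' 1 - a 1 * a' 0"
  have wr: "\<exists>w. wronskian (standard_basis F) u v = h * wronskian e u v + w * F" for u v
  proof
    show "wronskian (standard_basis F) u v = h * wronskian e u v
      + ((a 0 * e 0 u + a 1 * e 1 u) * r' v + r u * hamiltonian F v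
        - (a 0 * e 0 v + a 1 * e 1 v) * r' u - r v * hamiltonian F u) * F"
      unfolding wronskian_def h_def by (simp add: a a' algebra_simps)
  qed
  have pd0: "pd_x F $ 0 = deriv_x f" "pd_y F $ 0 = deriv_y f" by (simp_all add: pd_x_def pd_y_def F0)
  \<comment> \<open>The order of the arguments in the second value absorbs the sign of D(y' - y) = -
    F_x.\<close>
  have pd: "wronskian (standard_basis F) 1 gen_x = pd_y F" "wronskian (standard_basis F) gen_y 1 = pd_x F"
    by (simp_all add: wronskian_def hamiltonian_def)
  obtain w where "pd_y F = h * wronskian e 1 gen_x + w * F"
    using wr[of 1 gen_x] unfolding pd by blast
  moreover obtain w' where "pd_x F = h * wronskian e gen_y 1 + w' * F"
    using wr[of gen_y 1] unfolding pd by blast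
  ultimately have "deriv_y f = (wronskian e 1 gen_x $ 0) * h $ 0 + w $ 0 * f" "deriv_x f = (wronskian e gen_y 1 $ 0) * h $ 0 + w' $ 0 * f"
    by (simp_all add: F0 mult.commute flip: pd0)
  then have "deriv_x f \<in> gen_ideal {h $ 0, f}" "deriv_y f \<in> gen_ideal {h $ 0, f}"
    unfolding gen_ideal_2 by blast+
  then have "h $ 0 dvd 1"
    using f by (intro unit_of_partials_in_ideal) (auto simp: planar_icis_def)
  then obtain h' where h': "1 = h $ 0 * h'" by (rule dvdE)
  define l where "l = wronskian (standard_basis F) u v $ 0"
  obtain w0 where "wronskian (standard_basis F) u v = h * wronskian e u v + w0 * F"
    using wr[of u v] by blast
  then have "l = h $ 0 * wronskian e u v $ 0 + w0 $ 0 * f" by (simp add: l_def F0)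
  then obtain w where w: "l = h $ 0 * wronskian e u v $ 0 + w * f" by blast
  have "l = (on_diag u $ 0 * d1_on_diag v $ 0 - on_diag v $ 0 * d1_on_diag u $ 0) * deriv_y f
    + (on_diag v $ 0 * d2_on_diag u $ 0 - on_diag u $ 0 * d2_on_diag v $ 0) * deriv_x f"
    by (simp add: l_def wronskian_def hamiltonian_def pd0 algebra_simps)
  then have "l \<in> jacobian_ideal f"
    unfolding jacobian_ideal_def by (simp add: gen_ideal_add gen_ideal_mult gen_ideal_base)
  moreover have "gen_ideal {f, wronskian e u v $ 0} = gen_ideal {f, l}"
  proof (rule equalityI; rule gen_ideal_subsetI; clarsimp; intro conjI)
    have "h' * l = (h $ 0 * h') * wronskian e u v $ 0 + (h' * w) * f" unfolding w by (simp add: algebra_simps)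
    then have "wronskian e u v $ 0 = (- (h' * w)) * f + h' * l" by (simp flip: h')
    then show "wronskian e u v $ 0 \<in> gen_ideal {f, l}" unfolding gen_ideal_2 by blast
    have "l = w * f + h $ 0 * wronskian e u v $ 0" by (simp add: w)
    then show "l \<in> gen_ideal {f, wronskian e u v $ 0}" unfolding gen_ideal_2 by blast
  qed (auto intro: gen_ideal_base)
  ultimately show ?thesis by blast
qed

text \<open>Since D kills 1, the Wronskian of 1 and v is D v, and v = \<beta> (x' - x) - \<alpha>
  (y' - y) gives \<alpha> F_x + \<beta> F_y.\<close>

lemma wronskian_attains:
  assumes F0: "F $ 0 = f" and l: "l \<in> jacobian_ideal f"
  shows "\<exists>v. wronskian (standard_basis F) 1 v $ 0 = l"
proof -
  obtain \<alpha> \<beta> where "l = \<alpha> * deriv_x f + \<beta> * deriv_y f"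
    using l by (auto simp: jacobian_ideal_def gen_ideal_2)
  moreover have "hamiltonian F (left_incl (fps_const \<beta>) * gen_x - left_incl (fps_const \<alpha>) * gen_y)
      = fps_const \<beta> * pd_y F + fps_const \<alpha> * pd_x F"
  proof -
    have "d1_on_diag (p - q) = d1_on_diag p - d1_on_diag q" "d2_on_diag (p - q) = d2_on_diag p - d2_on_diag q"
      for p q :: "'a ser_two"
      by (simp_all add: d1_on_diag_def d2_on_diag_def pd_diff on_diag_diff)
    then show ?thesis by (simp add: hamiltonian_def d_on_diag_mult del: fps_const_neg)
  qed
  moreover have "hamiltonian F 1 = 0" by (simp add: hamiltonian_def)
  ultimately show ?thesis
    by (intro exI[of _ "left_incl (fps_const \<beta>) * gen_x - left_incl (fps_const \<alpha>) * gen_y"])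
      (simp add: wronskian_def pd_x_def pd_y_def F0)
qed

section \<open>General deformations\<close>

text \<open>No nonzero element of A kills df, because (f, f_x, f_y) contains a power of m; so df
  \<mapsto> 1 defines a homomorphism \<chi>. If all \<delta> i and both partials lay in the maximal
  ideal, then so would the value at df of every combination of the \<psi> i plus an extendable map,
  whereas \<chi> has value 1.\<close>

lemma def1_basis_unit:
  fixes f :: "'k::field ser_xy"
  assumes f: "planar_icis f" and \<delta>: "def1_basis f d \<delta>"
  shows "(\<exists>i<d. \<delta> i $ 0 $ 0 \<noteq> 0) \<or> deriv_x f dvd 1 \<or> deriv_y f dvd 1"
proof (rule ccontr)
  assume "\<not> ?thesis"
  then have small: "\<And>i. i < d \<Longrightarrow> \<delta> i $ 0 $ 0 = 0" "deriv_x f $ 0 $ 0 = 0" "deriv_y f $ 0 $ 0 = 0"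
    using ser_unitI by blast+
  let ?I = "gen_ideal {f}"
  obtain \<psi> where \<psi>: "\<And>i. i < d \<Longrightarrow> \<psi> i (deriv_x f, deriv_y f) - \<delta> i \<in> ?I"
    and basis: "basis_mod (\<lambda>c \<psi> p. const_xy c * \<psi> p) {0} (hom_df f) (extendable_df f) d \<psi>"
    using \<delta> by (auto simp: def1_basis_def)
  obtain N where N: "max_power N \<subseteq> gen_ideal {f, deriv_x f, deriv_y f}"
    using f max_power_in_ideal_of_finite_colength unfolding planar_icis_def by blast
  have dvd: "u \<in> ?I \<longleftrightarrow> f dvd u" for u by (auto simp: gen_ideal_1 dvd_def mult.commute)
  have ann: "g \<in> ?I" if "g * deriv_x f \<in> ?I" "g * deriv_y f \<in> ?I" for g
  proof -
    have d: "f dvd g * deriv_x f" "f dvd g * deriv_y f" using that by (simp_all only: dvd)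
    have "f dvd g"
    proof (rule dvd_of_multiples[OF N])
      fix s assume "s \<in> {f, deriv_x f, deriv_y f}"
      then show "f dvd g * s" using d by (elim insertE) simp_all
    qed
    then show ?thesis by (simp only: dvd)
  qed
  define D where "D p g \<longleftrightarrow> fst p - g * deriv_x f \<in> ?I \<and> snd p - g * deriv_y f \<in> ?I" for p g
  have D_unique: "g - g' \<in> ?I" if "D p g" "D p g'" for p g g'
  proof (rule ann)
    have "(g - g') * deriv_x f = (fst p - g' * deriv_x f) - (fst p - g * deriv_x f)"
      and "(g - g') * deriv_y f = (snd p - g' * deriv_y f) - (snd p - g * deriv_y f)"
      by (simp_all add: algebra_simps)
    with that show "(g - g') * deriv_x f \<in> ?I" "(g - g') * deriv_y f \<in> ?I"
      unfolding D_def by (metis gen_ideal_diff)+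
  qed
  define \<chi> where "\<chi> p = (SOME g. D p g)" for p
  have \<chi>: "D p (\<chi> p)" if "p \<in> df_module f" for p
    using that unfolding \<chi>_def by (intro someI_ex[of "D p"]) (auto simp: df_module_def D_def)
  have \<chi>_unique: "\<chi> p - g \<in> ?I" if "D p g" for p g
    using D_unique[OF _ that, of "\<chi> p"] someI[of "D p", OF that] by (simp add: \<chi>_def)
  have "\<chi> \<in> hom_df f"
    unfolding hom_df_def hom_mod_def
  proof (intro CollectI conjI ballI allI)
    fix u v assume "u \<in> df_module f" "v \<in> df_module f"
    then have "D u (\<chi> u)" "D v (\<chi> v)" using \<chi> by auto
    then have "D (u + v) (\<chi> u + \<chi> v)"
      unfolding D_def using gen_ideal_add[of "fst u - \<chi> u * deriv_x f" "{f}" "fst v - \<chi> v * deriv_x f"]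
        gen_ideal_add[of "snd u - \<chi> u * deriv_y f" "{f}" "snd v - \<chi> v * deriv_y f"]
      by (simp add: algebra_simps)
    then show "\<chi> (u + v) - (\<chi> u + \<chi> v) \<in> ?I" by (rule \<chi>_unique)
  next
    fix r v assume "v \<in> df_module f"
    then have "D v (\<chi> v)" using \<chi> by auto
    then have "D (scale_pair r v) (r * \<chi> v)"
      unfolding D_def scale_pair_def using gen_ideal_mult[of "fst v - \<chi> v * deriv_x f" "{f}" r]
        gen_ideal_mult[of "snd v - \<chi> v * deriv_y f" "{f}" r]
      by (simp add: algebra_simps)
    then show "\<chi> (scale_pair r v) - r * \<chi> v \<in> ?I" by (rule \<chi>_unique)
  next
    fix v assume "v \<in> ?I \<times> ?I"
    then have "D v 0" by (auto simp: D_def)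
    from \<chi>_unique[OF this] show "\<chi> v \<in> ?I" by simp
  qed
  then obtain c where c: "\<chi> - (\<Sum>i<d. (\<lambda>p. const_xy (c i) * \<psi> i p)) \<in> extendable_df f"
    using basis unfolding basis_mod_def by blast
  let ?df = "(deriv_x f, deriv_y f)"
  have df: "D ?df 1" by (simp add: D_def gen_ideal_zero)
  then have "?df \<in> df_module f" by (auto simp: df_module_def D_def intro!: exI[of _ 1])
  moreover obtain \<alpha> \<beta> where "\<forall>(u, v)\<in>df_module f. (\<chi> - (\<Sum>i<d. (\<lambda>p. const_xy (c i) * \<psi> i p))) (u, v) - (\<alpha> * u + \<beta> * v) \<in> ?I"
    using c by (auto simp: extendable_df_def)
  ultimately have 1: "(\<chi> - (\<Sum>i<d. (\<lambda>p. const_xy (c i) * \<psi> i p))) ?df - (\<alpha> * deriv_x f + \<beta> * deriv_y f) \<in> ?I"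
    by blast
  have fun_sum: "(\<Sum>i<m. (\<lambda>p. const_xy (c i) * \<psi> i p)) q = (\<Sum>i<m. const_xy (c i) * \<psi> i q)" for m q
    by (induction m) auto
  have vanish: "u $ 0 $ 0 = 0" if "u \<in> ?I" for u
    using that f by (auto simp: gen_ideal_1 nth00_mult planar_icis_def)
  have "\<chi> ?df $ 0 $ 0 = 1" using vanish[OF \<chi>_unique[OF df]] by simp
  moreover have "\<psi> i ?df $ 0 $ 0 = 0" if "i < d" for i
    using vanish[OF \<psi>[OF that]] small(1)[OF that] by simp
  ultimately have "((\<chi> - (\<Sum>i<d. (\<lambda>p. const_xy (c i) * \<psi> i p))) ?df - (\<alpha> * deriv_x f + \<beta> * deriv_y f)) $ 0 $ 0 = 1"
    by (simp add: fun_sum fps_sum_nth nth00_mult small del: deriv_x_nth)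
  with vanish[OF 1] show False by simp
qed

section \<open>Zariski-open sets of parameters\<close>

lemma poly_funs_on_line:
  fixes p :: "(nat \<Rightarrow> 'k::comm_ring_1) \<Rightarrow> 'k"
  assumes "p \<in> poly_funs d"
  shows "\<exists>P. \<forall>s. p (\<lambda>i. if i < d then a i + s * v i else undefined) = poly P s"
  using assms
proof induction
  case (const c)
  show ?case by (intro exI[of _ "[:c:]"]) simp
next
  case (coord i)
  then show ?case by (intro exI[of _ "[:a i, v i:]"]) simp
next
  case (add p q)
  then obtain P Q where "\<forall>s. p (\<lambda>i. if i < d then a i + s * v i else undefined) = poly P s"
    "\<forall>s. q (\<lambda>i. if i < d then a i + s * v i else undefined) = poly Q s" by blast
  then show ?case by (intro exI[of _ "P + Q"]) simp
next
  case (mult p q)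
  then obtain P Q where "\<forall>s. p (\<lambda>i. if i < d then a i + s * v i else undefined) = poly P s"
    "\<forall>s. q (\<lambda>i. if i < d then a i + s * v i else undefined) = poly Q s" by blast
  then show ?case by (intro exI[of _ "P * Q"]) simp
qed

text \<open>Irreducibility of affine space: on the line through \<open>a\<close> and
  \<open>b\<close> both functions become nonzero polynomials in one variable, which over an infinite
  field have a common nonzero. Entries beyond \<open>d\<close> are \<open>undefined\<close>, as
  \<open>param_space\<close> demands.\<close>

lemma poly_funs_nonvanishing:
  fixes p q :: "(nat \<Rightarrow> 'k::field_char_0) \<Rightarrow> 'k"
  assumes "p \<in> poly_funs d" "q \<in> poly_funs d" and a: "a \<in> param_space d" "p a \<noteq> 0"
    and b: "b \<in> param_space d" "q b \<noteq> 0"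
  shows "\<exists>c\<in>param_space d. p c \<noteq> 0 \<and> q c \<noteq> 0"
proof -
  define L where "L s = (\<lambda>i. if i < d then a i + s * (b i - a i) else undefined)" for s
  obtain P Q where P: "\<And>s. p (L s) = poly P s" and Q: "\<And>s. q (L s) = poly Q s"
    using poly_funs_on_line[OF assms(1), of a "\<lambda>i. b i - a i"]
      poly_funs_on_line[OF assms(2), of a "\<lambda>i. b i - a i"] unfolding L_def by blast
  have "L 0 = a" "L 1 = b"
    using a(1) b(1) by (auto simp: L_def param_space_def PiE_def extensional_def fun_eq_iff)
  then have "P \<noteq> 0" "Q \<noteq> 0" using P[of 0] Q[of 1] a b by auto
  then have "finite {s. poly (P * Q) s = 0}" by (intro poly_roots_finite) simp
  then have "{s. poly (P * Q) s = 0} \<noteq> UNIV" using infinite_UNIV_char_0 by metis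
  then obtain s where "poly P s \<noteq> 0" "poly Q s \<noteq> 0" by auto
  moreover have "L s \<in> param_space d" by (auto simp: L_def param_space_def PiE_def extensional_def)
  ultimately show ?thesis using P Q by metis
qed

lemma zariski_open_nonvanishing: "p \<in> poly_funs d \<Longrightarrow> zariski_open d {a \<in> param_space d. p a \<noteq> 0}"
  unfolding zariski_open_def by (intro exI[of _ "{p}"]) auto

lemma zariski_dense_nonvanishing:
  fixes p :: "(nat \<Rightarrow> 'k::field_char_0) \<Rightarrow> 'k"
  assumes "p \<in> poly_funs d" "b \<in> param_space d" "p b \<noteq> 0"
  shows "zariski_dense d {a \<in> param_space d. p a \<noteq> 0}"
  unfolding zariski_dense_def
proof (intro allI impI)
  fix V :: "(nat \<Rightarrow> 'k) set" assume "zariski_open d V \<and> V \<noteq> {}"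
  then obtain P q a where V: "V = {a \<in> param_space d. \<exists>p\<in>P. p a \<noteq> 0}" "P \<subseteq> poly_funs d" "q \<in> P" "a \<in> param_space d" "q a \<noteq> 0"
    by (auto simp: zariski_open_def)
  then obtain c where "c \<in> param_space d" "q c \<noteq> 0" "p c \<noteq> 0"
    using poly_funs_nonvanishing[of q d p a b] assms by blast
  then show "{a \<in> param_space d. p a \<noteq> 0} \<inter> V \<noteq> {}" using V by blast
qed

lemma linear_poly_fun: "(\<lambda>a. \<Sum>i<m. a i * c i) \<in> poly_funs d" if "m \<le> d" for c :: "nat \<Rightarrow> 'k::comm_ring_1"
  using that
proof (induction m)
  case 0
  show ?case using poly_funs.const[of 0 d] by simp
next
  case (Suc m)
  then have "(\<lambda>a. (\<Sum>i<m. a i * c i) + a m * c m) \<in> poly_funs d"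
    by (intro poly_funs.add poly_funs.mult poly_funs.coord poly_funs.const) auto
  then show ?case by simp
qed

lemma deformation_eq_nth_0: "deformation_eq f d \<delta> a $ 0 = f"
  by (simp add: deformation_eq_def)

text \<open>If some \<delta> i is a unit, then the first-order term is a unit off the hyperplane
  \<open>lin a = 0\<close>, and the i-th unit vector \<open>b\<close> lies off it. Otherwise
  \<open>f\<close> is smooth and every parameter works, also when \<open>d\<close> is 0.\<close>

lemma general_hamiltonian_generates:
  fixes f :: "'k::field_char_0 ser_xy"
  assumes f: "planar_icis f" and \<delta>: "def1_basis f d \<delta>"
  shows "\<exists>U. zariski_open d U \<and> zariski_dense d U \<and> U \<noteq> {} \<and> U \<subseteq> param_space d \<and>
    (\<forall>a\<in>U. hamiltonian_generates (deformation_eq f d \<delta> a))"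
proof (cases "\<exists>i<d. \<delta> i $ 0 $ 0 \<noteq> 0")
  case True
  then obtain i where i: "i < d" "\<delta> i $ 0 $ 0 \<noteq> 0" by blast
  define lin where "lin a = (\<Sum>i<d. a i * \<delta> i $ 0 $ 0)" for a
  define b :: "nat \<Rightarrow> 'k" where "b j = (if j < d then if j = i then 1 else 0 else undefined)" for j :: nat
  have b: "b \<in> param_space d" by (auto simp: param_space_def b_def PiE_def extensional_def)
  have "lin b = (\<Sum>j<d. if j = i then \<delta> i $ 0 $ 0 else 0)"
    unfolding lin_def by (intro sum.cong) (auto simp: b_def)
  then have b': "lin b \<noteq> 0" using i by simp
  have lin: "lin \<in> poly_funs d" unfolding lin_def by (rule linear_poly_fun) simp
  have "hamiltonian_generates (deformation_eq f d \<delta> a)" if "lin a \<noteq> 0" for a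
  proof -
    have "(\<Sum>i<d. const_xy (a i) * \<delta> i) dvd 1"
      using that by (intro ser_unitI) (simp add: lin_def fps_sum_nth const_xy_nth)
    then show ?thesis unfolding deformation_eq_def by (rule hamiltonian_generates_smoothing[OF f])
  qed
  then show ?thesis
    using zariski_open_nonvanishing[OF lin] zariski_dense_nonvanishing[OF lin b b'] b b'
    by (intro exI[of _ "{a \<in> param_space d. lin a \<noteq> 0}"]) blast
next
  case False
  then have unit: "deriv_x f dvd 1 \<or> deriv_y f dvd 1" using def1_basis_unit[OF f \<delta>] by blast
  define b :: "nat \<Rightarrow> 'k" where "b j = (if j < d then 0 else undefined)" for j
  have b: "b \<in> param_space d" by (auto simp: param_space_def b_def PiE_def extensional_def)
  have one: "(\<lambda>_. 1 :: 'k) \<in> poly_funs d" by (rule poly_funs.const)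
  have "hamiltonian_generates (deformation_eq f d \<delta> a)" for a
  proof (rule hamiltonian_generates_smooth)
    have "pd_x (deformation_eq f d \<delta> a) $ 0 = deriv_x f" "pd_y (deformation_eq f d \<delta> a) $ 0 = deriv_y f"
      by (simp_all add: pd_x_def pd_y_def deformation_eq_nth_0)
    then show "pd_x (deformation_eq f d \<delta> a) dvd 1 \<or> pd_y (deformation_eq f d \<delta> a) dvd 1"
      using unit by (metis fps_unitI)
  qed
  then show ?thesis
    using zariski_open_nonvanishing[OF one] zariski_dense_nonvanishing[OF one b] b
    by (intro exI[of _ "{a \<in> param_space d. (1 :: 'k) \<noteq> 0}"]) auto
qed

section \<open>Automatic degeneracy and limiting inflection points\<close>

theorem theorem6p5p4:
  fixes f :: "'k::{alg_closed_field, field_char_0} ser_xy"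
    and \<delta> :: "nat \<Rightarrow> 'k ser_xy" and d :: nat
  assumes "planar_icis f" and "def1_basis f d \<delta>"
  shows "convergent (normalized_jacobian_length f) \<and>
    ereal_of_enat (automatic_degeneracy 2 f d \<delta>) = jacobian_multiplicity f \<and>
    for_general_params d (\<lambda>a.
      (\<exists>e \<tau>. attains_degeneracy 2 f d \<delta> a e \<tau>) \<and>
      (\<forall>e \<tau>. attains_degeneracy 2 f d \<delta> a e \<tau> \<longrightarrow>
        ereal_of_enat (limiting_inflection_points 2 (deformation_eq f d \<delta> a) e \<tau>)
          = jacobian_multiplicity f))"
proof -
  obtain l n where l: "l \<in> jacobian_ideal f" "quot_dim scale_xy (gen_ideal {f, l}) = enat n"
    and min: "\<And>l'. l' \<in> jacobian_ideal f \<Longrightarrow> enat n \<le> quot_dim scale_xy (gen_ideal {f, l'})"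
    and lim: "normalized_jacobian_length f \<longlonglongrightarrow> ereal (real n)"
    using jacobian_multiplicity_eq_min[OF assms(1)] by blast
  have mult: "jacobian_multiplicity f = ereal (real n)"
    unfolding jacobian_multiplicity_def using lim by (rule limI)
  obtain U where U: "zariski_open d U" "zariski_dense d U" "U \<noteq> {}" "U \<subseteq> param_space d"
    and gens: "\<And>a. a \<in> U \<Longrightarrow> hamiltonian_generates (deformation_eq f d \<delta> a)"
    using general_hamiltonian_generates[OF assms] by blast
  \<comment> \<open>This bound covers every parameter with a free dual and every basis of it, as the
    infimum requires; only \<open>attained\<close> needs a general parameter.\<close>
  have lower: "enat n \<le> special_fibre_length 2 (deformation_eq f d \<delta> a) e \<tau>"
    if e: "dual_basis 2 (deformation_eq f d \<delta> a) e" for a e \<tau>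
  proof -
    obtain l' where "l' \<in> jacobian_ideal f"
      "gen_ideal {f, wronskian e (\<tau> 0) (\<tau> 1) $ 0} = gen_ideal {f, l'}"
      using wronskian_of_dual_basis[OF assms(1) deformation_eq_nth_0 e] by blast
    then show ?thesis using min by (simp add: special_fibre_length_2 deformation_eq_nth_0)
  qed
  have attained: "\<exists>e \<tau>. dual_basis 2 (deformation_eq f d \<delta> a) e \<and>
      special_fibre_length 2 (deformation_eq f d \<delta> a) e \<tau> = enat n" if "a \<in> U" for a
  proof -
    let ?F = "deformation_eq f d \<delta> a"
    obtain v where v: "wronskian (standard_basis ?F) 1 v $ 0 = l"
      using wronskian_attains[OF deformation_eq_nth_0 l(1)] by blast
    define \<tau> where "\<tau> i = (if i = 0 then 1 else v)" for i :: nat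
    have "special_fibre_length 2 ?F (standard_basis ?F) \<tau> = enat n"
      using v l(2) by (simp add: special_fibre_length_2 deformation_eq_nth_0 \<tau>_def)
    then show ?thesis using standard_dual_basis[OF gens[OF that]] by blast
  qed
  obtain a0 where a0: "a0 \<in> U" using U(3) by blast
  obtain e0 \<tau>0 where e0: "dual_basis 2 (deformation_eq f d \<delta> a0) e0"
    "special_fibre_length 2 (deformation_eq f d \<delta> a0) e0 \<tau>0 = enat n"
    using attained[OF a0] by blast
  have AD: "automatic_degeneracy 2 f d \<delta> = enat n"
    unfolding automatic_degeneracy_def
  proof (rule antisym)
    show "Inf {special_fibre_length 2 (deformation_eq f d \<delta> a) e \<tau> |a e \<tau>.
        a \<in> param_space d \<and> dual_basis 2 (deformation_eq f d \<delta> a) e} \<le> enat n"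
      using a0 e0 U(4)
      by (intro Inf_lower CollectI exI[of _ a0] exI[of _ e0] exI[of _ \<tau>0]) auto
    show "enat n \<le> Inf {special_fibre_length 2 (deformation_eq f d \<delta> a) e \<tau> |a e \<tau>.
        a \<in> param_space d \<and> dual_basis 2 (deformation_eq f d \<delta> a) e}"
      using lower by (intro Inf_greatest) auto
  qed
  have nonunit: "\<not> f dvd 1"
  proof
    assume "f dvd 1"
    then obtain g where "1 = f * g" by (rule dvdE)
    then have "(1 :: 'k ser_xy) $ 0 $ 0 = (f * g) $ 0 $ 0" by simp
    then show False using assms(1) by (simp add: nth00_mult planar_icis_def)
  qed
  \<comment> \<open>Attaining the minimum makes the special fibre finite, of length
    \<open>n\<close>; flatness carries this length to the generic fibre, whatever \<open>e\<close>
    and \<tau> are.\<close>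
  have limiting: "limiting_inflection_points 2 (deformation_eq f d \<delta> a) e \<tau> = enat n"
    if "attains_degeneracy 2 f d \<delta> a e \<tau>" for a e \<tau>
    unfolding limiting_inflection_points_def inflection_ideal_2
  proof (rule base_change_dim_flat)
    show "quot_dim scale_xy (gen_ideal {deformation_eq f d \<delta> a $ 0, wronskian e (\<tau> 0) (\<tau> 1) $ 0}) = enat n"
      using that by (simp add: attains_degeneracy_def AD special_fibre_length_2)
  qed (use nonunit in \<open>simp_all add: deformation_eq_nth_0 to_geometric_generic_def fls_times_fps_to_fls\<close>)
  have "for_general_params d (\<lambda>a.
      (\<exists>e \<tau>. attains_degeneracy 2 f d \<delta> a e \<tau>) \<and>
      (\<forall>e \<tau>. attains_degeneracy 2 f d \<delta> a e \<tau> \<longrightarrow>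
        ereal_of_enat (limiting_inflection_points 2 (deformation_eq f d \<delta> a) e \<tau>)
          = jacobian_multiplicity f))"
    unfolding for_general_params_def
  proof (intro exI[of _ U] conjI ballI allI impI U(1,2))
    fix a assume "a \<in> U"
    then show "\<exists>e \<tau>. attains_degeneracy 2 f d \<delta> a e \<tau>"
      using attained unfolding attains_degeneracy_def AD by blast
  qed (simp add: limiting mult)
  moreover have "convergent (normalized_jacobian_length f)" using lim by (auto simp: convergent_def)
  ultimately show ?thesis by (simp add: AD mult)
qed

end
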